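(* Let $G=\Gamma$ be the fundamental group of a closed Riemann surface of genus $g>1$, let $G/H=\mathbb Z^{2g}$ be the abelianisation of $\Gamma$ with quotient map $p:\Gamma\to\mathbb Z^{2g}$, so that $H=F$, the commutator subgroup, is a free group. Let $\sigma$ be any multiplier on $\Gamma$, let $A\in M_d(\mathbb C(\Gamma,\sigma))$ be self-adjoint as an operator on $l^2(\Gamma)^d$, let $\{X_m\}_{m\ge1}$ be a F\o{}lner exhaustion of $\mathbb Z^{2g}$, and put $A^{(m)}=P_{X_m}A|_{\mathcal H_{X_m}}$. Then, with $F_m(\lambda)=\tau_{X_m}(\chi_{(-\infty,\lambda]}(A^{(m)}))$ and $F(\lambda)=\tau(\chi_{(-\infty,\lambda]}(A))$, $$\lim_{m\to\infty}F_m(\lambda)=F(\lambda)\qquad\text{for all }\lambda\in\mathbb R.$$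
   Context: A multiplier on a discrete group $G$ is a normalized 2-cocycle $\sigma:G\times G\to U(1)$: $\sigma(b,c)\sigma(a,bc)=\sigma(ab,c)\sigma(a,b)$, $\sigma(1,g)=\sigma(g,1)=1$. $\mathbb C(G,\sigma)$ is the twisted group algebra: finite sums $\sum a_g g$ with $(\sum a_g g)(\sum b_h h)=\sum_k\big(\sum_{gh=k}a_gb_h\sigma(g,h)\big)k$. $A\in M_d(\mathbb C(G,\sigma))$, with matrices of coefficients $A(g)\in M_d(\mathbb C)$, acts on $f\in l^2(G)^d$ by $(Af)(x)=\sum_{h\in G}A(xh^{-1})\sigma(xh^{-1},h)f(h)$. $\tau$ is the trace on $W_L^*(G,\sigma)\otimes M_d(\mathbb C)$ given by $\tau(B)=\sum_{a=1}^d(B_{a,a}\delta_e,\delta_e)$, where $W_L^*(G,\sigma)$ is the von Neumann algebra generated by the left translations $(L^\sigma_gf)(x)=f(g^{-1}x)\sigma(g,g^{-1}x)$ on $l^2(G)$. For a finite non-empty subset $X\subset G/H$: $\mathcal H_X=l^2(p^{-1}(X))^d\subset l^2(G)^d$ is the subspace of functions supported on $p^{-1}(X)$ and $P_X$ is the orthogonal projection onto it. Fix a right inverse $s:G/H\to G$ of $p$. For a bounded operator $B$ on $\mathcal H_X$ with components $(B_{a,b})_{g,k}$ ($a,b=1,\dots,d$; matrix entries with respect to the standard orthonormal basis), $$\tau_X(B)=\frac1{\#X}\sum_{a=1}^d\sum_{x\in X}(B_{a,a})_{s(x),s(x)}.$$ A F\o{}lner exhaustion of $G/H$ is an exhaustion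 by finite subsets $X_1\subset X_2\subset\cdots$ with $\bigcup_mX_m=G/H$ such that for each fixed $\delta>0$, $\#\partial_\delta X_m/\#X_m\to0$, where $\partial_\delta X_m$ is the set of points of $(G/H)\setminus X_m$ at word-metric distance at most $\delta$ from $X_m$. $\chi_{(-\infty,\lambda]}$ is applied by the Borel functional calculus. *)

theory Defs
  imports "HOL-Homology.Homology" "HOL-Analysis.Analysis"
begin

section \<open>Closed Riemann surfaces and their fundamental groups\<close>

definition complex_atlas :: "'x topology \<Rightarrow> ('x set \<times> ('x \<Rightarrow> complex)) set \<Rightarrow> bool" where
  "complex_atlas X \<A> \<longleftrightarrow>
     (\<forall>(U, \<phi>) \<in> \<A>. openin X U \<and> open (\<phi> ` U) \<and>
        homeomorphic_map (subtopology X U) (top_of_set (\<phi> ` U)) \<phi>) \<and>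
     (\<Union>(U, \<phi>) \<in> \<A>. U) = topspace X \<and>
     (\<forall>(U, \<phi>) \<in> \<A>. \<forall>(V, \<psi>) \<in> \<A>.
        (\<lambda>z. \<psi> (inv_into U \<phi> z)) holomorphic_on (\<phi> ` (U \<inter> V)))"

text \<open>Second countability is not listed: it follows from compactness and the existence of charts.\<close>

definition closed_riemann_surface :: "'x topology \<Rightarrow> ('x set \<times> ('x \<Rightarrow> complex)) set \<Rightarrow> bool" where
  "closed_riemann_surface X \<A> \<longleftrightarrow>
     topspace X \<noteq> {} \<and> connected_space X \<and> Hausdorff_space X \<and> compact_space X \<and>
     complex_atlas X \<A>"

text \<open>\<open>free_Abelian_group {..<n}\<close> is the library's $\mathbb{Z}^n$, written multiplicatively as a
  \<open>monoid\<close> record. The (topological) genus of a closed Riemann surface is half its first Betti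
  number.\<close>

abbreviation int_lattice :: "nat \<Rightarrow> (nat \<Rightarrow>\<^sub>0 int) monoid" where
  "int_lattice n \<equiv> free_Abelian_group {..<n}"

definition has_genus :: "'x topology \<Rightarrow> nat \<Rightarrow> bool" where
  "has_genus X g \<longleftrightarrow> homology_group 1 X \<cong> int_lattice (2 * g)"

definition loops :: "'x topology \<Rightarrow> 'x \<Rightarrow> (real \<Rightarrow> 'x) set" where
  "loops X x0 = {c. pathin X c \<and> c 0 = x0 \<and> c 1 = x0}"

definition loop_homotopy :: "'x topology \<Rightarrow> 'x \<Rightarrow> ((real \<Rightarrow> 'x) \<times> (real \<Rightarrow> 'x)) set" where
  "loop_homotopy X x0 = {(c, c'). c \<in> loops X x0 \<and> c' \<in> loops X x0 \<and>
     homotopic_with (\<lambda>h. h 0 = x0 \<and> h 1 = x0) (top_of_set {0..1}) X c c'}"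

definition loop_concat :: "(real \<Rightarrow> 'x) \<Rightarrow> (real \<Rightarrow> 'x) \<Rightarrow> real \<Rightarrow> 'x" where
  "loop_concat c c' t = (if t \<le> 1/2 then c (2 * t) else c' (2 * t - 1))"

definition fundamental_group :: "'x topology \<Rightarrow> 'x \<Rightarrow> (real \<Rightarrow> 'x) set monoid" where
  "fundamental_group X x0 =
     \<lparr>carrier = loops X x0 // loop_homotopy X x0,
      monoid.mult = (\<lambda>C C'. \<Union>c\<in>C. \<Union>c'\<in>C'. loop_homotopy X x0 `` {loop_concat c c'}),
      one = loop_homotopy X x0 `` {\<lambda>_. x0}\<rparr>"

section \<open>Word metrics and Foelner exhaustions\<close>

definition finite_generating_set :: "('z, 'm) monoid_scheme \<Rightarrow> 'z set \<Rightarrow> bool" where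
  "finite_generating_set Z S \<longleftrightarrow> finite S \<and> S \<subseteq> carrier Z \<and> generate Z S = carrier Z"

definition word_dist :: "('z, 'm) monoid_scheme \<Rightarrow> 'z set \<Rightarrow> 'z \<Rightarrow> 'z \<Rightarrow> nat" where
  "word_dist Z S x y =
     (LEAST n. \<exists>ws. length ws = n \<and> set ws \<subseteq> S \<union> m_inv Z ` S \<and>
        y = x \<otimes>\<^bsub>Z\<^esub> foldr (\<otimes>\<^bsub>Z\<^esub>) ws \<one>\<^bsub>Z\<^esub>)"

definition outer_boundary :: "('z, 'm) monoid_scheme \<Rightarrow> 'z set \<Rightarrow> real \<Rightarrow> 'z set \<Rightarrow> 'z set" where
  "outer_boundary Z S \<delta> X =
     {y \<in> carrier Z - X. \<exists>x\<in>X. real (word_dist Z S x y) \<le> \<delta>}"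

definition folner_exhaustion ::
    "('z, 'm) monoid_scheme \<Rightarrow> 'z set \<Rightarrow> (nat \<Rightarrow> 'z set) \<Rightarrow> bool" where
  "folner_exhaustion Z S X \<longleftrightarrow>
     (\<forall>m. finite (X m) \<and> X m \<noteq> {} \<and> X m \<subseteq> X (Suc m)) \<and>
     (\<Union>m. X m) = carrier Z \<and>
     (\<forall>\<delta>>0. (\<lambda>m. real (card (outer_boundary Z S \<delta> (X m))) / real (card (X m)))
               \<longlonglongrightarrow> 0)"

section \<open>Bounded operators on $l^2(S)^d$\<close>

text \<open>For a subset \<open>S\<close> of the group, $l^2(S)^d$ is the space of square-summable functions with
  values in \<open>complex ^ 'd\<close> that vanish outside \<open>S\<close>; in this way $l^2(S)^d$ is literally a subspace
  of $l^2(G)^d$. Operators on it are HOL functions of which only the values on \<open>l2 S\<close> matter.\<close>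

type_synonym ('g, 'd) vfun = "'g \<Rightarrow> complex ^ 'd"
type_synonym ('g, 'd) oper = "('g, 'd) vfun \<Rightarrow> ('g, 'd) vfun"

definition l2 :: "'g set \<Rightarrow> ('g, 'd::finite) vfun set" where
  "l2 S = {f. (\<forall>x. x \<notin> S \<longrightarrow> f x = 0) \<and> (\<lambda>x. (norm (f x))\<^sup>2) summable_on S}"

definition l2_inner :: "('g, 'd::finite) vfun \<Rightarrow> ('g, 'd) vfun \<Rightarrow> complex" where
  "l2_inner f h = (\<Sum>\<^sub>\<infinity>x. \<Sum>a\<in>UNIV. f x $ a * cnj (h x $ a))"

definition l2_norm :: "('g, 'd::finite) vfun \<Rightarrow> real" where
  "l2_norm f = sqrt (\<Sum>\<^sub>\<infinity>x. (norm (f x))\<^sup>2)"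

definition bounded_operator_on :: "'g set \<Rightarrow> ('g, 'd::finite) oper \<Rightarrow> bool" where
  "bounded_operator_on S T \<longleftrightarrow>
     (\<forall>f\<in>l2 S. T f \<in> l2 S) \<and>
     (\<forall>f\<in>l2 S. \<forall>h\<in>l2 S. T (\<lambda>x. f x + h x) = (\<lambda>x. T f x + T h x)) \<and>
     (\<forall>c. \<forall>f\<in>l2 S. T (\<lambda>x. c *s f x) = (\<lambda>x. c *s T f x)) \<and>
     (\<exists>K. \<forall>f\<in>l2 S. l2_norm (T f) \<le> K * l2_norm f)"

definition self_adjoint_on :: "'g set \<Rightarrow> ('g, 'd::finite) oper \<Rightarrow> bool" where
  "self_adjoint_on S T \<longleftrightarrow>
     bounded_operator_on S T \<and> (\<forall>f\<in>l2 S. \<forall>h\<in>l2 S. l2_inner (T f) h = l2_inner f (T h))"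

definition orthogonal_projection_onto :: "('g, 'd::finite) vfun set \<Rightarrow> ('g, 'd) oper" where
  "orthogonal_projection_onto V f =
     (THE v. v \<in> V \<and> (\<forall>w\<in>V. l2_inner (\<lambda>x. f x - v x) w = 0))"

section \<open>Borel functional calculus\<close>

text \<open>The scalar measure $B \mapsto (E(B)f, f)$ of a projection-valued measure \<open>E\<close> on the line.\<close>

definition scalar_measure :: "(real set \<Rightarrow> ('g, 'd::finite) oper) \<Rightarrow> ('g, 'd) vfun \<Rightarrow> real measure" where
  "scalar_measure E f =
     measure_of UNIV (sets borel) (\<lambda>B. ennreal (Re (l2_inner (E B f) f)))"

definition projection_valued_measure ::
    "'g set \<Rightarrow> (real set \<Rightarrow> ('g, 'd::finite) oper) \<Rightarrow> bool" where
  "projection_valued_measure S E \<longleftrightarrow>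
     (\<forall>B\<in>sets borel. self_adjoint_on S (E B)) \<and>
     (\<forall>B\<in>sets borel. \<forall>C\<in>sets borel. \<forall>f\<in>l2 S. E (B \<inter> C) f = E B (E C f)) \<and>
     (\<forall>f\<in>l2 S. E UNIV f = f) \<and>
     (\<forall>B :: nat \<Rightarrow> real set. range B \<subseteq> sets borel \<longrightarrow> disjoint_family B \<longrightarrow>
        (\<forall>f\<in>l2 S. (\<lambda>n. l2_norm (\<lambda>x. E (\<Union>i. B i) f x - (\<Sum>i<n. E (B i) f x)))
                     \<longlonglongrightarrow> 0))"

text \<open>$T = \int t\,dE(t)$, stated through its quadratic form, which by polarization determines the
  operator. The boundedness of the support makes the integral absolutely convergent.\<close>

definition spectral_resolution ::
    "'g set \<Rightarrow> ('g, 'd::finite) oper \<Rightarrow> (real set \<Rightarrow> ('g, 'd) oper) \<Rightarrow> bool" where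
  "spectral_resolution S T E \<longleftrightarrow>
     projection_valued_measure S E \<and>
     (\<exists>R. \<forall>f\<in>l2 S. E {-R..R} f = f) \<and>
     (\<forall>f\<in>l2 S. l2_inner (T f) f = (LINT t|scalar_measure E f. complex_of_real t))"

text \<open>$\varphi(T) = \int \varphi(t)\,dE(t)$ for a bounded Borel function $\varphi$, where \<open>E\<close> is the
  spectral resolution of the bounded self-adjoint operator \<open>T\<close> on $l^2(S)^d$. By the spectral
  theorem both choices exist, and they are unique up to the irrelevant values outside \<open>l2 S\<close>
  and on non-Borel sets.\<close>

definition borel_calculus ::
    "'g set \<Rightarrow> ('g, 'd::finite) oper \<Rightarrow> (real \<Rightarrow> complex) \<Rightarrow> ('g, 'd) oper" where
  "borel_calculus S T \<phi> =
     (let E = (SOME E. spectral_resolution S T E)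
      in SOME Q. bounded_operator_on S Q \<and>
           (\<forall>f\<in>l2 S. l2_inner (Q f) f = (LINT t|scalar_measure E f. \<phi> t)))"

section \<open>Twisted group algebras and traces\<close>

definition multiplier :: "('g, 'm) monoid_scheme \<Rightarrow> ('g \<Rightarrow> 'g \<Rightarrow> complex) \<Rightarrow> bool" where
  "multiplier G \<sigma> \<longleftrightarrow>
     (\<forall>a\<in>carrier G. \<forall>b\<in>carrier G. cmod (\<sigma> a b) = 1) \<and>
     (\<forall>a\<in>carrier G. \<forall>b\<in>carrier G. \<forall>c\<in>carrier G.
        \<sigma> b c * \<sigma> a (b \<otimes>\<^bsub>G\<^esub> c) = \<sigma> (a \<otimes>\<^bsub>G\<^esub> b) c * \<sigma> a b) \<and>
     (\<forall>a\<in>carrier G. \<sigma> \<one>\<^bsub>G\<^esub> a = 1 \<and> \<sigma> a \<one>\<^bsub>G\<^esub> = 1)"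

text \<open>An element of $M_d(\mathbb{C}(G,\sigma))$ is given by its finitely many non-zero matrix
  coefficients $A(g)$. The underlying set does not involve the multiplier, which enters through
  the product and the action on $l^2(G)^d$.\<close>

definition group_algebra_matrices ::
    "('g, 'm) monoid_scheme \<Rightarrow> ('g \<Rightarrow> complex ^ 'd ^ 'd::finite) set" where
  "group_algebra_matrices G = {A. finite {g. A g \<noteq> 0} \<and> {g. A g \<noteq> 0} \<subseteq> carrier G}"

definition twisted_action ::
    "('g, 'm) monoid_scheme \<Rightarrow> ('g \<Rightarrow> 'g \<Rightarrow> complex) \<Rightarrow> ('g \<Rightarrow> complex ^ 'd ^ 'd::finite)
      \<Rightarrow> ('g, 'd) oper" where
  "twisted_action G \<sigma> A f x =
     (if x \<in> carrier G
      then \<Sum>\<^sub>\<infinity>h\<in>carrier G.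
             \<sigma> (x \<otimes>\<^bsub>G\<^esub> inv\<^bsub>G\<^esub> h) h *s (A (x \<otimes>\<^bsub>G\<^esub> inv\<^bsub>G\<^esub> h) *v f h)
      else 0)"

definition unit_vec :: "'g \<Rightarrow> 'd \<Rightarrow> ('g, 'd::finite) vfun" where
  "unit_vec g a = (\<lambda>x. if x = g then axis a 1 else 0)"

text \<open>The matrix entry $(B_{a,b})_{g,k}$ with respect to the standard orthonormal basis.\<close>

definition matrix_entry :: "('g, 'd::finite) oper \<Rightarrow> 'd \<Rightarrow> 'd \<Rightarrow> 'g \<Rightarrow> 'g \<Rightarrow> complex" where
  "matrix_entry B a b g k = l2_inner (B (unit_vec k b)) (unit_vec g a)"

text \<open>The trace of $W_L^*(G,\sigma) \otimes M_d(\mathbb{C})$. The formula makes sense for every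
  operator on $l^2(G)^d$, so the domain is not restricted to the von Neumann algebra.\<close>

definition vn_trace :: "('g, 'm) monoid_scheme \<Rightarrow> ('g, 'd::finite) oper \<Rightarrow> complex" where
  "vn_trace G B = (\<Sum>a\<in>UNIV. matrix_entry B a a \<one>\<^bsub>G\<^esub> \<one>\<^bsub>G\<^esub>)"

definition local_trace :: "('z \<Rightarrow> 'g) \<Rightarrow> 'z set \<Rightarrow> ('g, 'd::finite) oper \<Rightarrow> complex" where
  "local_trace s X B =
     1 / of_nat (card X) * (\<Sum>a\<in>UNIV. \<Sum>x\<in>X. matrix_entry B a a (s x) (s x))"

definition preimage :: "('g, 'm) monoid_scheme \<Rightarrow> ('g \<Rightarrow> 'z) \<Rightarrow> 'z set \<Rightarrow> 'g set" where
  "preimage G p X = {x \<in> carrier G. p x \<in> X}"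

definition compression :: "'g set \<Rightarrow> ('g, 'd::finite) oper \<Rightarrow> ('g, 'd) oper" where
  "compression S T f = orthogonal_projection_onto (l2 S) (T f)"

end

theory Submission
  imports Defs "HOL-Probability.Helly_Selection" "HOL-Probability.Probability_Mass_Function"
begin

text \<open>
  Write $\delta_{g,a}$ for the standard basis vectors and $\mu^T_v$ for the spectral measure of a
  bounded self-adjoint operator $T$ at a vector $v$. The functions $F_m$ and $F$ are the
  distribution functions of the averaged spectral measures
  $$\mu_m = \frac1{\#X_m}\sum_{x\in X_m}\sum_a \mu^{A^{(m)}}_{\delta_{s(x),a}}, \qquad
    \mu = \sum_a \mu^A_{\delta_{1,a}},$$
  all supported in one interval $[-R,R]$ with $R \ge \|A\|$. Convergence at every $\lambda$,
  including the jumps of $F$, combines two estimates.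

  Moments. The operator $A$ enlarges supports by a bounded amount only. Hence
  $(A^{(m)})^k\delta_{s(x),a} = A^k\delta_{s(x),a}$ unless $x$ is close to the complement of $X_m$,
  and the F\o{}lner condition makes the exceptional $x$ negligible. As $A$ commutes with the twisted
  right translations by the whole group, the diagonal entries of $A^k$ do not depend on the point
  (\<open>spectral_measure_homogeneous\<close>), so the moments of $\mu_m$ converge to those of $\mu$
  (\<open>moment_difference\<close>). By Weierstrass approximation,
  $\limsup \mu_m(-\infty,\lambda] \le \mu(-\infty,\lambda]$ and
  $\liminf \mu_m(-\infty,\lambda) \ge \mu(-\infty,\lambda)$.

  Atoms. It remains to see $\liminf \mu_m\{\lambda\} \ge \mu\{\lambda\}$
  (\<open>atom_lower_bound\<close>). If $Av = \lambda v$, then $A^{(m)}-\lambda$ maps the restriction of $v$ to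
  $p^{-1}(X_m)$ to a function that lives over the boundary of $X_m$. So, up to the dimension of the
  functions over the boundary, the kernel of $A^{(m)}-\lambda$ is at least as large as the space of
  these restrictions, whose dimension is at least $\#X_m\,\mu\{\lambda\}$. The spaces are infinite
  dimensional if $H = \ker p$ is infinite, and dimension means the trace
  $\sum_{x,a}\langle\,\cdot\,\delta_{s(x),a},\delta_{s(x),a}\rangle$ of the orthogonal projection.
  This functional is a trace on the operators that commute with the twisted right translations by
  $H$ (\<open>trace_symmetric\<close>), and rank and nullity can be compared because $C^*C$ and $CC^*$ have the
  same distribution with respect to a trace (\<open>kernel_trace_estimate\<close>).

  The spectral theorem is obtained through measures: the Hausdorff moment problem yields $\mu^T_v$,
  uniqueness of moments makes $\mu^T_v(B)$ a quadratic form in $v$, and the Riesz representation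
  turns it into a projection. This is done on real Hilbert spaces; multiplication by $i$ is then just
  one more operator that commutes with $T$. To have a single Hilbert space available as a type, the
  spaces $l^2(S)^d$ are embedded in \<open>ell2\<close>, operators being extended by $0$.
\<close>

section \<open>The Hausdorff moment problem\<close>

lemma bernstein_binomial_moment:
  fixes x :: "'a::comm_ring_1"
  assumes "j \<le> n"
  shows "(\<Sum>k\<le>n. of_nat (n choose k) * of_nat (k choose j) * (x ^ k * (1 - x) ^ (n - k)))
           = of_nat (n choose j) * x ^ j"
proof -
  let ?t = "\<lambda>k. of_nat (n choose k) * of_nat (k choose j) * (x ^ k * (1 - x) ^ (n - k)) :: 'a"
  have "(\<Sum>k\<le>n. ?t k) = (\<Sum>k\<in>{j..n}. ?t k)"
    by (rule sum.mono_neutral_right) (auto simp: binomial_eq_0)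
  also have "\<dots> = (\<Sum>i\<le>n - j. ?t (i + j))"
    using assms by (intro sum.reindex_bij_witness[of _ "\<lambda>i. i + j" "\<lambda>k. k - j"]) auto
  also have "\<dots> = (\<Sum>i\<le>n - j. of_nat (n choose j) * x ^ j
                     * (of_nat ((n - j) choose i) * x ^ i * (1 - x) ^ (n - j - i)))"
  proof (rule sum.cong[OF refl])
    fix i assume "i \<in> {..n - j}"
    then have "(n choose (i + j)) * ((i + j) choose j) = (n choose j) * ((n - j) choose i)"
      using choose_mult[of j "i + j" n] assms by auto
    then have "of_nat (n choose (i + j)) * of_nat ((i + j) choose j)
                 = (of_nat (n choose j) * of_nat ((n - j) choose i) :: 'a)"
      by (metis of_nat_mult)
    then show "?t (i + j) = of_nat (n choose j) * x ^ j
                     * (of_nat ((n - j) choose i) * x ^ i * (1 - x) ^ (n - j - i))"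
      by (simp add: power_add algebra_simps)
  qed
  also have "\<dots> = of_nat (n choose j) * x ^ j * (x + (1 - x)) ^ (n - j)"
    by (simp only: binomial_ring sum_distrib_left)
  finally show ?thesis by simp
qed

text \<open>The Bernstein weights are evaluated on binomial coefficients by the previous lemma, whereas
  moments are about powers; the two test functions differ by $O(1/n)$.\<close>

lemma binomial_ratio_approx:
  assumes "k \<le> n" "j < n"
  shows "\<bar>real (k choose j) / real (n choose j) - (real k / real n) ^ j\<bar>
           \<le> real j * (real j / real (n - j))"
proof -
  have ratio: "real (k choose j) / real (n choose j) = (\<Prod>i<j. real (k - i) / real (n - i))"
  proof (cases "j \<le> k")
    case True
    have "real (k choose j) = (\<Prod>i<j. real (k - i) / real (j - i))"
      using binomial_altdef_of_nat[OF True, where 'a=real] by (simp add: atLeast0LessThan)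
    moreover have "real (n choose j) = (\<Prod>i<j. real (n - i) / real (j - i))"
      using binomial_altdef_of_nat[of j n, where 'a=real] assms by (simp add: atLeast0LessThan)
    ultimately show ?thesis
      by (simp add: prod_dividef)
  next
    case False
    then have "(\<Prod>i<j. real (k - i) / real (n - i)) = 0"
      by (intro prod_zero) (auto intro!: bexI[of _ k])
    with False show ?thesis by (simp add: binomial_eq_0)
  qed
  have "norm ((\<Prod>i<j. real (k - i) / real (n - i)) - (\<Prod>i<j. real k / real n))
          \<le> (\<Sum>i<j. norm (real (k - i) / real (n - i) - real k / real n))"
    using assms by (intro norm_prod_diff) (auto simp: divide_simps)
  also have "\<dots> \<le> (\<Sum>i<j. real j / real (n - j))"
  proof (rule sum_mono)
    fix i assume "i \<in> {..<j}"
    then have i: "i < j" by simp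
    show "norm (real (k - i) / real (n - i) - real k / real n) \<le> real j / real (n - j)"
    proof (cases "i \<le> k")
      case True
      have "real k / real n - real (k - i) / real (n - i)
              = real i * real (n - k) / (real n * real (n - i))"
        using True i assms by (simp add: of_nat_diff field_simps)
      moreover have "real i * real (n - k) / (real n * real (n - i))
                       \<le> real j * real n / (real n * real (n - j))"
        using i assms by (intro frac_le mult_mono) auto
      ultimately show ?thesis
        using assms i by (simp add: abs_minus_commute abs_le_iff)
    next
      case False
      have "real k / real n \<le> real j / real (n - j)"
        using False i assms by (intro frac_le) auto
      with False show ?thesis by simp
    qed
  qed
  finally show ?thesis
    using ratio by simp
qed

text \<open>The numbers $\binom nk L(X^k(1-X)^{n-k})$ are the weights of a probability measure on the points
  $k/n$, whose moments tend to those of $L$. Helly's selection theorem provides a limit measure.\<close>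

lemma hausdorff_moment:
  fixes L :: "real poly \<Rightarrow> real"
  assumes add: "\<And>p q. L (p + q) = L p + L q"
    and smult: "\<And>c p. L (smult c p) = c * L p"
    and pos: "\<And>k n. L ([:0, 1:] ^ k * [:1, -1:] ^ n) \<ge> 0"
    and one: "L 1 = 1"
  obtains M where "real_distribution M" "AE t in M. 0 \<le> t \<and> t \<le> 1"
    "\<And>j. (\<integral>t. t ^ j \<partial>M) = L ([:0, 1:] ^ j)"
proof -
  let ?X = "[:0, 1:] :: real poly"
  have X1: "[:1, -1:] = 1 - ?X" by (simp add: one_pCons)
  have L0: "L 0 = 0" using smult[of 0 0] by simp
  have Lsum: "L (\<Sum>k\<in>A. f k) = (\<Sum>k\<in>A. L (f k))" if "finite A" for A and f :: "nat \<Rightarrow> real poly"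
    using that by (induction A) (auto simp: L0 add)
  define w where "w n k = (if k \<le> n then real (n choose k) * L (?X ^ k * [:1, -1:] ^ (n - k)) else 0)"
    for n k
  have w_nonneg: "w n k \<ge> 0" for n k
    using pos by (simp add: w_def)
  have bern: "(\<Sum>k\<le>n. real (k choose j) * w n k) = real (n choose j) * L (?X ^ j)" if "j \<le> n" for n j
  proof -
    have "(\<Sum>k\<le>n. real (k choose j) * w n k)
            = (\<Sum>k\<le>n. L (of_nat (n choose k) * of_nat (k choose j) * (?X ^ k * (1 - ?X) ^ (n - k))))"
      by (intro sum.cong) (auto simp: w_def X1 of_nat_poly smult simp flip: of_nat_mult)
    also have "\<dots> = L (of_nat (n choose j) * ?X ^ j)"
      by (simp only: bernstein_binomial_moment[OF that] flip: Lsum[OF finite_atMost])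
    finally show ?thesis by (simp add: of_nat_poly smult)
  qed
  have w_sum: "(\<Sum>k\<le>n. w n k) = 1" for n
    using bern[of 0 n] one by simp
  define P where "P n = embed_pmf (w n)" for n
  have pmfP: "pmf (P n) k = w n k" for n k
    unfolding P_def
  proof (rule pmf_embed_pmf)
    have "(\<integral>\<^sup>+ x. ennreal (w n x) \<partial>count_space UNIV) = (\<Sum>k\<le>n. ennreal (w n k))"
      by (rule nn_integral_count_space') (auto simp: w_def)
    also have "\<dots> = 1"
      using w_sum by (subst sum_ennreal) (auto simp: w_nonneg)
    finally show "(\<integral>\<^sup>+ x. ennreal (w n x) \<partial>count_space UNIV) = 1" .
  qed (rule w_nonneg)
  have setP: "set_pmf (P n) \<subseteq> {..n}" for n
    by (auto simp: set_pmf_eq pmfP w_def split: if_splits)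
  define D where "D n = distr (measure_pmf (P n)) borel (\<lambda>k. real k / real n)" for n
  have D: "real_distribution (D n)" for n
    unfolding D_def real_distribution_def real_distribution_axioms_def
    by (auto intro: measure_pmf.prob_space_distr)
  interpret D: real_distribution "D n" for n by (rule D)
  have intD: "(\<integral>t. f t \<partial>D n) = (\<Sum>k\<le>n. f (real k / real n) * w n k)"
    if "f \<in> borel_measurable borel" for f :: "real \<Rightarrow> real" and n
  proof -
    have "(\<integral>t. f t \<partial>D n) = (\<integral>k. f (real k / real n) \<partial>measure_pmf (P n))"
      unfolding D_def using that by (intro integral_distr) auto
    also have "\<dots> = (\<Sum>k\<le>n. f (real k / real n) * pmf (P n) k)"
      using setP by (intro integral_measure_pmf_real) auto
    finally show ?thesis by (simp add: pmfP)
  qed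
  have mom: "(\<lambda>n. \<Sum>k\<le>n. (real k / real n) ^ j * w n k) \<longlonglongrightarrow> L (?X ^ j)" for j
  proof -
    have "(\<lambda>n. (\<Sum>k\<le>n. (real k / real n) ^ j * w n k) - L (?X ^ j)) \<longlonglongrightarrow> 0"
    proof (rule Lim_null_comparison)
      show "\<forall>\<^sub>F n in sequentially. norm ((\<Sum>k\<le>n. (real k / real n) ^ j * w n k) - L (?X ^ j))
               \<le> real j * (real j / real (n - j))"
        using eventually_gt_at_top[of j]
      proof eventually_elim
        case (elim n)
        have "L (?X ^ j) = (\<Sum>k\<le>n. real (k choose j) / real (n choose j) * w n k)"
          using bern[of j n] elim by (simp add: sum_divide_distrib[symmetric] field_simps)
        then have "norm ((\<Sum>k\<le>n. (real k / real n) ^ j * w n k) - L (?X ^ j))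
            = \<bar>\<Sum>k\<le>n. ((real k / real n) ^ j - real (k choose j) / real (n choose j)) * w n k\<bar>"
          by (simp add: sum_subtractf left_diff_distrib)
        also have "\<dots> \<le> (\<Sum>k\<le>n. \<bar>((real k / real n) ^ j - real (k choose j) / real (n choose j)) * w n k\<bar>)"
          by (rule sum_abs)
        also have "\<dots> \<le> (\<Sum>k\<le>n. real j * (real j / real (n - j)) * w n k)"
        proof (rule sum_mono)
          fix k assume "k \<in> {..n}"
          then have "\<bar>(real k / real n) ^ j - real (k choose j) / real (n choose j)\<bar>
                       \<le> real j * (real j / real (n - j))"
            using binomial_ratio_approx[of k n j] elim by (simp add: abs_minus_commute)
          then show "\<bar>((real k / real n) ^ j - real (k choose j) / real (n choose j)) * w n k\<bar>
                 \<le> real j * (real j / real (n - j)) * w n k"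
            using w_nonneg[of n k] by (simp only: abs_mult abs_of_nonneg) (rule mult_right_mono)
        qed
        finally show ?case
          by (simp only: w_sum mult_1_right sum_distrib_left[symmetric])
      qed
      have "(\<lambda>n. real j * (real j / real n)) \<longlonglongrightarrow> real j * 0"
        by (intro tendsto_mult tendsto_const lim_const_over_n)
      then have "(\<lambda>n. real j * (real j / real (n + j - j))) \<longlonglongrightarrow> 0" by simp
      then show "(\<lambda>n. real j * (real j / real (n - j))) \<longlonglongrightarrow> 0"
        by (rule LIMSEQ_offset)
    qed
    then show ?thesis by (rule LIM_zero_cancel)
  qed
  have supp: "measure (D n) {-1<..1} = 1" for n
  proof -
    have "AE k in measure_pmf (P n). real k / real n \<in> {-1<..1}"
      using setP[of n] by (auto simp: AE_measure_pmf_iff divide_le_eq less_divide_eq field_simps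
          intro: less_le_trans[of _ 0])
    then have "AE t in D n. t \<in> {-1<..1}"
      unfolding D_def by (subst AE_distr_iff) auto
    then show ?thesis
      by (subst D.prob_eq_1) auto
  qed
  have "\<exists>a b. a < b \<and> (\<forall>n. measure (D n) {a<..b} > 1 - \<epsilon>)" if "\<epsilon> > 0" for \<epsilon> :: real
    using that by (intro exI[of _ "- 1 :: real"] exI[of _ "1 :: real"] conjI) (auto simp: supp)
  then have "tight D"
    unfolding tight_def using D by blast
  from tight_imp_convergent_subsubsequence[OF this strict_mono_id]
  obtain r M where r: "strict_mono (r :: nat \<Rightarrow> nat)" and M: "real_distribution M"
    and conv: "weak_conv_m (D \<circ> id \<circ> r) M" by auto
  \<comment> \<open>Clipping makes the test functions $t^j$ bounded, and pushing the limit forward along it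
    produces a measure on $[0,1]$ without an analysis of the support of the limit.\<close>
  define c where "c t = max 0 (min 1 t)" for t :: real
  have c_cont: "isCont c x" for x
    unfolding c_def by (intro continuous_intros)
  have c_meas [measurable]: "c \<in> borel_measurable borel"
    using c_cont by (intro borel_measurable_continuous_onI continuous_at_imp_continuous_on) auto
  interpret M: real_distribution M by (rule M)
  have lim: "(\<integral>t. c t ^ j \<partial>M) = L (?X ^ j)" for j
  proof -
    have "(\<lambda>n. \<integral>t. c t ^ j \<partial>((D \<circ> id \<circ> r) n)) \<longlonglongrightarrow> (\<integral>t. c t ^ j \<partial>M)"
    proof (rule weak_conv_imp_integral_bdd_continuous_conv[OF _ M conv])
      show "real_distribution ((D \<circ> id \<circ> r) n)" for n using D by simp
      show "isCont (\<lambda>t. c t ^ j) x" for x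
        using c_cont by (intro continuous_intros)
      show "norm (c x ^ j) \<le> 1" for x
        by (auto simp: c_def power_le_one power_abs)
    qed
    moreover have "(\<lambda>n. \<integral>t. c t ^ j \<partial>D n) = (\<lambda>n. \<Sum>k\<le>n. (real k / real n) ^ j * w n k)"
    proof
      fix n
      have "(\<integral>t. c t ^ j \<partial>D n) = (\<Sum>k\<le>n. c (real k / real n) ^ j * w n k)"
        by (rule intD) simp
      also have "\<dots> = (\<Sum>k\<le>n. (real k / real n) ^ j * w n k)"
        by (intro sum.cong) (auto simp: c_def divide_le_eq)
      finally show "(\<integral>t. c t ^ j \<partial>D n) = (\<Sum>k\<le>n. (real k / real n) ^ j * w n k)" .
    qed
    then have "(\<lambda>n. \<integral>t. c t ^ j \<partial>((D \<circ> id \<circ> r) n)) \<longlonglongrightarrow> L (?X ^ j)"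
      using LIMSEQ_subseq_LIMSEQ[OF mom[of j] r] by (simp add: fun_eq_iff o_def)
    ultimately show ?thesis
      by (rule LIMSEQ_unique)
  qed
  define N where "N = distr M borel c"
  show ?thesis
  proof (rule that[of N])
    show "real_distribution N"
      unfolding N_def real_distribution_def real_distribution_axioms_def
      by (auto intro: M.prob_space_distr)
    show "AE t in N. 0 \<le> t \<and> t \<le> 1"
      unfolding N_def by (subst AE_distr_iff) (auto simp: c_def)
    show "(\<integral>t. t ^ j \<partial>N) = L (?X ^ j)" for j
      unfolding N_def using lim[of j] by (subst integral_distr) auto
  qed
qed

section \<open>Uniqueness for the moment problem on a compact interval\<close>

text \<open>Two finite measures on a compact interval with the same moments agree. The form needed below
  is linear: a finite combination of such measures, with bounded densities as coefficients, vanishes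
  as soon as its moments do. In this form it transports every linear identity between the moments
  $\langle T^n x, y\rangle$ to the spectral measures.\<close>

definition moment_measure :: "real \<Rightarrow> real measure \<Rightarrow> bool" where
  "moment_measure R M \<longleftrightarrow> finite_measure M \<and> sets M = sets borel \<and> (AE t in M. \<bar>t\<bar> \<le> R)"

definition bounded_on_interval :: "real \<Rightarrow> (real \<Rightarrow> real) \<Rightarrow> bool" where
  "bounded_on_interval R f \<longleftrightarrow> f \<in> borel_measurable borel \<and> (\<exists>K. \<forall>t. \<bar>t\<bar> \<le> R \<longrightarrow> \<bar>f t\<bar> \<le> K)"

lemma bounded_on_interval_mult:
  assumes "bounded_on_interval R f" "bounded_on_interval R g"
  shows "bounded_on_interval R (\<lambda>t. f t * g t)"
proof -
  obtain K K' where *: "\<And>t. \<bar>t\<bar> \<le> R \<Longrightarrow> \<bar>f t\<bar> \<le> K" "\<And>t. \<bar>t\<bar> \<le> R \<Longrightarrow> \<bar>g t\<bar> \<le> K'"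
    using assms unfolding bounded_on_interval_def by blast
  have "\<bar>f t * g t\<bar> \<le> K * K'" if "\<bar>t\<bar> \<le> R" for t
    unfolding abs_mult using *(1)[OF that] *(2)[OF that] by (intro mult_mono) auto
  with assms show ?thesis unfolding bounded_on_interval_def by auto
qed

lemma bounded_on_interval_add:
  assumes "bounded_on_interval R f" "bounded_on_interval R g"
  shows "bounded_on_interval R (\<lambda>t. f t + g t)"
proof -
  obtain K K' where *: "\<And>t. \<bar>t\<bar> \<le> R \<Longrightarrow> \<bar>f t\<bar> \<le> K" "\<And>t. \<bar>t\<bar> \<le> R \<Longrightarrow> \<bar>g t\<bar> \<le> K'"
    using assms unfolding bounded_on_interval_def by blast
  have "\<bar>f t + g t\<bar> \<le> K + K'" if "\<bar>t\<bar> \<le> R" for t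
    using *(1)[OF that] *(2)[OF that] by linarith
  with assms show ?thesis unfolding bounded_on_interval_def by auto
qed

lemma bounded_on_interval_const [simp]: "bounded_on_interval R (\<lambda>t. c)"
  unfolding bounded_on_interval_def by auto

lemma bounded_on_interval_power [simp]: "bounded_on_interval R (\<lambda>t. t ^ n)"
proof -
  have "\<bar>t ^ n\<bar> \<le> R ^ n" if "\<bar>t\<bar> \<le> R" for t
    using that by (simp add: power_abs power_mono)
  then show ?thesis unfolding bounded_on_interval_def by auto
qed

lemma bounded_on_interval_id [simp]: "bounded_on_interval R (\<lambda>t. t)"
  using bounded_on_interval_power[of R 1] by simp

lemma bounded_on_interval_minus:
  "bounded_on_interval R f \<Longrightarrow> bounded_on_interval R (\<lambda>t. - f t)"
  unfolding bounded_on_interval_def by auto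

lemma bounded_on_interval_diff:
  "bounded_on_interval R f \<Longrightarrow> bounded_on_interval R g \<Longrightarrow> bounded_on_interval R (\<lambda>t. f t - g t)"
  using bounded_on_interval_add[of R f "\<lambda>t. - g t"] bounded_on_interval_minus by auto

lemma bounded_on_interval_sum:
  "(\<And>i. i \<in> I \<Longrightarrow> bounded_on_interval R (f i)) \<Longrightarrow> bounded_on_interval R (\<lambda>t. \<Sum>i\<in>I. f i t)"
  by (induction I rule: infinite_finite_induct) (auto intro: bounded_on_interval_add)

lemma bounded_on_interval_indicator [simp]:
  "B \<in> sets borel \<Longrightarrow> bounded_on_interval R (indicator B)"
  unfolding bounded_on_interval_def by (auto intro!: exI[of _ 1] simp: indicator_def)

lemma moment_measure_mono: "moment_measure R M \<Longrightarrow> R \<le> R' \<Longrightarrow> moment_measure R' M"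
  unfolding moment_measure_def by (auto elim: eventually_mono)

lemma moment_measure_integrable:
  assumes M: "moment_measure R M" and f: "bounded_on_interval R f"
  shows "integrable M f"
proof -
  interpret finite_measure M using M by (simp add: moment_measure_def)
  obtain K where K: "\<And>t. \<bar>t\<bar> \<le> R \<Longrightarrow> \<bar>f t\<bar> \<le> K" and meas: "f \<in> borel_measurable borel"
    using f unfolding bounded_on_interval_def by blast
  have [measurable_cong]: "sets M = sets borel" using M by (simp add: moment_measure_def)
  note [measurable] = meas
  show ?thesis
  proof (rule integrable_const_bound[of _ K])
    have "AE t in M. \<bar>t\<bar> \<le> R" using M by (simp add: moment_measure_def)
    then show "AE x in M. norm (f x) \<le> K" by eventually_elim (simp add: K)
  qed measurable
qed

lemma moment_measure_tendsto:
  fixes f :: "nat \<Rightarrow> real \<Rightarrow> real"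
  assumes M: "moment_measure R M"
    and meas: "\<And>k. f k \<in> borel_measurable borel" "g \<in> borel_measurable borel"
    and lim: "\<And>t. \<bar>t\<bar> \<le> R \<Longrightarrow> (\<lambda>k. f k t) \<longlonglongrightarrow> g t"
    and bound: "\<And>k t. \<bar>t\<bar> \<le> R \<Longrightarrow> \<bar>f k t\<bar> \<le> K"
  shows "(\<lambda>k. \<integral>t. f k t \<partial>M) \<longlonglongrightarrow> (\<integral>t. g t \<partial>M)"
proof -
  interpret finite_measure M using M by (simp add: moment_measure_def)
  have [measurable_cong]: "sets M = sets borel" using M by (simp add: moment_measure_def)
  note [measurable] = meas
  have ae: "AE t in M. \<bar>t\<bar> \<le> R" using M by (simp add: moment_measure_def)
  show ?thesis
  proof (rule integral_dominated_convergence[where w = "\<lambda>_. K"])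
    show "AE x in M. (\<lambda>i. f i x) \<longlonglongrightarrow> g x"
      using ae by eventually_elim (rule lim)
    show "AE x in M. norm (f i x) \<le> K" for i
      using ae by eventually_elim (simp add: bound)
  qed auto
qed

lemma bounded_on_interval_continuous:
  assumes "continuous_on UNIV f"
  shows "bounded_on_interval R f"
proof -
  have "compact (f ` {-R..R})"
    using assms by (intro compact_continuous_image) (auto intro: continuous_on_subset)
  then have "bounded (f ` {-R..R})" by (rule compact_imp_bounded)
  then obtain K where K: "\<forall>y\<in>f ` {-R..R}. norm y \<le> K"
    unfolding bounded_iff by blast
  have "\<bar>f t\<bar> \<le> K" if "\<bar>t\<bar> \<le> R" for t
  proof -
    have "t \<in> {-R..R}" using that by (simp add: abs_le_iff minus_le_iff)
    then have "f t \<in> f ` {-R..R}" by (rule imageI)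
    with K show ?thesis by fastforce
  qed
  then show ?thesis
    using borel_measurable_continuous_onI[OF assms] unfolding bounded_on_interval_def by blast
qed

text \<open>A pair \<open>(w, M)\<close> stands for the signed measure with density \<open>w\<close> with respect to \<open>M\<close>,
  and a list for the sum of its members.\<close>

definition weighted_integral :: "((real \<Rightarrow> real) \<times> real measure) list \<Rightarrow> (real \<Rightarrow> real) \<Rightarrow> real" where
  "weighted_integral L f = (\<Sum>(w, M)\<leftarrow>L. \<integral>t. f t * w t \<partial>M)"

lemma weighted_integral_simps [simp]:
  "weighted_integral [] f = 0"
  "weighted_integral ((w, M) # L) f = (\<integral>t. f t * w t \<partial>M) + weighted_integral L f"
  "weighted_integral (L @ L') f = weighted_integral L f + weighted_integral L' f"
  by (auto simp: weighted_integral_def)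

definition admissible :: "real \<Rightarrow> ((real \<Rightarrow> real) \<times> real measure) list \<Rightarrow> bool" where
  "admissible R L \<longleftrightarrow> (\<forall>(w, M)\<in>set L. bounded_on_interval R w \<and> moment_measure R M)"

lemma admissible_simps [simp]:
  "admissible R []"
  "admissible R ((w, M) # L) \<longleftrightarrow> bounded_on_interval R w \<and> moment_measure R M \<and> admissible R L"
  "admissible R (L @ L') \<longleftrightarrow> admissible R L \<and> admissible R L'"
  by (auto simp: admissible_def)

lemma weighted_integral_add:
  assumes "admissible R L" "bounded_on_interval R f" "bounded_on_interval R g"
  shows "weighted_integral L (\<lambda>t. f t + g t) = weighted_integral L f + weighted_integral L g"
  using assms(1)
proof (induction L)
  case (Cons a L)
  obtain w M where [simp]: "a = (w, M)" by fastforce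
  have "integrable M (\<lambda>t. f t * w t)" "integrable M (\<lambda>t. g t * w t)"
    using Cons.prems assms by (auto intro!: moment_measure_integrable bounded_on_interval_mult)
  then show ?case using Cons by (simp add: distrib_right)
qed auto

lemma weighted_integral_cmult: "weighted_integral L (\<lambda>t. c * f t) = c * weighted_integral L f"
  by (induction L) (auto simp: distrib_left mult.assoc)

lemma weighted_integral_sum:
  assumes "admissible R L" "\<And>i. i \<in> I \<Longrightarrow> bounded_on_interval R (f i)"
  shows "weighted_integral L (\<lambda>t. \<Sum>i\<in>I. f i t) = (\<Sum>i\<in>I. weighted_integral L (f i))"
  using assms(2)
proof (induction I rule: infinite_finite_induct)
  case (insert i I)
  then show ?case
    using weighted_integral_add[OF assms(1), of "f i" "\<lambda>t. \<Sum>i\<in>I. f i t"]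
    by (simp add: bounded_on_interval_sum)
qed (use weighted_integral_cmult[of L 0 "\<lambda>_. 0"] in auto)

lemma weighted_integral_tendsto:
  assumes "admissible R L"
    and "\<And>k. f k \<in> borel_measurable borel" "g \<in> borel_measurable borel"
    and "\<And>t. \<bar>t\<bar> \<le> R \<Longrightarrow> (\<lambda>k. f k t) \<longlonglongrightarrow> g t"
    and "\<And>k t. \<bar>t\<bar> \<le> R \<Longrightarrow> \<bar>f k t\<bar> \<le> K"
  shows "(\<lambda>k. weighted_integral L (f k)) \<longlonglongrightarrow> weighted_integral L g"
  using assms(1)
proof (induction L)
  case (Cons a L)
  obtain w M where [simp]: "a = (w, M)" by fastforce
  have M: "moment_measure R M" and wR: "bounded_on_interval R w" using Cons.prems by auto
  obtain K' where K': "\<And>t. \<bar>t\<bar> \<le> R \<Longrightarrow> \<bar>w t\<bar> \<le> K'" and [measurable]: "w \<in> borel_measurable borel"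
    using wR unfolding bounded_on_interval_def by blast
  have "(\<lambda>k. \<integral>t. f k t * w t \<partial>M) \<longlonglongrightarrow> (\<integral>t. g t * w t \<partial>M)"
  proof (rule moment_measure_tendsto[OF M, where K = "K * K'"])
    show "(\<lambda>k. f k t * w t) \<longlonglongrightarrow> g t * w t" if "\<bar>t\<bar> \<le> R" for t
      using assms(4)[OF that] by (intro tendsto_intros)
    show "\<bar>f k t * w t\<bar> \<le> K * K'" if "\<bar>t\<bar> \<le> R" for k t
      unfolding abs_mult using assms(5)[OF that, of k] K'[OF that] by (intro mult_mono) auto
  qed (use assms in auto)
  then show ?case using Cons by (auto intro!: tendsto_add)
qed auto

lemma polynomial_uniform_approx:
  fixes f :: "real \<Rightarrow> real"
  assumes "continuous_on {-R..R} f" "e > 0"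
  obtains a n where "\<And>t. \<bar>t\<bar> \<le> R \<Longrightarrow> \<bar>f t - (\<Sum>i\<le>n. a i * t ^ i)\<bar> < e"
proof -
  obtain g where "real_polynomial_function g" and g: "\<And>t. t \<in> {-R..R} \<Longrightarrow> \<bar>f t - g t\<bar> < e"
    using Stone_Weierstrass_real_polynomial_function[of "{-R..R}" f e] assms by auto
  then obtain a and n :: nat where "g = (\<lambda>t. \<Sum>i\<le>n. a i * t ^ i)"
    using real_polynomial_function_iff_sum by metis
  with g show ?thesis by (intro that[of a n]) (auto simp: abs_le_iff)
qed

lemma weighted_integral_continuous_eq_0:
  assumes L: "admissible R L" and mom: "\<And>n. weighted_integral L (\<lambda>t. t ^ n) = 0"
    and f: "continuous_on UNIV f"
  shows "weighted_integral L f = 0"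
proof -
  have "\<exists>a n. \<forall>t. \<bar>t\<bar> \<le> R \<longrightarrow> \<bar>f t - (\<Sum>i\<le>n. a i * t ^ i)\<bar> < 1 / real (Suc k)" for k
  proof (rule polynomial_uniform_approx[of R f "1 / real (Suc k)"])
    show "continuous_on {-R..R} f" by (rule continuous_on_subset[OF f]) simp
    show "1 / real (Suc k) > 0" by simp
    show ?thesis if "\<And>t. \<bar>t\<bar> \<le> R \<Longrightarrow> \<bar>f t - (\<Sum>i\<le>n. a i * t ^ i)\<bar> < 1 / real (Suc k)"
      for a n
      by (intro exI[of _ a] exI[of _ n] allI impI that)
  qed
  then obtain a n where an: "\<And>k t. \<bar>t\<bar> \<le> R \<Longrightarrow> \<bar>f t - (\<Sum>i\<le>n k. a k i * t ^ i)\<bar> < 1 / real (Suc k)"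
    by metis
  have "\<exists>K. \<forall>t. \<bar>t\<bar> \<le> R \<longrightarrow> \<bar>f t\<bar> \<le> K"
    using bounded_on_interval_continuous[OF f, of R] by (simp add: bounded_on_interval_def)
  then obtain K where "\<forall>t. \<bar>t\<bar> \<le> R \<longrightarrow> \<bar>f t\<bar> \<le> K" ..
  then have K: "\<bar>f t\<bar> \<le> K" if "\<bar>t\<bar> \<le> R" for t using that by simp
  have "(\<lambda>k. weighted_integral L (\<lambda>t. \<Sum>i\<le>n k. a k i * t ^ i)) \<longlonglongrightarrow> weighted_integral L f"
  proof (rule weighted_integral_tendsto[OF L, where K = "K + 1"])
    show "f \<in> borel_measurable borel" using f by (rule borel_measurable_continuous_onI)
    show "(\<lambda>k. \<Sum>i\<le>n k. a k i * t ^ i) \<longlonglongrightarrow> f t" if "\<bar>t\<bar> \<le> R" for t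
    proof -
      have "(\<lambda>k. (\<Sum>i\<le>n k. a k i * t ^ i) - f t) \<longlonglongrightarrow> 0"
      proof (rule Lim_null_comparison)
        show "\<forall>\<^sub>F k in sequentially. norm ((\<Sum>i\<le>n k. a k i * t ^ i) - f t) \<le> 1 / real (Suc k)"
          using an[OF that] by (auto intro!: always_eventually less_imp_le simp: abs_minus_commute)
        show "(\<lambda>k. 1 / real (Suc k)) \<longlonglongrightarrow> 0"
          by (rule LIMSEQ_Suc[OF lim_const_over_n])
      qed
      then show ?thesis by (rule LIM_zero_cancel)
    qed
    show "\<bar>\<Sum>i\<le>n k. a k i * t ^ i\<bar> \<le> K + 1" if "\<bar>t\<bar> \<le> R" for k t
    proof -
      have "1 / real (Suc k) \<le> 1" by simp
      with an[OF that, of k] K[OF that] show ?thesis by linarith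
    qed
  qed simp
  moreover have "weighted_integral L (\<lambda>t. \<Sum>i\<le>m. c i * t ^ i) = 0" for m c
    by (subst weighted_integral_sum[OF L])
      (auto simp: weighted_integral_cmult mom intro!: bounded_on_interval_mult)
  ultimately show ?thesis
    by (simp add: LIMSEQ_const_iff)
qed

text \<open>Continuous functions that decrease to the indicator of \<open>{..a}\<close>.\<close>

definition ramp :: "nat \<Rightarrow> real \<Rightarrow> real \<Rightarrow> real" where
  "ramp k a t = max 0 (min 1 (1 - real k * (t - a)))"

lemma continuous_on_ramp: "continuous_on UNIV (ramp k a)"
  unfolding ramp_def by (intro continuous_intros)

lemma ramp_measurable [measurable]: "ramp k a \<in> borel_measurable borel"
  using continuous_on_ramp by (rule borel_measurable_continuous_onI)

lemma ramp_bounds: "0 \<le> ramp k a t" "ramp k a t \<le> 1" "indicator {..a} t \<le> ramp k a t"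
  by (auto simp: ramp_def indicator_def mult_nonneg_nonpos)

lemma ramp_tendsto: "(\<lambda>k. ramp k a t) \<longlonglongrightarrow> indicator {..a} t"
proof (cases "t \<le> a")
  case True
  then have "ramp k a t = 1" for k by (auto simp: ramp_def mult_nonneg_nonpos)
  with True show ?thesis by simp
next
  case False
  obtain N where N: "1 < real N * (t - a)" using False reals_Archimedean3[of "t - a"] by auto
  have "ramp k a t = 0" if "k \<ge> N" for k
  proof -
    have "real N * (t - a) \<le> real k * (t - a)" using that False by (intro mult_right_mono) auto
    with N show ?thesis by (simp add: ramp_def)
  qed
  then have "\<forall>\<^sub>F k in sequentially. ramp k a t = indicator {..a} t"
    using False by (auto simp: eventually_sequentially)
  then show ?thesis by (rule tendsto_eventually)
qed

text \<open>Half-lines are limits of ramps; they generate the Borel sets and are stable under intersection,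
  so that Dynkin's theorem applies.\<close>

lemma weighted_integral_indicator_eq_0:
  assumes L: "admissible R L" and mom: "\<And>n. weighted_integral L (\<lambda>t. t ^ n) = 0"
    and B: "B \<in> sets borel"
  shows "weighted_integral L (indicator B) = 0"
proof -
  have half: "weighted_integral L (indicator {..a}) = 0" for a
  proof -
    have "(\<lambda>k. weighted_integral L (ramp k a)) \<longlonglongrightarrow> weighted_integral L (indicator {..a})"
      by (rule weighted_integral_tendsto[OF L, where K = 1])
        (use ramp_bounds[of _ a] ramp_tendsto[of a] in \<open>auto simp: abs_of_nonneg\<close>)
    moreover have "weighted_integral L (ramp k a) = 0" for k
      by (rule weighted_integral_continuous_eq_0[OF L mom continuous_on_ramp])
    ultimately show ?thesis by (simp add: LIMSEQ_const_iff)
  qed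
  have borel_eq: "sets (borel :: real measure) = sigma_sets UNIV (range atMost)"
    by (simp add: borel_eq_atMost)
  have int_stable: "Int_stable (range (atMost :: real \<Rightarrow> real set))"
    by (auto simp: Int_stable_def)
  have "B \<in> sigma_sets UNIV (range atMost)" using B borel_eq by simp
  with int_stable have "Int_stable (range (atMost :: real \<Rightarrow> real set))" "range (atMost :: real \<Rightarrow> real set) \<subseteq> Pow UNIV"
    "B \<in> sigma_sets UNIV (range atMost)" by auto
  then show ?thesis
  proof (induction rule: sigma_sets_induct_disjoint)
    case (basic A)
    then show ?case using half by auto
  next
    case empty
    then show ?case using weighted_integral_cmult[of L 0 "\<lambda>_. 0"] by simp
  next
    case (compl A)
    then have [simp]: "A \<in> sets borel" "UNIV - A \<in> sets borel"
      using borel_eq sets.compl_sets[of A borel] by auto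
    have "weighted_integral L (\<lambda>t. indicator A t + indicator (UNIV - A) t) = weighted_integral L (\<lambda>t. t ^ 0)"
      by (intro arg_cong2[of _ _ _ _ weighted_integral] refl ext) (simp add: indicator_def)
    then show ?case
      using compl mom[of 0] by (subst (asm) weighted_integral_add[OF L]) auto
  next
    case (union A)
    then have A: "A i \<in> sets borel" for i using borel_eq by auto
    have disj: "(\<Sum>i<k. indicator (A i) t :: real) = indicator (\<Union>i<k. A i) t" for k t
      using union by (subst indicator_UN_disjoint) (auto simp: disjoint_family_on_def)
    have "(\<lambda>k. weighted_integral L (\<lambda>t. \<Sum>i<k. indicator (A i) t))
            \<longlonglongrightarrow> weighted_integral L (indicator (\<Union>i. A i))"
    proof (rule weighted_integral_tendsto[OF L, where K = 1])
      show "(\<lambda>k. \<Sum>i<k. indicator (A i) t :: real) \<longlonglongrightarrow> indicator (\<Union>i. A i) t" for t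
        unfolding disj by (rule LIMSEQ_indicator_UN)
      show "\<bar>\<Sum>i<k. indicator (A i) t :: real\<bar> \<le> 1" for k t
        unfolding disj by (simp add: indicator_def)
    qed (use A in auto)
    moreover have "weighted_integral L (\<lambda>t. \<Sum>i<k. indicator (A i) t) = 0" for k
      using union A by (subst weighted_integral_sum[OF L]) auto
    ultimately show ?case by (simp add: LIMSEQ_const_iff)
  qed
qed

text \<open>A bounded function is a uniform limit of functions with finitely many values, obtained by
  rounding down to multiples of $1/(k+1)$.\<close>

lemma weighted_integral_eq_0_of_indicators:
  assumes L: "admissible R L" and ind: "\<And>B. B \<in> sets borel \<Longrightarrow> weighted_integral L (indicator B) = 0"
    and f: "bounded_on_interval R f"
  shows "weighted_integral L f = 0"
proof -
  obtain K where K: "\<And>t. \<bar>t\<bar> \<le> R \<Longrightarrow> \<bar>f t\<bar> \<le> K" and [measurable]: "f \<in> borel_measurable borel"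
    using f unfolding bounded_on_interval_def by blast
  define g where "g k t = (if \<bar>t\<bar> \<le> R then real_of_int \<lfloor>real (Suc k) * f t\<rfloor> / real (Suc k) else 0)" for k t
  have approx: "\<bar>g k t - f t\<bar> \<le> 1 / real (Suc k)" if "\<bar>t\<bar> \<le> R" for k t
  proof -
    have "real_of_int \<lfloor>real (Suc k) * f t\<rfloor> \<le> real (Suc k) * f t"
      "real (Suc k) * f t \<le> real_of_int \<lfloor>real (Suc k) * f t\<rfloor> + 1"
      by linarith+
    then have "\<bar>real_of_int \<lfloor>real (Suc k) * f t\<rfloor> - real (Suc k) * f t\<bar> \<le> 1" by linarith
    moreover have "g k t - f t = (real_of_int \<lfloor>real (Suc k) * f t\<rfloor> - real (Suc k) * f t) / real (Suc k)"
      using that by (simp add: g_def diff_divide_distrib del: of_nat_Suc)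
    ultimately show ?thesis by (simp add: divide_right_mono)
  qed
  have g_meas: "g k \<in> borel_measurable borel" for k
    unfolding g_def by measurable
  have "(\<lambda>k. weighted_integral L (g k)) \<longlonglongrightarrow> weighted_integral L f"
  proof (rule weighted_integral_tendsto[OF L g_meas, where K = "K + 1"])
    show "(\<lambda>k. g k t) \<longlonglongrightarrow> f t" if "\<bar>t\<bar> \<le> R" for t
    proof -
      have "(\<lambda>k. g k t - f t) \<longlonglongrightarrow> 0"
      proof (rule Lim_null_comparison)
        show "\<forall>\<^sub>F k in sequentially. norm (g k t - f t) \<le> 1 / real (Suc k)"
          using approx[OF that] by (auto intro!: always_eventually)
        show "(\<lambda>k. 1 / real (Suc k)) \<longlonglongrightarrow> 0"
          by (rule LIMSEQ_Suc[OF lim_const_over_n])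
      qed
      then show ?thesis by (rule LIM_zero_cancel)
    qed
    show "\<bar>g k t\<bar> \<le> K + 1" if "\<bar>t\<bar> \<le> R" for k t
    proof -
      have "1 / real (Suc k) \<le> 1" by simp
      with approx[OF that, of k] K[OF that] show ?thesis by linarith
    qed
  qed simp
  moreover have "weighted_integral L (g k) = 0" for k
  proof -
    define N where "N = \<lceil>real (Suc k) * \<bar>K\<bar>\<rceil> + 1"
    define C where "C j = {t. \<bar>t\<bar> \<le> R \<and> \<lfloor>real (Suc k) * f t\<rfloor> = j}" for j
    have C [measurable]: "C j \<in> sets borel" for j unfolding C_def by measurable
    have "g k = (\<lambda>t. \<Sum>j\<in>{-N..N}. (real_of_int j / real (Suc k)) * indicator (C j) t)"
    proof
      fix t
      show "g k t = (\<Sum>j\<in>{-N..N}. (real_of_int j / real (Suc k)) * indicator (C j) t)"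
      proof (cases "\<bar>t\<bar> \<le> R")
        case True
        define j where "j = \<lfloor>real (Suc k) * f t\<rfloor>"
        have "\<bar>real (Suc k) * f t\<bar> \<le> real (Suc k) * \<bar>K\<bar>"
          using K[OF True] by (simp add: abs_mult mult_left_mono del: of_nat_Suc)
        then have "j \<in> {-N..N}"
          unfolding j_def N_def by simp linarith
        have "(\<Sum>i\<in>{-N..N}. (real_of_int i / real (Suc k)) * indicator (C i) t)
                = (\<Sum>i\<in>{-N..N}. if i = j then real_of_int j / real (Suc k) else 0)"
          by (intro sum.cong) (auto simp: C_def j_def True indicator_def)
        also have "\<dots> = real_of_int j / real (Suc k)"
          using \<open>j \<in> {-N..N}\<close> by simp
        finally show ?thesis by (simp add: g_def True j_def)
      qed (simp add: g_def C_def)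
    qed
    then have "weighted_integral L (g k)
        = (\<Sum>j\<in>{-N..N}. weighted_integral L (\<lambda>t. (real_of_int j / real (Suc k)) * indicator (C j) t))"
      by (simp only:) (rule weighted_integral_sum[OF L], intro bounded_on_interval_mult, simp_all)
    also have "\<dots> = 0"
      by (simp only: weighted_integral_cmult ind[OF C]) simp
    finally show ?thesis .
  qed
  ultimately show ?thesis by (simp add: LIMSEQ_const_iff)
qed

lemma weighted_integral_eq_0:
  assumes L: "admissible R L" and mom: "\<And>n. weighted_integral L (\<lambda>t. t ^ n) = 0"
    and f: "bounded_on_interval R f"
  shows "weighted_integral L f = 0"
  using weighted_integral_eq_0_of_indicators[OF L weighted_integral_indicator_eq_0[OF L mom] f] .

section \<open>The spectral theorem for bounded symmetric operators\<close>

text \<open>The representing vector minimises $\|y\|^2 - 2\varphi(y)$. Minimising sequences are Cauchy by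
  the parallelogram law.\<close>

lemma riesz_representation:
  fixes \<phi> :: "'a::{real_inner,complete_space} \<Rightarrow> real"
  assumes "bounded_linear \<phi>"
  obtains z where "\<And>x. \<phi> x = z \<bullet> x"
proof -
  interpret bounded_linear \<phi> by fact
  obtain K where K: "\<And>x. \<bar>\<phi> x\<bar> \<le> norm x * K" "K > 0"
    using pos_bounded by auto
  define J where "J y = y \<bullet> y - 2 * \<phi> y" for y
  have J_ge: "J y \<ge> - K\<^sup>2" for y
  proof -
    have "2 * \<phi> y \<le> 2 * (norm y * K)" using K(1)[of y] by simp
    moreover have "0 \<le> (norm y - K)\<^sup>2" by simp
    ultimately show ?thesis
      by (simp add: J_def power2_diff power2_norm_eq_inner)
  qed
  define m where "m = Inf (range J)"
  have bdd: "bdd_below (range J)" using J_ge by (auto intro!: bdd_belowI)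
  have m_le: "m \<le> J y" for y
    unfolding m_def using bdd by (intro cInf_lower) auto
  have "\<exists>y. J y < m + 1 / real (Suc n)" for n
  proof -
    have "Inf (range J) < m + 1 / real (Suc n)" by (simp add: m_def)
    then show ?thesis using cInf_lessD[of "range J"] by auto
  qed
  then obtain Y where Y: "\<And>n. J (Y n) < m + 1 / real (Suc n)" by metis
  have par: "norm (y - y') ^ 2 \<le> 2 * (J y - m) + 2 * (J y' - m)" for y y'
  proof -
    have "J ((1/2) *\<^sub>R (y + y')) = J y / 2 + J y' / 2 - norm (y - y') ^ 2 / 4"
      by (simp add: J_def power2_norm_eq_inner scaleR add inner_add inner_diff inner_commute
          field_simps)
    with m_le[of "(1/2) *\<^sub>R (y + y')"] show ?thesis by (simp add: field_simps)
  qed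
  have "Cauchy Y"
  proof (rule metric_CauchyI)
    fix e :: real assume "e > 0"
    then obtain N where N: "1 / real (Suc N) < e\<^sup>2 / 4"
      using reals_Archimedean[of "e\<^sup>2 / 4"] by (auto simp: inverse_eq_divide)
    show "\<exists>M. \<forall>a\<ge>M. \<forall>b\<ge>M. dist (Y a) (Y b) < e"
    proof (intro exI allI impI)
      fix a b assume "a \<ge> N" "b \<ge> N"
      then have "1 / real (Suc a) \<le> 1 / real (Suc N)" "1 / real (Suc b) \<le> 1 / real (Suc N)"
        by (auto simp: frac_le)
      then have "norm (Y a - Y b) ^ 2 < e\<^sup>2"
        using par[of "Y a" "Y b"] Y[of a] Y[of b] N by simp
      then show "dist (Y a) (Y b) < e"
        using \<open>e > 0\<close> by (simp add: dist_norm power2_less_imp_less)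
    qed
  qed
  then obtain z where z: "Y \<longlonglongrightarrow> z"
    using Cauchy_convergent unfolding convergent_def by blast
  have "(\<lambda>n. J (Y n)) \<longlonglongrightarrow> J z"
    unfolding J_def by (intro tendsto_intros tendsto z)
  moreover have "(\<lambda>n. m + 1 / real (Suc n)) \<longlonglongrightarrow> m + 0"
    by (intro tendsto_add tendsto_const LIMSEQ_Suc lim_const_over_n)
  ultimately have Jz: "J z \<le> m"
    using Y by (intro LIMSEQ_le[of _ "J z" _ m]) (auto intro!: exI[of _ 0] less_imp_le)
  have "\<phi> x = z \<bullet> x" for x
  proof (rule ccontr)
    define d where "d = z \<bullet> x - \<phi> x"
    assume "\<phi> x \<noteq> z \<bullet> x"
    then have d: "d \<noteq> 0" and x: "x \<bullet> x > 0"
      by (auto simp: d_def zero)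
    have *: "2 * t * d + t\<^sup>2 * (x \<bullet> x) \<ge> 0" for t
    proof -
      have "J (z + t *\<^sub>R x) = J z + (2 * t * d + t\<^sup>2 * (x \<bullet> x))"
        by (simp add: J_def d_def add scaleR inner_add inner_commute algebra_simps power2_eq_square)
      with m_le[of "z + t *\<^sub>R x"] Jz show ?thesis by simp
    qed
    have eq: "2 * (- d / (x \<bullet> x)) * d + (- d / (x \<bullet> x))\<^sup>2 * (x \<bullet> x) = - (d\<^sup>2 / (x \<bullet> x))"
      using x by (simp add: power2_eq_square field_simps)
    have "- (d\<^sup>2 / (x \<bullet> x)) \<ge> 0"
      using *[of "- d / (x \<bullet> x)"] unfolding eq .
    moreover have "d\<^sup>2 / (x \<bullet> x) > 0" using d x by simp
    ultimately show False by linarith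
  qed
  then show ?thesis by (rule that)
qed

text \<open>The polynomial calculus $p \mapsto p(T)$.\<close>

definition poly_op :: "('a::real_vector \<Rightarrow> 'a) \<Rightarrow> real poly \<Rightarrow> 'a \<Rightarrow> 'a" where
  "poly_op T p = fold_coeffs (\<lambda>a f x. a *\<^sub>R x + T (f x)) p (\<lambda>_. 0)"

lemma inner_eqI:
  fixes u v :: "'a::real_inner"
  shows "(\<And>y. u \<bullet> y = v \<bullet> y) \<Longrightarrow> u = v"
  by (metis inner_diff_left inner_eq_zero_iff right_minus_eq)

locale symmetric_operator =
  fixes T :: "'a::{real_inner,complete_space} \<Rightarrow> 'a" and R :: real
  assumes lin: "bounded_linear T"
    and symm: "T x \<bullet> y = x \<bullet> T y"
    and bound: "norm (T x) \<le> R * norm x"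
    and R_pos: "R > 0"
begin

sublocale T: bounded_linear T by (rule lin)

lemma poly_op_0 [simp]: "poly_op T 0 x = 0"
  by (simp add: poly_op_def)

lemma poly_op_pCons [simp]: "poly_op T (pCons a p) x = a *\<^sub>R x + T (poly_op T p x)"
  by (cases "p = 0 \<and> a = 0") (auto simp: poly_op_def T.zero)

lemma poly_op_1 [simp]: "poly_op T 1 x = x"
  by (simp add: one_pCons T.zero)

lemma poly_op_add: "poly_op T (p + q) x = poly_op T p x + poly_op T q x"
  by (induction p q rule: poly_induct2) (auto simp: algebra_simps T.add)

lemma poly_op_smult: "poly_op T (smult c p) x = c *\<^sub>R poly_op T p x"
  by (induction p) (auto simp: algebra_simps T.scaleR)

lemma poly_op_mult: "poly_op T (p * q) x = poly_op T p (poly_op T q x)"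
  by (induction p) (auto simp: algebra_simps poly_op_add poly_op_smult)

lemma poly_op_commute:
  assumes "bounded_linear U" "\<And>x. U (T x) = T (U x)"
  shows "U (poly_op T p x) = poly_op T p (U x)"
proof -
  interpret U: bounded_linear U by fact
  show ?thesis by (induction p) (auto simp: U.zero U.add U.scaleR assms)
qed

lemma poly_op_sym: "poly_op T p x \<bullet> y = x \<bullet> poly_op T p y"
proof (induction p arbitrary: y)
  case (pCons a p)
  have "T (poly_op T p x) \<bullet> y = x \<bullet> T (poly_op T p y)"
    by (simp add: symm pCons.IH poly_op_commute[OF lin refl, of p y])
  then show ?case by (simp add: inner_add)
qed simp

lemma poly_op_power: "poly_op T ([:0, 1:] ^ n) x = (T ^^ n) x"
  by (induction n) (auto simp: poly_op_mult T.zero)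

lemma pow_add: "(T ^^ n) (x + y) = (T ^^ n) x + (T ^^ n) y"
  and pow_diff: "(T ^^ n) (x - y) = (T ^^ n) x - (T ^^ n) y"
  and pow_scaleR: "(T ^^ n) (c *\<^sub>R x) = c *\<^sub>R (T ^^ n) x"
  by (induction n) (auto simp: T.add T.diff T.scaleR)

lemma pow_sym: "(T ^^ n) x \<bullet> y = x \<bullet> (T ^^ n) y"
  using poly_op_sym[of "[:0, 1:] ^ n"] by (simp add: poly_op_power)

text \<open>With $u = (R+T)/2R$ and $v = 1-u$, the operator $u^kv^n$ is $qrq$ with $q$ a polynomial in $T$
  and $r$ one of $1$, $u$, $v$, $uv$; all of these are positive, $uv$ because $\|Tx\| \le R\|x\|$.\<close>

lemma bernstein_nonneg:
  "poly_op T ([:1/2, 1/(2*R):] ^ k * [:1/2, -1/(2*R):] ^ n) x \<bullet> x \<ge> 0"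
proof -
  define u where "u = [:1/2, 1/(2*R):]"
  define v where "v = [:1/2, -1/(2*R):]"
  have sandwich: "poly_op T (q * r * q) x \<bullet> x = poly_op T r (poly_op T q x) \<bullet> poly_op T q x" for q r
    by (simp add: poly_op_mult poly_op_sym)
  define q where "q = u ^ (k div 2) * v ^ (n div 2)"
  define y where "y = poly_op T q x"
  define r where "r = u ^ (k mod 2) * v ^ (n mod 2)"
  have split: "w ^ m = w ^ (m div 2) * w ^ (m div 2) * w ^ (m mod 2)" for w :: "real poly" and m
    by (metis mult_2 mult_div_mod_eq power_add)
  have "u ^ k * v ^ n = q * r * q"
    unfolding q_def r_def by (subst split[of u], subst split[of v]) (simp only: ac_simps)
  then have eq: "poly_op T (u ^ k * v ^ n) x \<bullet> x = poly_op T r y \<bullet> y"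
    by (simp add: sandwich y_def)
  have Tyy: "\<bar>T y \<bullet> y\<bar> \<le> R * (y \<bullet> y)"
  proof -
    have "\<bar>T y \<bullet> y\<bar> \<le> norm (T y) * norm y" by (rule Cauchy_Schwarz_ineq2)
    also have "\<dots> \<le> R * norm y * norm y" by (intro mult_right_mono bound) auto
    finally show ?thesis by (simp add: power2_norm_eq_inner[symmetric] power2_eq_square)
  qed
  have TyTy: "T y \<bullet> T y \<le> R\<^sup>2 * (y \<bullet> y)"
  proof -
    have "norm (T y) ^ 2 \<le> (R * norm y) ^ 2" by (intro power_mono bound) auto
    then show ?thesis by (simp add: power_mult_distrib power2_norm_eq_inner)
  qed
  have u1: "poly_op T u y \<bullet> y \<ge> 0" and v1: "poly_op T v y \<bullet> y \<ge> 0"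
    using Tyy R_pos by (auto simp: u_def v_def T.zero T.scaleR T.neg inner_add inner_diff field_simps)
  have "u * v = [:1/4, 0, -1/(4*R\<^sup>2):]"
    using R_pos by (simp add: u_def v_def field_simps power2_eq_square)
  then have uv: "poly_op T (u * v) y \<bullet> y \<ge> 0"
    using TyTy R_pos by (simp add: T.zero T.scaleR inner_add inner_diff symm field_simps T.neg)
  have "poly_op T r y \<bullet> y \<ge> 0"
  proof (cases "even k"; cases "even n")
    assume "even k" "even n" then show ?thesis by (simp add: r_def even_iff_mod_2_eq_zero)
  next
    assume "even k" "odd n" then show ?thesis
      using v1 by (simp add: r_def even_iff_mod_2_eq_zero odd_iff_mod_2_eq_one)
  next
    assume "odd k" "even n" then show ?thesis
      using u1 by (simp add: r_def even_iff_mod_2_eq_zero odd_iff_mod_2_eq_one)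
  next
    assume "odd k" "odd n" then show ?thesis
      using uv by (simp add: r_def even_iff_mod_2_eq_zero odd_iff_mod_2_eq_one)
  qed
  with eq show ?thesis by (simp add: u_def v_def)
qed

text \<open>For a unit vector $x$ the functional $p \mapsto \langle p(u)x, x\rangle$ satisfies the
  hypotheses of the Hausdorff moment problem on $[0,1]$; the affine map $t \mapsto 2Rt-R$ carries
  the measure back to $[-R,R]$.\<close>

lemma ex_spectral_measure:
  "\<exists>M. moment_measure R M \<and> (\<forall>n. (\<integral>t. t ^ n \<partial>M) = (T ^^ n) x \<bullet> x)"
proof -
  define u where "u = [:1/2, 1/(2*R):]"
  define v where "v = [:-R, 2*R:]"
  define L where "L p = (if x = 0 then poly p 0 else poly_op T (pcompose p u) x \<bullet> x / (norm x)\<^sup>2)" for p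
  have vu: "pcompose v u = [:0, 1:]"
    using R_pos by (simp add: u_def v_def pcompose_pCons)
  have pow: "pcompose (p ^ n) q = pcompose p q ^ n" for p q :: "real poly" and n
    by (induction n) (auto simp: pcompose_mult pcompose_1)
  obtain N where N: "real_distribution N" "AE t in N. 0 \<le> t \<and> t \<le> 1"
    and mom: "\<And>j. (\<integral>t. t ^ j \<partial>N) = L ([:0, 1:] ^ j)"
  proof (rule hausdorff_moment[of L])
    show "L (p + q) = L p + L q" for p q
      by (simp add: L_def pcompose_add poly_op_add inner_add add_divide_distrib)
    show "L (smult c p) = c * L p" for c p
      by (simp add: L_def pcompose_smult poly_op_smult)
    show "L 1 = 1"
      by (simp add: L_def pcompose_1 power2_norm_eq_inner)
    fix k n
    have "pcompose [:0, 1:] u = u" "pcompose [:1, -1:] u = [:1/2, -1/(2*R):]"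
      by (auto simp: u_def pcompose_pCons)
    then have "pcompose ([:0, 1:] ^ k * [:1, -1:] ^ n) u = u ^ k * [:1/2, -1/(2*R):] ^ n"
      by (simp add: pcompose_mult pow)
    then show "0 \<le> L ([:0, 1:] ^ k * [:1, -1:] ^ n)"
      using bernstein_nonneg[of k n x] by (simp add: L_def u_def)
  qed blast
  interpret N: real_distribution N by (rule N)
  have mmN: "moment_measure 1 N"
    unfolding moment_measure_def using N(2) N.finite_measure_axioms by auto
  have add: "L (p + q) = L p + L q" and smult: "L (smult c p) = c * L p" for p q c
    by (auto simp: L_def pcompose_add poly_op_add inner_add add_divide_distrib pcompose_smult poly_op_smult)
  have L0: "L 0 = 0" using smult[of 0 0] by simp
  have polyN: "(\<integral>t. poly p t \<partial>N) = L p" for p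
  proof -
    have "(\<integral>t. poly p t \<partial>N) = (\<integral>t. (\<Sum>i\<le>degree p. coeff p i * t ^ i) \<partial>N)"
      by (simp add: poly_altdef)
    also have "\<dots> = (\<Sum>i\<le>degree p. coeff p i * L ([:0, 1:] ^ i))"
      by (subst Bochner_Integration.integral_sum)
        (auto simp: mom intro!: integrable_mult_right moment_measure_integrable[OF mmN])
    also have "\<dots> = L (\<Sum>i\<le>degree p. smult (coeff p i) ([:0, 1:] ^ i))"
    proof -
      have "(\<Sum>i\<in>A. coeff p i * L ([:0, 1:] ^ i)) = L (\<Sum>i\<in>A. smult (coeff p i) ([:0, 1:] ^ i))"
        if "finite A" for A
        using that by induction (auto simp: L0 add smult)
      then show ?thesis by simp
    qed
    also have "(\<Sum>i\<le>degree p. smult (coeff p i) ([:0, 1:] ^ i)) = p"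
      using poly_as_sum_of_monoms[of p] by (simp add: monom_altdef)
    finally show ?thesis .
  qed
  define N' where "N' = distr N borel (\<lambda>t. 2 * R * t - R)"
  interpret N': prob_space N' unfolding N'_def by (intro N.prob_space_distr) auto
  define M where "M = density N' (\<lambda>_. ennreal ((norm x)\<^sup>2))"
  have "moment_measure R M"
    unfolding moment_measure_def
  proof (intro conjI)
    have "emeasure M (space M) = ennreal ((norm x)\<^sup>2)"
      by (simp add: M_def emeasure_density N'.emeasure_space_1)
    then show "finite_measure M" by (intro finite_measureI) simp
    show "sets M = sets borel" by (simp add: M_def N'_def)
    have "AE t in N'. \<bar>t\<bar> \<le> R"
      unfolding N'_def using N(2)
    proof (subst AE_distr_iff, goal_cases)
      case 3
      then show ?case
      proof eventually_elim
        case (elim t)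
        then have "0 \<le> 2 * R * t" "2 * R * t \<le> 2 * R * 1"
          using R_pos by (auto intro!: mult_left_mono)
        then show ?case by (simp add: abs_le_iff)
      qed
    qed auto
    then show "AE t in M. \<bar>t\<bar> \<le> R"
      unfolding M_def by (subst AE_density) auto
  qed
  moreover have "(\<integral>t. t ^ n \<partial>M) = (T ^^ n) x \<bullet> x" for n
  proof -
    have "(\<integral>t. t ^ n \<partial>M) = (\<integral>t. (norm x)\<^sup>2 * t ^ n \<partial>N')"
      unfolding M_def by (subst integral_density) (auto simp: N'_def)
    also have "\<dots> = (norm x)\<^sup>2 * (\<integral>t. t ^ n \<partial>N')" by simp
    also have "(\<integral>t. t ^ n \<partial>N') = (\<integral>t. (2 * R * t - R) ^ n \<partial>N)"
      unfolding N'_def by (subst integral_distr) auto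
    also have "(\<lambda>t. (2 * R * t - R) ^ n) = poly (pcompose ([:0, 1:] ^ n) v)"
      by (auto simp: fun_eq_iff poly_pcompose v_def algebra_simps)
    also have "integral\<^sup>L N (poly (pcompose ([:0, 1:] ^ n) v)) = L (pcompose ([:0, 1:] ^ n) v)"
      by (rule polyN)
    also have "(norm x)\<^sup>2 * \<dots> = (T ^^ n) x \<bullet> x"
    proof (cases "x = 0")
      case False
      have "pcompose (pcompose ([:0, 1:] ^ n) v) u = [:0, 1:] ^ n"
        by (simp add: pcompose_assoc[symmetric] vu pow pcompose_pCons)
      with False show ?thesis by (simp add: L_def poly_op_power)
    qed simp
    finally show ?thesis .
  qed
  ultimately show ?thesis by blast
qed

definition spectral_measure :: "'a \<Rightarrow> real measure" where
  "spectral_measure x = (SOME M. moment_measure R M \<and> (\<forall>n. (\<integral>t. t ^ n \<partial>M) = (T ^^ n) x \<bullet> x))"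

lemma spectral_measure: "moment_measure R (spectral_measure x)"
  and spectral_measure_moment: "(\<integral>t. t ^ n \<partial>spectral_measure x) = (T ^^ n) x \<bullet> x"
  using someI_ex[OF ex_spectral_measure[of x]] unfolding spectral_measure_def by auto

lemma sets_spectral_measure [simp, measurable_cong]: "sets (spectral_measure x) = sets borel"
  using spectral_measure[of x] by (simp add: moment_measure_def)

lemma space_spectral_measure [simp]: "space (spectral_measure x) = UNIV"
  using sets_eq_imp_space_eq[OF sets_spectral_measure[of x]] by simp

lemma finite_spectral_measure: "finite_measure (spectral_measure x)"
  using spectral_measure[of x] by (simp add: moment_measure_def)

text \<open>The polarised spectral integral $\langle f(T)x, y\rangle$. Its bilinearity, and its behaviour
  under operators commuting with $T$, hold for powers $f(t)=t^n$ and therefore for all bounded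
  Borel functions.\<close>

definition spectral_form :: "(real \<Rightarrow> real) \<Rightarrow> 'a \<Rightarrow> 'a \<Rightarrow> real" where
  "spectral_form f x y = ((\<integral>t. f t \<partial>spectral_measure (x + y)) - (\<integral>t. f t \<partial>spectral_measure (x - y))) / 4"

lemma spectral_form_power: "spectral_form (\<lambda>t. t ^ n) x y = (T ^^ n) x \<bullet> y"
proof -
  have "(T ^^ n) y \<bullet> x = (T ^^ n) x \<bullet> y" by (metis pow_sym inner_commute)
  then show ?thesis
    by (simp add: spectral_form_def spectral_measure_moment pow_add pow_diff inner_add inner_diff)
qed

definition form_list :: "(real \<Rightarrow> real) \<Rightarrow> 'a \<Rightarrow> 'a \<Rightarrow> ((real \<Rightarrow> real) \<times> real measure) list" where
  "form_list w x y = [(w, spectral_measure (x + y)), (\<lambda>t. - w t, spectral_measure (x - y))]"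

lemma weighted_integral_form_list:
  "weighted_integral (form_list w x y) f = 4 * spectral_form (\<lambda>t. f t * w t) x y"
  by (simp add: form_list_def spectral_form_def)

lemma admissible_form_list [simp]: "admissible R (form_list w x y) \<longleftrightarrow> bounded_on_interval R w"
  by (auto simp: form_list_def spectral_measure intro: bounded_on_interval_minus)

lemma spectral_form_cmult: "spectral_form (\<lambda>t. f t * c) x y = c * spectral_form f x y"
  by (simp add: spectral_form_def algebra_simps)

lemma spectral_form_minus: "spectral_form (\<lambda>t. - f t) x y = - spectral_form f x y"
  by (simp add: spectral_form_def diff_divide_distrib)

lemma spectral_form_eqI:
  assumes w: "bounded_on_interval R w" "bounded_on_interval R w'"
    and mom: "\<And>n. spectral_form (\<lambda>t. t ^ n * w t) x y = spectral_form (\<lambda>t. t ^ n * w' t) x' y'"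
    and f: "bounded_on_interval R f"
  shows "spectral_form (\<lambda>t. f t * w t) x y = spectral_form (\<lambda>t. f t * w' t) x' y'"
proof -
  have "weighted_integral (form_list w x y @ form_list (\<lambda>t. - w' t) x' y') f = 0"
    by (rule weighted_integral_eq_0[OF _ _ f])
      (auto simp: w mom weighted_integral_form_list spectral_form_minus bounded_on_interval_minus)
  then show ?thesis by (simp add: weighted_integral_form_list spectral_form_minus)
qed

lemma spectral_form_add:
  assumes f: "bounded_on_interval R f"
  shows "spectral_form f (x + x') y = spectral_form f x y + spectral_form f x' y"
proof -
  have "weighted_integral (form_list (\<lambda>_. 1) (x + x') y @ form_list (\<lambda>_. -1) x y @ form_list (\<lambda>_. -1) x' y) f = 0"
    by (rule weighted_integral_eq_0[OF _ _ f])
      (auto simp: weighted_integral_form_list spectral_form_minus spectral_form_power pow_add inner_add)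
  then show ?thesis by (simp add: weighted_integral_form_list spectral_form_minus)
qed

lemma spectral_form_scaleR:
  assumes f: "bounded_on_interval R f"
  shows "spectral_form f (c *\<^sub>R x) y = c * spectral_form f x y"
proof -
  have "weighted_integral (form_list (\<lambda>_. 1) (c *\<^sub>R x) y @ form_list (\<lambda>_. - c) x y) f = 0"
    by (rule weighted_integral_eq_0[OF _ _ f])
      (auto simp: weighted_integral_form_list spectral_form_minus spectral_form_cmult
        spectral_form_power pow_scaleR)
  then show ?thesis by (simp add: weighted_integral_form_list spectral_form_minus spectral_form_cmult)
qed

lemma spectral_form_adjoint:
  assumes U: "bounded_linear U" and adj: "\<And>x y. U x \<bullet> y = x \<bullet> V y"
    and comm: "\<And>x. U (T x) = T (U x)" and f: "bounded_on_interval R f"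
  shows "spectral_form f (U x) y = spectral_form f x (V y)"
proof -
  have pow: "(T ^^ n) (U x) = U ((T ^^ n) x)" for n
    using poly_op_commute[OF U comm, of "[:0, 1:] ^ n" x] by (simp add: poly_op_power)
  have "spectral_form (\<lambda>t. f t * 1) (U x) y = spectral_form (\<lambda>t. f t * 1) x (V y)"
    by (rule spectral_form_eqI[OF _ _ _ f]) (simp_all add: spectral_form_power adj pow)
  then show ?thesis by simp
qed

lemma spectral_form_sym:
  assumes f: "bounded_on_interval R f"
  shows "spectral_form f x y = spectral_form f y x"
proof -
  have "(T ^^ n) x \<bullet> y = (T ^^ n) y \<bullet> x" for n by (metis pow_sym inner_commute)
  then have pow: "spectral_form (\<lambda>t. t ^ n * 1) x y = spectral_form (\<lambda>t. t ^ n * 1) y x" for n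
    by (simp add: spectral_form_power)
  have "spectral_form (\<lambda>t. f t * 1) x y = spectral_form (\<lambda>t. f t * 1) y x"
    by (rule spectral_form_eqI[OF _ _ pow f]) simp_all
  then show ?thesis by simp
qed

lemma spectral_form_diag:
  assumes f: "bounded_on_interval R f"
  shows "spectral_form f x x = (\<integral>t. f t \<partial>spectral_measure x)"
proof -
  have "weighted_integral (form_list (\<lambda>_. 1) x x @ [(\<lambda>_. -4, spectral_measure x)]) f = 0"
    by (rule weighted_integral_eq_0[OF _ _ f])
      (auto simp: weighted_integral_form_list spectral_form_power spectral_measure spectral_measure_moment)
  then show ?thesis by (simp add: weighted_integral_form_list)
qed

text \<open>As measures, $d\langle E x, T^ky\rangle = t^k\,d\langle E x, y\rangle$. This gives the moments of
  $\langle E(C)x, y\rangle$ below, and thereby the multiplicativity of the projections.\<close>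

lemma spectral_form_pow:
  assumes f: "bounded_on_interval R f"
  shows "spectral_form f x ((T ^^ k) y) = spectral_form (\<lambda>t. f t * t ^ k) x y"
proof -
  have "spectral_form (\<lambda>t. f t * 1) x ((T ^^ k) y) = spectral_form (\<lambda>t. f t * t ^ k) x y"
  proof (rule spectral_form_eqI[OF _ _ _ f])
    fix n
    have "(T ^^ (k + n)) x \<bullet> y = (T ^^ n) x \<bullet> (T ^^ k) y"
      by (simp add: funpow_add pow_sym[of k])
    then show "spectral_form (\<lambda>t. t ^ n * 1) x ((T ^^ k) y) = spectral_form (\<lambda>t. t ^ n * t ^ k) x y"
      by (simp add: spectral_form_power add.commute[of k] flip: power_add)
  qed auto
  then show ?thesis by simp
qed

lemma spectral_measure_total: "measure (spectral_measure x) UNIV = x \<bullet> x"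
  using spectral_measure_moment[of x 0] by simp

lemma spectral_measure_le: "measure (spectral_measure x) B \<le> x \<bullet> x"
  using finite_measure.bounded_measure[OF finite_spectral_measure, of x B]
  by (simp add: spectral_measure_total)

lemma spectral_form_indicator:
  assumes "B \<in> sets borel"
  shows "spectral_form (indicator B) x y
    = (measure (spectral_measure (x + y)) B - measure (spectral_measure (x - y)) B) / 4"
  using assms by (simp add: spectral_form_def)

text \<open>From $0 \le \mu_z(B) \le \|z\|^2$ the form is bounded by $(\|x\|^2+\|y\|^2)/2$; homogeneity in
  $y$ turns this into a bound that is linear in $\|y\|$.\<close>

lemma ex_spectral_projection:
  assumes B: "B \<in> sets borel"
  shows "\<exists>z. \<forall>y. z \<bullet> y = spectral_form (indicator B) x y"
proof -
  let ?s = "\<lambda>y. spectral_form (indicator B) x y"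
  have bi: "bounded_on_interval R (indicator B)" using B by simp
  have add: "?s (y + y') = ?s y + ?s y'" for y y'
    by (simp add: spectral_form_sym[OF bi, of x] spectral_form_add[OF bi])
  have scale: "?s (c *\<^sub>R y) = c * ?s y" for c y
    by (simp add: spectral_form_sym[OF bi, of x] spectral_form_scaleR[OF bi])
  have le: "\<bar>?s y\<bar> \<le> (x \<bullet> x + y \<bullet> y) / 2" for y
  proof -
    have "0 \<le> measure (spectral_measure (x + y)) B" "0 \<le> measure (spectral_measure (x - y)) B" by auto
    moreover note spectral_measure_le[of "x + y" B] spectral_measure_le[of "x - y" B]
    moreover have "4 * ?s y = measure (spectral_measure (x + y)) B - measure (spectral_measure (x - y)) B"
      by (simp add: spectral_form_indicator[OF B])
    ultimately have "\<bar>4 * ?s y\<bar> \<le> (x + y) \<bullet> (x + y) + (x - y) \<bullet> (x - y)"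
      by linarith
    then show ?thesis by (simp add: inner_add inner_diff)
  qed
  have "bounded_linear ?s"
  proof (rule bounded_linear_intro[where K = "(x \<bullet> x + 1) / 2"])
    show "norm (?s y) \<le> norm y * ((x \<bullet> x + 1) / 2)" for y
    proof (cases "y = 0")
      case True then show ?thesis using scale[of 0 0] by simp
    next
      case False
      have "?s y = norm y * ?s (sgn y)"
        using scale[of "norm y" "sgn y"] False by (simp add: sgn_div_norm)
      moreover have "sgn y \<bullet> sgn y = 1"
        using norm_sgn[of y] False by (simp add: norm_eq_1)
      ultimately show ?thesis
        using mult_left_mono[OF le[of "sgn y"], of "norm y"] by (simp add: abs_mult)
    qed
  qed (auto simp: add scale)
  from riesz_representation[OF this] show ?thesis by metis
qed

definition spectral_projection :: "real set \<Rightarrow> 'a \<Rightarrow> 'a" where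
  "spectral_projection B x = (SOME z. \<forall>y. z \<bullet> y = spectral_form (indicator B) x y)"

lemma spectral_projection_inner:
  "B \<in> sets borel \<Longrightarrow> spectral_projection B x \<bullet> y = spectral_form (indicator B) x y"
  using someI_ex[OF ex_spectral_projection, of B x] unfolding spectral_projection_def by auto

lemma spectral_projection_sym:
  "B \<in> sets borel \<Longrightarrow> spectral_projection B x \<bullet> y = x \<bullet> spectral_projection B y"
  using spectral_form_sym[of "indicator B" x y]
  by (simp add: spectral_projection_inner inner_commute[of x])

lemma spectral_projection_commute:
  assumes U: "bounded_linear U" and adj: "\<And>x y. U x \<bullet> y = x \<bullet> V y"
    and comm: "\<And>x. U (T x) = T (U x)" and B: "B \<in> sets borel"
  shows "U (spectral_projection B x) = spectral_projection B (U x)"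
  by (rule inner_eqI)
    (use spectral_form_adjoint[OF U adj comm, of "indicator B" x] B in
      \<open>simp add: adj spectral_projection_inner\<close>)

lemma spectral_form_projection:
  assumes C: "C \<in> sets borel" and f: "bounded_on_interval R f"
  shows "spectral_form f (spectral_projection C x) y = spectral_form (\<lambda>t. f t * indicator C t) x y"
proof -
  have "spectral_form (\<lambda>t. f t * 1) (spectral_projection C x) y = spectral_form (\<lambda>t. f t * indicator C t) x y"
  proof (rule spectral_form_eqI[OF _ _ _ f])
    fix n
    have "spectral_form (\<lambda>t. t ^ n) (spectral_projection C x) y = spectral_projection C x \<bullet> (T ^^ n) y"
      by (simp add: spectral_form_power pow_sym)
    also have "\<dots> = spectral_form (\<lambda>t. indicator C t * t ^ n) x y"
      using C by (simp add: spectral_projection_inner spectral_form_pow)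
    finally show "spectral_form (\<lambda>t. t ^ n * 1) (spectral_projection C x) y = spectral_form (\<lambda>t. t ^ n * indicator C t) x y"
      by (simp add: mult.commute)
  qed (use C in auto)
  then show ?thesis by simp
qed

lemma spectral_projection_Int:
  assumes B: "B \<in> sets borel" and C: "C \<in> sets borel"
  shows "spectral_projection (B \<inter> C) x = spectral_projection B (spectral_projection C x)"
proof (rule inner_eqI)
  fix y
  have "spectral_projection B (spectral_projection C x) \<bullet> y = spectral_form (\<lambda>t. indicator B t * indicator C t) x y"
    using B C by (simp add: spectral_projection_inner spectral_form_projection)
  also have "(\<lambda>t. indicator B t * indicator C t) = (indicator (B \<inter> C) :: real \<Rightarrow> real)"
    by (auto simp: indicator_def fun_eq_iff)
  finally show "spectral_projection (B \<inter> C) x \<bullet> y = spectral_projection B (spectral_projection C x) \<bullet> y"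
    using B C by (simp add: spectral_projection_inner)
qed

lemma measure_spectral_measure:
  assumes B: "B \<in> sets borel"
  shows "measure (spectral_measure x) B = spectral_projection B x \<bullet> x"
    and "measure (spectral_measure x) B = (norm (spectral_projection B x))\<^sup>2"
proof -
  show *: "measure (spectral_measure x) B = spectral_projection B x \<bullet> x"
    using B by (simp add: spectral_projection_inner spectral_form_diag)
  then show "measure (spectral_measure x) B = (norm (spectral_projection B x))\<^sup>2"
    using spectral_projection_Int[OF B B, of x]
    by (simp add: power2_norm_eq_inner spectral_projection_sym[OF B, symmetric])
qed

lemma spectral_projection_UNIV [simp]: "spectral_projection UNIV x = x"
  by (rule inner_eqI)
    (use spectral_form_power[of 0 x] in \<open>simp add: spectral_projection_inner indicator_UNIV\<close>)

lemma spectral_projection_norm_le: "B \<in> sets borel \<Longrightarrow> norm (spectral_projection B x) \<le> norm x"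
  using measure_spectral_measure(2)[of B x] spectral_measure_le[of x B]
  by (simp add: power2_norm_eq_inner[symmetric] power2_le_iff_abs_le)

lemma spectral_projection_linear:
  assumes B: "B \<in> sets borel"
  shows "bounded_linear (spectral_projection B)"
proof (rule bounded_linear_intro[where K = 1])
  have bi: "bounded_on_interval R (indicator B)" using B by simp
  show "spectral_projection B (x + y) = spectral_projection B x + spectral_projection B y" for x y
    by (rule inner_eqI) (simp add: inner_add spectral_projection_inner[OF B] spectral_form_add[OF bi])
  show "spectral_projection B (r *\<^sub>R x) = r *\<^sub>R spectral_projection B x" for r x
    by (rule inner_eqI) (simp add: spectral_projection_inner[OF B] spectral_form_scaleR[OF bi])
qed (simp add: spectral_projection_norm_le[OF B])

lemma spectral_projection_eq_self_iff:
  assumes "B \<in> sets borel"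
  shows "spectral_projection B x = x \<longleftrightarrow> measure (spectral_measure x) (UNIV - B) = 0"
proof -
  interpret finite_measure "spectral_measure x" by (rule finite_spectral_measure)
  have "measure (spectral_measure x) (UNIV - B) = x \<bullet> x - spectral_projection B x \<bullet> x"
    using finite_measure_compl[of B] assms
    by (simp add: spectral_measure_total measure_spectral_measure(1))
  also have "\<dots> = (norm (x - spectral_projection B x))\<^sup>2"
    using assms spectral_projection_Int[OF assms assms, of x]
      spectral_projection_sym[OF assms, of "spectral_projection B x" x]
    by (simp add: power2_norm_eq_inner inner_diff inner_commute)
  finally show ?thesis by auto
qed

text \<open>Atoms of the spectral measure are the eigenspaces.\<close>

lemma spectral_projection_eigen:
  "T (spectral_projection {l} x) = l *\<^sub>R spectral_projection {l} x"
proof -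
  define y where "y = spectral_projection {l} x"
  have "T y \<bullet> z = (l *\<^sub>R y) \<bullet> z" for z
  proof -
    have "T y \<bullet> z = spectral_form (\<lambda>t. t) y z"
      using spectral_form_power[of 1 y z] by simp
    also have "\<dots> = spectral_form (\<lambda>t. t * indicator {l} t) x z"
      unfolding y_def by (rule spectral_form_projection) auto
    also have "(\<lambda>t. t * indicator {l} t) = (\<lambda>t. indicator {l} t * l)"
      by (auto simp: indicator_def)
    also have "spectral_form \<dots> x z = l * (y \<bullet> z)"
      by (simp add: spectral_form_cmult y_def spectral_projection_inner)
    finally show ?thesis by simp
  qed
  then show ?thesis unfolding y_def by (rule inner_eqI)
qed

text \<open>If $Tx = lx$ then $\int (t-l)^2\,d\mu_x = \|(T-l)x\|^2 = 0$.\<close>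

lemma spectral_projection_of_eigen:
  assumes "T x = l *\<^sub>R x"
  shows "spectral_projection {l} x = x"
proof -
  interpret finite_measure "spectral_measure x" by (rule finite_spectral_measure)
  have int: "integrable (spectral_measure x) (\<lambda>t. t\<^sup>2)" "integrable (spectral_measure x) (\<lambda>t. 2 * l * t)"
    by (intro moment_measure_integrable[OF spectral_measure] bounded_on_interval_mult; simp)+
  have "(\<integral>t. (t - l)\<^sup>2 \<partial>spectral_measure x) = (\<integral>t. t\<^sup>2 - 2 * l * t + l\<^sup>2 \<partial>spectral_measure x)"
    by (simp add: power2_diff algebra_simps)
  also have "\<dots> = (\<integral>t. t\<^sup>2 \<partial>spectral_measure x) - 2 * l * (\<integral>t. t \<partial>spectral_measure x) + l\<^sup>2 * (x \<bullet> x)"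
    using int by (simp add: spectral_measure_total)
  also have "\<dots> = 0"
    using spectral_measure_moment[of x 2] spectral_measure_moment[of x 1]
    by (simp add: assms numeral_2_eq_2 T.scaleR power2_eq_square)
  finally have "(\<integral>t. (t - l)\<^sup>2 \<partial>spectral_measure x) = 0" .
  moreover have "integrable (spectral_measure x) (\<lambda>t. (t - l)\<^sup>2)"
    unfolding power2_eq_square
    by (intro moment_measure_integrable[OF spectral_measure] bounded_on_interval_mult bounded_on_interval_diff; simp)
  ultimately have "AE t in spectral_measure x. (t - l)\<^sup>2 = 0"
    by (subst (asm) integral_nonneg_eq_0_iff_AE) auto
  then have "AE t in spectral_measure x. t \<notin> UNIV - {l}" by eventually_elim simp
  then have "measure (spectral_measure x) (UNIV - {l}) = 0"
    by (subst (asm) AE_iff_measurable[OF _ refl]) (auto simp: measure_def Compl_eq_Diff_UNIV[symmetric] Compl_eq)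
  then show ?thesis by (simp add: spectral_projection_eq_self_iff)
qed

end

section \<open>The Hilbert space of square-summable functions as a type\<close>

typedef (overloaded) ('a, 'b::real_inner) ell2 =
  "{f :: 'a \<Rightarrow> 'b. (\<lambda>x. (norm (f x))\<^sup>2) summable_on UNIV}"
  morphisms ell2_fun Abs_ell2
  by (rule exI[of _ "\<lambda>_. 0"]) simp

lemma ell2_summable: "(\<lambda>x. (norm (ell2_fun f x))\<^sup>2) summable_on A"
  using ell2_fun[of f] by (auto intro: summable_on_subset_banach)

lemma ell2_fun_Abs: "(\<lambda>x. (norm (f x))\<^sup>2) summable_on UNIV \<Longrightarrow> ell2_fun (Abs_ell2 f) = f"
  by (rule Abs_ell2_inverse) simp

lemma ell2_eqI: "(\<And>x. ell2_fun f x = ell2_fun g x) \<Longrightarrow> f = g"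
  by (metis ell2_fun_inject ext)

lemma square_summable_add:
  fixes f g :: "'a \<Rightarrow> 'b::real_inner"
  assumes "(\<lambda>x. (norm (f x))\<^sup>2) summable_on A" "(\<lambda>x. (norm (g x))\<^sup>2) summable_on A"
  shows "(\<lambda>x. (norm (f x + g x))\<^sup>2) summable_on A"
proof (rule summable_on_comparison_test)
  show "(\<lambda>x. 2 * (norm (f x))\<^sup>2 + 2 * (norm (g x))\<^sup>2) summable_on A"
    using assms by (intro summable_on_add summable_on_cmult_right)
  fix x
  have "(norm (f x + g x))\<^sup>2 \<le> (norm (f x + g x))\<^sup>2 + (norm (f x - g x))\<^sup>2" by simp
  also have "\<dots> = 2 * (norm (f x))\<^sup>2 + 2 * (norm (g x))\<^sup>2"
    by (simp add: power2_norm_eq_inner inner_add inner_diff)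
  finally show "(norm (f x + g x))\<^sup>2 \<le> 2 * (norm (f x))\<^sup>2 + 2 * (norm (g x))\<^sup>2" .
qed simp

lemma square_summable_scaleR:
  fixes f :: "'a \<Rightarrow> 'b::real_inner"
  assumes "(\<lambda>x. (norm (f x))\<^sup>2) summable_on A"
  shows "(\<lambda>x. (norm (c *\<^sub>R f x))\<^sup>2) summable_on A"
  using summable_on_cmult_right[OF assms, of "c\<^sup>2"] by (simp add: power_mult_distrib)

lemma ell2_inner_summable: "(\<lambda>x. ell2_fun f x \<bullet> ell2_fun g x) summable_on A"
proof (rule abs_summable_summable, rule summable_on_comparison_test)
  show "(\<lambda>x. (norm (ell2_fun f x))\<^sup>2 + (norm (ell2_fun g x))\<^sup>2) summable_on A"
    by (intro summable_on_add ell2_summable)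
  fix x
  have "norm (ell2_fun f x \<bullet> ell2_fun g x) \<le> norm (ell2_fun f x) * norm (ell2_fun g x)"
    by (simp add: Cauchy_Schwarz_ineq2)
  also have "\<dots> \<le> (norm (ell2_fun f x))\<^sup>2 + (norm (ell2_fun g x))\<^sup>2"
    using sum_squares_bound[of "norm (ell2_fun f x)" "norm (ell2_fun g x)"]
      mult_nonneg_nonneg[of "norm (ell2_fun f x)" "norm (ell2_fun g x)"] by (simp del: mult_nonneg_nonneg)
  finally show "norm (ell2_fun f x \<bullet> ell2_fun g x) \<le> (norm (ell2_fun f x))\<^sup>2 + (norm (ell2_fun g x))\<^sup>2" .
qed simp

instantiation ell2 :: (type, real_inner) real_inner
begin

definition "0 = Abs_ell2 (\<lambda>_. 0)"
definition "f + g = Abs_ell2 (\<lambda>x. ell2_fun f x + ell2_fun g x)"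
definition "- f = Abs_ell2 (\<lambda>x. - ell2_fun f x)"
definition "f - g = Abs_ell2 (\<lambda>x. ell2_fun f x - ell2_fun g x)"
definition "c *\<^sub>R f = Abs_ell2 (\<lambda>x. c *\<^sub>R ell2_fun f x)"
definition "inner f g = (\<Sum>\<^sub>\<infinity>x. ell2_fun f x \<bullet> ell2_fun g x)"
definition "norm (f :: ('a, 'b) ell2) = sqrt (inner f f)"
definition "dist (f :: ('a, 'b) ell2) g = norm (f - g)"
definition "sgn (f :: ('a, 'b) ell2) = inverse (norm f) *\<^sub>R f"
definition "uniformity = (INF e\<in>{0 <..}. principal {(f :: ('a, 'b) ell2, g). dist f g < e})"
definition "open U = (\<forall>x\<in>U. \<forall>\<^sub>F (x', y) in uniformity. x' = x \<longrightarrow> (y :: ('a, 'b) ell2) \<in> U)"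

lemma ell2_fun_zero: "ell2_fun 0 x = 0"
  by (simp add: zero_ell2_def ell2_fun_Abs)

lemma ell2_fun_add: "ell2_fun (f + g) x = ell2_fun f x + ell2_fun g x"
  by (simp add: plus_ell2_def ell2_fun_Abs square_summable_add ell2_summable)

lemma ell2_fun_scaleR: "ell2_fun (c *\<^sub>R f) x = c *\<^sub>R ell2_fun f x"
  unfolding scaleR_ell2_def by (subst ell2_fun_Abs[OF square_summable_scaleR[OF ell2_summable]]) simp

lemma ell2_fun_uminus: "ell2_fun (- f) x = - ell2_fun f x"
  unfolding uminus_ell2_def by (subst ell2_fun_Abs) (simp_all add: ell2_summable)

lemma ell2_fun_minus: "ell2_fun (f - g) x = ell2_fun f x - ell2_fun g x"
  unfolding minus_ell2_def
  using square_summable_add[OF ell2_summable[of f UNIV], of "\<lambda>x. - ell2_fun g x"]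
  by (subst ell2_fun_Abs) (simp_all add: ell2_summable)

instance
proof
  fix f g h :: "('a, 'b) ell2" and a b :: real
  note simps = ell2_fun_zero ell2_fun_add ell2_fun_scaleR ell2_fun_uminus ell2_fun_minus
  show "f + g + h = f + (g + h)" "f + g = g + f" "0 + f = f" "- f + f = 0" "f - g = f + - g"
    by (rule ell2_eqI; simp add: simps)+
  show "a *\<^sub>R (f + g) = a *\<^sub>R f + a *\<^sub>R g" "(a + b) *\<^sub>R f = a *\<^sub>R f + b *\<^sub>R f"
    "a *\<^sub>R b *\<^sub>R f = (a * b) *\<^sub>R f" "1 *\<^sub>R f = f"
    by (rule ell2_eqI; simp add: simps scaleR_add_right scaleR_add_left)+
  show "f \<bullet> g = g \<bullet> f" by (simp add: inner_ell2_def inner_commute)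
  show "(f + g) \<bullet> h = f \<bullet> h + g \<bullet> h"
    by (simp add: inner_ell2_def simps inner_add_left infsum_add ell2_inner_summable)
  show "(a *\<^sub>R f) \<bullet> g = a * (f \<bullet> g)"
    by (simp add: inner_ell2_def simps infsum_cmult_right')
  show "0 \<le> f \<bullet> f" by (simp add: inner_ell2_def infsum_nonneg)
  show "f \<bullet> f = 0 \<longleftrightarrow> f = 0"
  proof
    assume "f \<bullet> f = 0"
    then have "ell2_fun f x \<bullet> ell2_fun f x = 0" for x
      unfolding inner_ell2_def by (intro nonneg_infsum_le_0D[where A = UNIV]) (auto simp: ell2_inner_summable)
    then show "f = 0" by (intro ell2_eqI) (simp add: simps)
  qed (simp add: inner_ell2_def simps)
qed (rule norm_ell2_def dist_ell2_def sgn_ell2_def uniformity_ell2_def open_ell2_def)+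

end

lemmas ell2_fun_simps [simp] = ell2_fun_zero ell2_fun_add ell2_fun_scaleR ell2_fun_uminus ell2_fun_minus

lemma ell2_fun_sum: "ell2_fun (\<Sum>i\<in>I. f i) x = (\<Sum>i\<in>I. ell2_fun (f i) x)"
  by (induction I rule: infinite_finite_induct) auto

lemma ell2_norm_sq: "(norm f)\<^sup>2 = (\<Sum>\<^sub>\<infinity>x. (norm (ell2_fun f x))\<^sup>2)"
  by (simp add: power2_norm_eq_inner inner_ell2_def)

lemma ell2_sum_le_norm: "finite F \<Longrightarrow> (\<Sum>x\<in>F. (norm (ell2_fun f x))\<^sup>2) \<le> (norm f)\<^sup>2"
  unfolding ell2_norm_sq by (intro finite_sum_le_infsum ell2_summable) auto

lemma ell2_fun_norm_le: "norm (ell2_fun f x) \<le> norm f"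
  using ell2_sum_le_norm[of "{x}" f] by (simp add: power2_le_iff_abs_le)

lemma square_summableI:
  fixes f :: "'a \<Rightarrow> 'b::real_inner"
  assumes "\<And>F. finite F \<Longrightarrow> (\<Sum>x\<in>F. (norm (f x))\<^sup>2) \<le> C"
  shows "(\<lambda>x. (norm (f x))\<^sup>2) summable_on UNIV"
    and "(\<Sum>\<^sub>\<infinity>x. (norm (f x))\<^sup>2) \<le> C"
proof -
  show s: "(\<lambda>x. (norm (f x))\<^sup>2) summable_on UNIV"
    using assms by (intro nonneg_bdd_above_summable_on) (auto intro!: bdd_aboveI2)
  show "(\<Sum>\<^sub>\<infinity>x. (norm (f x))\<^sup>2) \<le> C"
    using assms by (intro infsum_le_finite_sums s) auto
qed

instance ell2 :: (type, "{real_inner, complete_space}") complete_space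
proof
  fix X :: "nat \<Rightarrow> ('a, 'b) ell2"
  assume X: "Cauchy X"
  have "Cauchy (\<lambda>n. ell2_fun (X n) x)" for x
  proof (rule metric_CauchyI)
    fix e :: real assume "e > 0"
    then obtain N where N: "\<And>m n. m \<ge> N \<Longrightarrow> n \<ge> N \<Longrightarrow> dist (X m) (X n) < e"
      using metric_CauchyD[OF X] by metis
    have "dist (ell2_fun (X m) x) (ell2_fun (X n) x) \<le> dist (X m) (X n)" for m n
      using ell2_fun_norm_le[of "X m - X n" x] by (simp add: dist_norm)
    with N show "\<exists>M. \<forall>m\<ge>M. \<forall>n\<ge>M. dist (ell2_fun (X m) x) (ell2_fun (X n) x) < e"
      by (metis le_less_trans)
  qed
  then have "\<exists>l. (\<lambda>n. ell2_fun (X n) x) \<longlonglongrightarrow> l" for x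
    using Cauchy_convergent unfolding convergent_def by blast
  then obtain g where g: "\<And>x. (\<lambda>n. ell2_fun (X n) x) \<longlonglongrightarrow> g x" by metis
  have tail: "(\<Sum>x\<in>F. (norm (ell2_fun (X n) x - g x))\<^sup>2) \<le> e\<^sup>2"
    if N: "\<And>m n. m \<ge> N \<Longrightarrow> n \<ge> N \<Longrightarrow> dist (X m) (X n) < e" and "n \<ge> N" "finite F" for e N n F
  proof (rule tendsto_upperbound)
    show "(\<lambda>m. \<Sum>x\<in>F. (norm (ell2_fun (X n) x - ell2_fun (X m) x))\<^sup>2)
            \<longlonglongrightarrow> (\<Sum>x\<in>F. (norm (ell2_fun (X n) x - g x))\<^sup>2)"
      by (intro tendsto_intros g)
    show "\<forall>\<^sub>F m in sequentially. (\<Sum>x\<in>F. (norm (ell2_fun (X n) x - ell2_fun (X m) x))\<^sup>2) \<le> e\<^sup>2"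
      using eventually_ge_at_top[of N]
    proof eventually_elim
      case (elim m)
      have "(\<Sum>x\<in>F. (norm (ell2_fun (X n - X m) x))\<^sup>2) \<le> (norm (X n - X m))\<^sup>2"
        by (rule ell2_sum_le_norm) fact
      also have "\<dots> \<le> e\<^sup>2"
        using N[OF \<open>n \<ge> N\<close> elim] by (intro power_mono) (auto simp: dist_norm)
      finally show ?case by simp
    qed
  qed simp
  obtain N where N: "\<And>m n. m \<ge> N \<Longrightarrow> n \<ge> N \<Longrightarrow> dist (X m) (X n) < 1"
    using metric_CauchyD[OF X, of 1] by auto
  have sN: "(\<lambda>x. (norm (ell2_fun (X N) x - g x))\<^sup>2) summable_on UNIV"
    using tail[OF N order.refl] by (rule square_summableI)
  have sg: "(\<lambda>x. (norm (g x))\<^sup>2) summable_on UNIV"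
    using square_summable_add[OF ell2_summable[of "X N" UNIV], of "\<lambda>x. g x - ell2_fun (X N) x"] sN
    by (simp add: norm_minus_commute)
  define G where "G = Abs_ell2 g"
  have G: "ell2_fun G = g" unfolding G_def by (rule ell2_fun_Abs[OF sg])
  have "X \<longlonglongrightarrow> G"
  proof (rule metric_LIMSEQ_I)
    fix e :: real assume "e > 0"
    then obtain M where M: "\<And>m n. m \<ge> M \<Longrightarrow> n \<ge> M \<Longrightarrow> dist (X m) (X n) < e / 2"
      using metric_CauchyD[OF X, of "e / 2"] by auto
    have "dist (X n) G < e" if "n \<ge> M" for n
    proof -
      have "(norm (X n - G))\<^sup>2 \<le> (e / 2)\<^sup>2"
        unfolding ell2_norm_sq using square_summableI(2)[OF tail[OF M that]] by (simp add: G)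
      then have "norm (X n - G) \<le> e / 2" using \<open>e > 0\<close> by (simp add: power2_le_iff_abs_le)
      then show ?thesis using \<open>e > 0\<close> by (simp add: dist_norm)
    qed
    then show "\<exists>no. \<forall>n\<ge>no. dist (X n) G < e" by blast
  qed
  then show "convergent X" by (auto simp: convergent_def)
qed

lemma has_sum_finite_sum:
  fixes f :: "'i \<Rightarrow> 'x \<Rightarrow> 'y::topological_comm_monoid_add"
  assumes "\<And>i. i \<in> I \<Longrightarrow> (f i has_sum g i) A"
  shows "((\<lambda>x. \<Sum>i\<in>I. f i x) has_sum (\<Sum>i\<in>I. g i)) A"
  using assms by (induction I rule: infinite_finite_induct) (auto intro: has_sum_add)

subsection \<open>Coordinatewise isometric operators\<close>

text \<open>Restriction to a subset, multiplication by $i$ and the twisted right translations are all of the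
  form $(Wv)(x) = U_x(v(\pi(x)))$ for $x$ in a set \<open>S\<close> on which $\pi$ is injective, with isometries
  $U_x$.\<close>

definition weighted_shift :: "'a set \<Rightarrow> ('a \<Rightarrow> 'a) \<Rightarrow> ('a \<Rightarrow> 'b \<Rightarrow> 'b) \<Rightarrow> ('a, 'b::real_inner) ell2 \<Rightarrow> ('a, 'b) ell2" where
  "weighted_shift S \<pi> U v = Abs_ell2 (\<lambda>x. if x \<in> S then U x (ell2_fun v (\<pi> x)) else 0)"

locale shift_data =
  fixes S :: "'a set" and \<pi> :: "'a \<Rightarrow> 'a" and U :: "'a \<Rightarrow> 'b::real_inner \<Rightarrow> 'b"
  assumes inj: "inj_on \<pi> S"
    and U_linear: "x \<in> S \<Longrightarrow> linear (U x)"
    and U_norm: "x \<in> S \<Longrightarrow> norm (U x b) = norm b"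
begin

lemma square_summable_shift:
  "(\<lambda>x. (norm (if x \<in> S then U x (ell2_fun v (\<pi> x)) else 0))\<^sup>2) summable_on UNIV"
proof -
  have "((\<lambda>x. (norm (ell2_fun v x))\<^sup>2) \<circ> \<pi>) summable_on S"
    using summable_on_reindex[OF inj, of "\<lambda>x. (norm (ell2_fun v x))\<^sup>2"] by (simp add: ell2_summable)
  then show ?thesis
    by (subst summable_on_cong_neutral[where T = S and g = "(\<lambda>x. (norm (ell2_fun v x))\<^sup>2) \<circ> \<pi>"])
      (auto simp: U_norm)
qed

lemma ell2_fun_shift: "ell2_fun (weighted_shift S \<pi> U v) x = (if x \<in> S then U x (ell2_fun v (\<pi> x)) else 0)"
  unfolding weighted_shift_def by (subst ell2_fun_Abs[OF square_summable_shift]) simp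

lemma shift_norm: "(norm (weighted_shift S \<pi> U v))\<^sup>2 = (\<Sum>\<^sub>\<infinity>y\<in>\<pi> ` S. (norm (ell2_fun v y))\<^sup>2)"
proof -
  have "(norm (weighted_shift S \<pi> U v))\<^sup>2 = (\<Sum>\<^sub>\<infinity>x\<in>S. ((\<lambda>x. (norm (ell2_fun v x))\<^sup>2) \<circ> \<pi>) x)"
    unfolding ell2_norm_sq by (rule infsum_cong_neutral) (auto simp: ell2_fun_shift U_norm)
  then show ?thesis by (simp add: infsum_reindex[OF inj] o_def)
qed

lemma shift_norm_le: "norm (weighted_shift S \<pi> U v) \<le> norm v"
proof -
  have "(norm (weighted_shift S \<pi> U v))\<^sup>2 \<le> (norm v)\<^sup>2"
    unfolding shift_norm unfolding ell2_norm_sq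
    by (rule infsum_mono_neutral) (auto simp: ell2_summable)
  then show ?thesis by (simp add: power2_le_iff_abs_le)
qed

lemma shift_linear: "bounded_linear (weighted_shift S \<pi> U)"
proof (rule bounded_linear_intro[where K = 1])
  show "weighted_shift S \<pi> U (x + y) = weighted_shift S \<pi> U x + weighted_shift S \<pi> U y" for x y
    by (rule ell2_eqI) (simp add: ell2_fun_shift linear_add[OF U_linear])
  show "weighted_shift S \<pi> U (r *\<^sub>R x) = r *\<^sub>R weighted_shift S \<pi> U x" for r x
    by (rule ell2_eqI) (simp add: ell2_fun_shift linear_scale[OF U_linear])
qed (simp add: shift_norm_le)

lemma shift_adjoint:
  assumes V: "shift_data (\<pi> ` S) \<rho> V" and \<rho>: "\<And>x. x \<in> S \<Longrightarrow> \<rho> (\<pi> x) = x"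
    and adj: "\<And>x b c. x \<in> S \<Longrightarrow> U x b \<bullet> c = b \<bullet> V (\<pi> x) c"
  shows "weighted_shift S \<pi> U v \<bullet> w = v \<bullet> weighted_shift (\<pi> ` S) \<rho> V w"
proof -
  interpret V: shift_data "\<pi> ` S" \<rho> V by (rule V)
  let ?h = "\<lambda>y. ell2_fun v y \<bullet> V y (ell2_fun w (\<rho> y))"
  have "weighted_shift S \<pi> U v \<bullet> w = (\<Sum>\<^sub>\<infinity>x\<in>S. (?h \<circ> \<pi>) x)"
    unfolding inner_ell2_def by (rule infsum_cong_neutral) (auto simp: ell2_fun_shift adj \<rho>)
  also have "\<dots> = (\<Sum>\<^sub>\<infinity>y\<in>\<pi> ` S. ?h y)"
    by (rule infsum_reindex[OF inj, symmetric])
  also have "\<dots> = v \<bullet> weighted_shift (\<pi> ` S) \<rho> V w"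
    unfolding inner_ell2_def by (rule infsum_cong_neutral) (auto simp: V.ell2_fun_shift)
  finally show ?thesis .
qed

end

definition restrict_ell2 :: "'a set \<Rightarrow> ('a, 'b::real_inner) ell2 \<Rightarrow> ('a, 'b) ell2" where
  "restrict_ell2 S = weighted_shift S (\<lambda>x. x) (\<lambda>_ b. b)"

lemma shift_data_restrict: "shift_data S (\<lambda>x. x) (\<lambda>_ b. b :: 'b::real_inner)"
  by unfold_locales (auto simp: linear_iff)

lemma ell2_fun_restrict [simp]: "ell2_fun (restrict_ell2 S v) x = (if x \<in> S then ell2_fun v x else 0)"
  unfolding restrict_ell2_def by (rule shift_data.ell2_fun_shift[OF shift_data_restrict])

lemma restrict_ell2_linear: "bounded_linear (restrict_ell2 S)"
  unfolding restrict_ell2_def by (rule shift_data.shift_linear[OF shift_data_restrict])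

lemma restrict_ell2_norm_le: "norm (restrict_ell2 S v) \<le> norm v"
  unfolding restrict_ell2_def by (rule shift_data.shift_norm_le[OF shift_data_restrict])

lemma restrict_ell2_sym: "restrict_ell2 S v \<bullet> w = v \<bullet> restrict_ell2 S w"
  using shift_data.shift_adjoint[OF shift_data_restrict, of S "\<lambda>x. x" "\<lambda>_ b. b" v w]
  by (simp add: restrict_ell2_def shift_data_restrict)

lemma restrict_ell2_restrict: "restrict_ell2 S (restrict_ell2 S' v) = restrict_ell2 (S \<inter> S') v"
  by (rule ell2_eqI) simp

lemma restrict_ell2_norm: "(norm (restrict_ell2 S v))\<^sup>2 = (\<Sum>\<^sub>\<infinity>x\<in>S. (norm (ell2_fun v x))\<^sup>2)"
  using shift_data.shift_norm[OF shift_data_restrict, of S v] by (simp add: restrict_ell2_def)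

lemma restrict_ell2_eq_self_iff: "restrict_ell2 S v = v \<longleftrightarrow> (\<forall>x. x \<notin> S \<longrightarrow> ell2_fun v x = 0)"
proof
  assume "restrict_ell2 S v = v"
  then show "\<forall>x. x \<notin> S \<longrightarrow> ell2_fun v x = 0" by (metis ell2_fun_restrict)
qed (auto intro: ell2_eqI)

text \<open>A projection-valued measure \<open>F\<close> with $\int t\,dF = T$ has the spectral measures of \<open>T\<close>:
  polarising, $\int t\,d\langle Fx, F(C)y\rangle = \int_C t\,d\langle Fx, y\rangle$ says that
  $\langle F(C)Tx, y\rangle = \int_C t\,d\langle Fx,y\rangle$, and by induction the moments are
  $\langle T^nx, y\rangle$. The condition \<open>F UNIV x = x\<close> singles out the subspace on which \<open>F\<close> is
  a resolution, when it is extended by zero from there.\<close>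

lemma (in symmetric_operator) resolution_unique:
  assumes F_lin: "\<And>B. B \<in> sets borel \<Longrightarrow> linear (F B)"
    and F_sym: "\<And>B x y. B \<in> sets borel \<Longrightarrow> F B x \<bullet> y = x \<bullet> F B y"
    and F_Int: "\<And>B C x. B \<in> sets borel \<Longrightarrow> C \<in> sets borel \<Longrightarrow> F (B \<inter> C) x = F B (F C x)"
    and M: "\<And>x. moment_measure R' (M x)"
    and M_eq: "\<And>B x. B \<in> sets borel \<Longrightarrow> measure (M x) B = F B x \<bullet> x"
    and int: "\<And>x. (\<integral>t. t \<partial>M x) = T x \<bullet> x"
    and x: "F UNIV x = x" and B: "B \<in> sets borel"
  shows "measure (M x) B = measure (spectral_measure x) B"
proof -
  define m where "m f x y = ((\<integral>t. f t \<partial>M (x + y)) - (\<integral>t. f t \<partial>M (x - y))) / 4" for f :: "real \<Rightarrow> real" and x y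
  have sets_M [simp]: "sets (M x) = sets borel" for x
    using M[of x] by (simp add: moment_measure_def)
  have space_M [simp]: "space (M x) = UNIV" for x
    using sets_eq_imp_space_eq[OF sets_M] by simp
  have M_indicator: "(\<integral>t. indicator C t \<partial>M x) = F C x \<bullet> x" if "C \<in> sets borel" for C x
    using that by (simp add: M_eq)
  have m_indicator: "m (indicator C) x y = F C x \<bullet> y" if C: "C \<in> sets borel" for C x y
  proof -
    interpret linear "F C" by (rule F_lin[OF C])
    show ?thesis
      using F_sym[OF C, of x y] C
      by (simp add: m_def M_eq add diff inner_add inner_diff inner_commute)
  qed
  have m_id: "m (\<lambda>t. t) x y = T x \<bullet> y" for x y
    using symm[of x y]
    by (simp add: m_def int T.add T.diff inner_add inner_diff inner_commute)
  define fl where "fl w x y = [(w, M (x + y)), (\<lambda>t. - w t, M (x - y))]"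
    for w :: "real \<Rightarrow> real" and x y
  have wi_fl: "weighted_integral (fl w x y) f = 4 * m (\<lambda>t. f t * w t) x y" for w x y f
    by (simp add: fl_def m_def)
  have adm: "admissible R' (fl w x y)" if "bounded_on_interval R' w" for w x y
    using that M by (auto simp: fl_def intro: bounded_on_interval_minus)
  have m_minus: "m (\<lambda>t. - f t) x y = - m f x y" for f x y
    by (simp add: m_def diff_divide_distrib)
  have ext: "m (\<lambda>t. f t * w t) x y = m (\<lambda>t. f t * w' t) x' y'"
    if w: "bounded_on_interval R' w" "bounded_on_interval R' w'"
      and ind: "\<And>C. C \<in> sets borel \<Longrightarrow> m (\<lambda>t. indicator C t * w t) x y = m (\<lambda>t. indicator C t * w' t) x' y'"
      and f: "bounded_on_interval R' f" for f w w' x y x' y'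
  proof -
    have "weighted_integral (fl w x y @ fl (\<lambda>t. - w' t) x' y') f = 0"
    proof (rule weighted_integral_eq_0_of_indicators[OF _ _ f])
      show "admissible R' (fl w x y @ fl (\<lambda>t. - w' t) x' y')"
        using w by (auto intro!: adm bounded_on_interval_minus)
    qed (auto simp: wi_fl m_minus ind)
    then show ?thesis by (simp add: wi_fl m_minus)
  qed
  have ind_Int: "(\<lambda>t. indicator B t * indicator C t) = (indicator (B \<inter> C) :: real \<Rightarrow> real)" for B C :: "real set"
    by (auto simp: indicator_def fun_eq_iff)
  have m_F: "m (\<lambda>t. f t * 1) x (F C y) = m (\<lambda>t. f t * indicator C t) x y"
    if C: "C \<in> sets borel" and f: "bounded_on_interval R' f" for C f x y
  proof (rule ext[OF _ _ _ f])
    fix D :: "real set" assume D: "D \<in> sets borel"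
    have "m (indicator D) x (F C y) = F C (F D x) \<bullet> y"
      using C D by (simp add: m_indicator F_sym)
    also have "\<dots> = m (indicator (D \<inter> C)) x y"
      using C D by (simp add: m_indicator F_Int[symmetric] Int_commute)
    finally show "m (\<lambda>t. indicator D t * 1) x (F C y) = m (\<lambda>t. indicator D t * indicator C t) x y"
      by (simp add: ind_Int)
  qed (use C in auto)
  have m_T: "m (\<lambda>t. f t * 1) (T x) y = m (\<lambda>t. f t * t) x y" if f: "bounded_on_interval R' f" for f x y
  proof (rule ext[OF _ _ _ f])
    fix D :: "real set" assume D: "D \<in> sets borel"
    have "m (indicator D) (T x) y = T x \<bullet> F D y"
      using D by (simp add: m_indicator F_sym)
    also have "\<dots> = m (\<lambda>t. t * indicator D t) x y"
      using m_F[OF D, of "\<lambda>t. t" x y] by (simp add: m_id)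
    finally show "m (\<lambda>t. indicator D t * 1) (T x) y = m (\<lambda>t. indicator D t * t) x y"
      by (simp add: mult.commute)
  qed auto
  have m_pow: "m (\<lambda>t. t ^ k) ((T ^^ n) x) y = m (\<lambda>t. t ^ (k + n)) x y" for k n x y
  proof (induction n arbitrary: k)
    case (Suc n)
    have "m (\<lambda>t. t ^ k) ((T ^^ Suc n) x) y = m (\<lambda>t. t ^ k * t) ((T ^^ n) x) y"
      using m_T[of "\<lambda>t. t ^ k" "(T ^^ n) x" y] by simp
    also have "\<dots> = m (\<lambda>t. t ^ Suc k) ((T ^^ n) x) y"
      by (simp add: mult.commute)
    finally show ?case using Suc.IH[of "Suc k"] by simp
  qed simp
  have mom: "m (\<lambda>t. t ^ n) x x = (T ^^ n) x \<bullet> x" for n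
  proof -
    have "m (\<lambda>t. t ^ n) x x = m (\<lambda>t. t ^ 0) ((T ^^ n) x) x"
      using m_pow[of 0 n x x] by simp
    also have "\<dots> = F UNIV ((T ^^ n) x) \<bullet> x"
      using m_indicator[of UNIV "(T ^^ n) x" x] by (simp add: indicator_UNIV)
    also have "\<dots> = (T ^^ n) x \<bullet> x" by (simp add: F_sym x)
    finally show ?thesis .
  qed
  have diag: "m f x x = (\<integral>t. f t \<partial>M x)" if f: "bounded_on_interval R' f" for f
  proof -
    have "weighted_integral (fl (\<lambda>_. 1) x x @ [(\<lambda>_. - 4, M x)]) f = 0"
    proof (rule weighted_integral_eq_0_of_indicators[OF _ _ f])
      show "admissible R' (fl (\<lambda>_. 1) x x @ [(\<lambda>_. - 4, M x)])"
        using M adm[of "\<lambda>_. 1"] by auto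
    qed (auto simp: wi_fl m_indicator M_eq)
    then show ?thesis by (simp add: wi_fl)
  qed
  have "weighted_integral [(\<lambda>_. 1, M x), (\<lambda>_. -1, spectral_measure x)] (indicator B) = 0"
  proof (rule weighted_integral_eq_0[where R = "max R R'"])
    show "admissible (max R R') [(\<lambda>_. 1, M x), (\<lambda>_. -1, spectral_measure x)]"
      by (simp add: moment_measure_mono[OF M] moment_measure_mono[OF spectral_measure])
    show "weighted_integral [(\<lambda>_. 1, M x), (\<lambda>_. -1, spectral_measure x)] (\<lambda>t. t ^ n) = 0" for n
      using mom[of n] diag[of "\<lambda>t. t ^ n"] by (simp add: spectral_measure_moment)
  qed (use B in auto)
  then show ?thesis using B by simp
qed

section \<open>Complex structure and the concrete $l^2$ spaces\<close>

lemma norm_vector_scalar_mult: "norm (z *s (b :: complex ^ 'd::finite)) = cmod z * norm b"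
  by (simp add: norm_vec_def norm_mult L2_set_right_distrib)

lemma inner_vector_scalar_mult: "(z *s (b :: complex ^ 'd::finite)) \<bullet> c = b \<bullet> (cnj z *s c)"
  by (simp add: inner_vec_def inner_complex_def algebra_simps)

lemma linear_vector_scalar_mult: "linear (\<lambda>b :: complex ^ 'd::finite. z *s b)"
  by (auto simp: linear_iff vec_eq_iff algebra_simps)

lemma shift_data_scalar:
  assumes "inj_on \<pi> S" "\<And>x. x \<in> S \<Longrightarrow> cmod (z x) = 1"
  shows "shift_data S \<pi> (\<lambda>x b :: complex ^ 'd::finite. z x *s b)"
  using assms by (intro shift_data.intro) (auto simp: linear_vector_scalar_mult norm_vector_scalar_mult)

definition mult_i :: "('g, complex ^ 'd::finite) ell2 \<Rightarrow> ('g, complex ^ 'd) ell2" where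
  "mult_i = weighted_shift UNIV (\<lambda>x. x) (\<lambda>_ b. \<i> *s b)"

lemma ell2_fun_mult_i [simp]: "ell2_fun (mult_i v) x = \<i> *s ell2_fun v x"
  unfolding mult_i_def by (subst shift_data.ell2_fun_shift[OF shift_data_scalar]) auto

lemma mult_i_linear: "bounded_linear mult_i"
  unfolding mult_i_def by (rule shift_data.shift_linear[OF shift_data_scalar]) auto

lemma mult_i_skew: "mult_i v \<bullet> w = - (v \<bullet> mult_i w)"
proof -
  have *: "(\<i> *s b) \<bullet> c = - (b \<bullet> (\<i> *s c))" for b c :: "complex ^ 'd"
    by (simp add: inner_vec_def inner_complex_def flip: sum_negf)
  have "(\<Sum>\<^sub>\<infinity>x. ell2_fun (mult_i v) x \<bullet> ell2_fun w x) = (\<Sum>\<^sub>\<infinity>x. - (ell2_fun v x \<bullet> ell2_fun (mult_i w) x))"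
    by (simp add: *)
  then show ?thesis by (simp add: inner_ell2_def infsum_uminus)
qed

lemma mult_i_adjoint: "mult_i v \<bullet> w = v \<bullet> (- mult_i w)"
  by (simp add: mult_i_skew)

lemma mult_i_restrict: "mult_i (restrict_ell2 S v) = restrict_ell2 S (mult_i v)"
  by (rule ell2_eqI) (simp add: vec_eq_iff)

lemma scalar_mult_ell2:
  "(\<lambda>x. c *s ell2_fun u x) = ell2_fun (Re c *\<^sub>R u + Im c *\<^sub>R mult_i u)"
proof
  fix x
  have "c * z = Re c *\<^sub>R z + Im c *\<^sub>R (\<i> * z)" for z
    by (simp add: complex_eq_iff)
  then show "c *s ell2_fun u x = ell2_fun (Re c *\<^sub>R u + Im c *\<^sub>R mult_i u) x"
    by (simp add: vec_eq_iff)
qed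

lemma l2_iff: "f \<in> l2 S \<longleftrightarrow> (\<exists>u. f = ell2_fun u \<and> restrict_ell2 S u = u)"
proof
  assume f: "f \<in> l2 S"
  then have "(\<lambda>x. (norm (f x))\<^sup>2) summable_on UNIV"
    unfolding l2_def by (subst summable_on_cong_neutral[where T = S]) auto
  then have "ell2_fun (Abs_ell2 f) = f" by (rule ell2_fun_Abs)
  with f show "\<exists>u. f = ell2_fun u \<and> restrict_ell2 S u = u"
    by (intro exI[of _ "Abs_ell2 f"]) (simp add: restrict_ell2_eq_self_iff l2_def)
next
  assume "\<exists>u. f = ell2_fun u \<and> restrict_ell2 S u = u"
  then show "f \<in> l2 S"
    by (auto simp: l2_def restrict_ell2_eq_self_iff ell2_summable)
qed

lemma ell2_fun_in_l2_iff: "ell2_fun u \<in> l2 S \<longleftrightarrow> restrict_ell2 S u = u"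
  by (auto simp: l2_iff ell2_fun_inject)

text \<open>The complex inner product is recovered from the real one and multiplication by $i$.\<close>

lemma l2_inner_ell2: "l2_inner (ell2_fun u) (ell2_fun v) = Complex (u \<bullet> v) (u \<bullet> mult_i v)"
proof -
  have pt: "(\<Sum>a\<in>UNIV. b $ a * cnj (c $ a)) = complex_of_real (b \<bullet> c) + \<i> * complex_of_real (b \<bullet> (\<i> *s c))"
    for b c :: "complex ^ 'd"
    by (simp add: inner_vec_def inner_complex_def complex_eq_iff algebra_simps)
  have "((\<lambda>x. complex_of_real (ell2_fun u x \<bullet> ell2_fun v x)) has_sum complex_of_real (u \<bullet> v)) UNIV"
    unfolding inner_ell2_def
    by (intro has_sum_bounded_linear[OF bounded_linear_of_real] has_sum_infsum ell2_inner_summable)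
  moreover have "((\<lambda>x. complex_of_real (ell2_fun u x \<bullet> ell2_fun (mult_i v) x)) has_sum complex_of_real (u \<bullet> mult_i v)) UNIV"
    unfolding inner_ell2_def
    by (intro has_sum_bounded_linear[OF bounded_linear_of_real] has_sum_infsum ell2_inner_summable)
  ultimately have "((\<lambda>x. complex_of_real (ell2_fun u x \<bullet> ell2_fun v x)
      + \<i> * complex_of_real (ell2_fun u x \<bullet> ell2_fun (mult_i v) x)) has_sum
      (complex_of_real (u \<bullet> v) + \<i> * complex_of_real (u \<bullet> mult_i v))) UNIV"
    by (intro has_sum_add has_sum_cmult_right)
  then have "l2_inner (ell2_fun u) (ell2_fun v) = complex_of_real (u \<bullet> v) + \<i> * complex_of_real (u \<bullet> mult_i v)"
    unfolding l2_inner_def pt by (simp add: infsumI)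
  then show ?thesis by (simp add: complex_eq_iff)
qed

lemma l2_norm_ell2: "l2_norm (ell2_fun u) = norm u"
  by (simp add: l2_norm_def flip: ell2_norm_sq)

text \<open>An operator on $l^2(S)^d$ extended by $0$ to the whole space.\<close>

definition ell2_op :: "'g set \<Rightarrow> ('g, 'd::finite) oper \<Rightarrow> ('g, complex ^ 'd) ell2 \<Rightarrow> ('g, complex ^ 'd) ell2" where
  "ell2_op S T u = Abs_ell2 (T (ell2_fun (restrict_ell2 S u)))"

context
  fixes S :: "'g set" and T :: "('g, 'd::finite) oper"
  assumes bo: "bounded_operator_on S T"
begin

lemma bounded_operator_in_l2: "ell2_fun u \<in> l2 S \<Longrightarrow> T (ell2_fun u) \<in> l2 S"
  using bo by (simp add: bounded_operator_on_def)

lemma restrict_in_l2: "ell2_fun (restrict_ell2 S u) \<in> l2 S"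
  by (simp add: ell2_fun_in_l2_iff restrict_ell2_restrict)

lemma ell2_fun_ell2_op: "ell2_fun (ell2_op S T u) = T (ell2_fun (restrict_ell2 S u))"
  using bounded_operator_in_l2[OF restrict_in_l2, of u] unfolding ell2_op_def
  by (intro ell2_fun_Abs) (auto simp: l2_iff ell2_summable)

lemma restrict_ell2_op: "restrict_ell2 S (ell2_op S T u) = ell2_op S T u"
  using bounded_operator_in_l2[OF restrict_in_l2, of u]
  by (simp add: ell2_fun_in_l2_iff flip: ell2_fun_ell2_op)

lemma ell2_op_restrict: "ell2_op S T (restrict_ell2 S u) = ell2_op S T u"
  by (simp add: ell2_op_def restrict_ell2_restrict)

lemma ell2_op_add: "ell2_op S T (u + v) = ell2_op S T u + ell2_op S T v"
proof (rule ell2_eqI)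
  fix x
  interpret P: bounded_linear "restrict_ell2 S" by (rule restrict_ell2_linear)
  have "T (\<lambda>x. ell2_fun (restrict_ell2 S u) x + ell2_fun (restrict_ell2 S v) x)
      = (\<lambda>x. T (ell2_fun (restrict_ell2 S u)) x + T (ell2_fun (restrict_ell2 S v)) x)"
    using bo restrict_in_l2[of u] restrict_in_l2[of v] unfolding bounded_operator_on_def by blast
  moreover have "(\<lambda>x. ell2_fun (restrict_ell2 S u) x + ell2_fun (restrict_ell2 S v) x)
      = ell2_fun (restrict_ell2 S (u + v))"
    by (simp add: fun_eq_iff)
  ultimately show "ell2_fun (ell2_op S T (u + v)) x = ell2_fun (ell2_op S T u + ell2_op S T v) x"
    by (simp add: ell2_fun_ell2_op)
qed

lemma ell2_op_cmult:
  "ell2_op S T (a *\<^sub>R u + b *\<^sub>R mult_i u) = a *\<^sub>R ell2_op S T u + b *\<^sub>R mult_i (ell2_op S T u)"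
proof (rule ell2_eqI)
  fix x
  interpret P: bounded_linear "restrict_ell2 S" by (rule restrict_ell2_linear)
  have "T (\<lambda>x. Complex a b *s ell2_fun (restrict_ell2 S u) x)
      = (\<lambda>x. Complex a b *s T (ell2_fun (restrict_ell2 S u)) x)"
    using bo restrict_in_l2[of u] unfolding bounded_operator_on_def by blast
  then have "T (ell2_fun (restrict_ell2 S (a *\<^sub>R u + b *\<^sub>R mult_i u)))
      = ell2_fun (a *\<^sub>R ell2_op S T u + b *\<^sub>R mult_i (ell2_op S T u))"
    by (simp only: scalar_mult_ell2 complex.sel P.add P.scaleR mult_i_restrict flip: ell2_fun_ell2_op)
  then show "ell2_fun (ell2_op S T (a *\<^sub>R u + b *\<^sub>R mult_i u)) x
      = ell2_fun (a *\<^sub>R ell2_op S T u + b *\<^sub>R mult_i (ell2_op S T u)) x"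
    by (simp only: ell2_fun_ell2_op)
qed

lemma ell2_op_scaleR: "ell2_op S T (a *\<^sub>R u) = a *\<^sub>R ell2_op S T u"
  using ell2_op_cmult[of a u 0] by simp

lemma ell2_op_mult_i: "mult_i (ell2_op S T u) = ell2_op S T (mult_i u)"
  using ell2_op_cmult[of 0 u 1] by simp

lemma ell2_op_bound: "\<exists>K>0. \<forall>u. norm (ell2_op S T u) \<le> K * norm u"
proof -
  obtain K where K: "\<And>f. f \<in> l2 S \<Longrightarrow> l2_norm (T f) \<le> K * l2_norm f"
    using bo unfolding bounded_operator_on_def by blast
  have "norm (ell2_op S T u) \<le> (\<bar>K\<bar> + 1) * norm u" for u
  proof -
    have "norm (ell2_op S T u) \<le> K * norm (restrict_ell2 S u)"
      using K[OF restrict_in_l2[of u]] by (simp add: l2_norm_ell2 flip: ell2_fun_ell2_op)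
    also have "\<dots> \<le> (\<bar>K\<bar> + 1) * norm u"
      using restrict_ell2_norm_le[of S u] by (intro mult_mono) auto
    finally show ?thesis .
  qed
  then show ?thesis by (intro exI[of _ "\<bar>K\<bar> + 1"]) auto
qed

lemma ell2_op_linear: "bounded_linear (ell2_op S T)"
  using ell2_op_bound
  by (auto intro!: bounded_linear_intro[where K = "SOME K. \<forall>u. norm (ell2_op S T u) \<le> K * norm u"]
      simp: ell2_op_add ell2_op_scaleR mult.commute dest: someI[where P = "\<lambda>K. \<forall>u. norm (ell2_op S T u) \<le> K * norm u"])

end

lemma self_adjoint_on_bounded: "self_adjoint_on S T \<Longrightarrow> bounded_operator_on S T"
  by (simp add: self_adjoint_on_def)

lemma ell2_op_sym:
  assumes sa: "self_adjoint_on S T"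
  shows "ell2_op S T u \<bullet> v = u \<bullet> ell2_op S T v"
proof -
  note bo = self_adjoint_on_bounded[OF sa]
  have "l2_inner (T (ell2_fun (restrict_ell2 S u))) (ell2_fun (restrict_ell2 S v))
      = l2_inner (ell2_fun (restrict_ell2 S u)) (T (ell2_fun (restrict_ell2 S v)))"
    using sa restrict_in_l2[OF bo] unfolding self_adjoint_on_def by blast
  then have "ell2_op S T u \<bullet> restrict_ell2 S v = restrict_ell2 S u \<bullet> ell2_op S T v"
    by (simp add: l2_inner_ell2 flip: ell2_fun_ell2_op[OF bo])
  then have "restrict_ell2 S (ell2_op S T u) \<bullet> v = u \<bullet> restrict_ell2 S (ell2_op S T v)"
    by (simp only: restrict_ell2_sym)
  then show ?thesis by (simp add: restrict_ell2_op[OF bo])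
qed

lemma symmetric_operator_ell2_op:
  assumes sa: "self_adjoint_on S T" and "\<And>u. norm (ell2_op S T u) \<le> R * norm u" "R > 0"
  shows "symmetric_operator (ell2_op S T) R"
  by (rule symmetric_operator.intro) (use assms ell2_op_linear[OF self_adjoint_on_bounded[OF sa]] ell2_op_sym[OF sa] in auto)

lemma self_adjoint_onI:
  assumes lin: "bounded_linear Q" and comm: "\<And>u. mult_i (Q u) = Q (mult_i u)"
    and inv: "\<And>u. restrict_ell2 S (Q u) = Q (restrict_ell2 S u)"
    and sym: "\<And>u v. Q u \<bullet> v = u \<bullet> Q v"
    and T: "\<And>u. restrict_ell2 S u = u \<Longrightarrow> T (ell2_fun u) = ell2_fun (Q u)"
  shows "self_adjoint_on S T"
proof -
  interpret Q: bounded_linear Q by (rule lin)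
  interpret P: bounded_linear "restrict_ell2 S" by (rule restrict_ell2_linear)
  interpret J: bounded_linear mult_i by (rule mult_i_linear)
  obtain K where K: "\<And>u. norm (Q u) \<le> norm u * K" using Q.pos_bounded by blast
  have "T f \<in> l2 S" if f: "f \<in> l2 S" for f
  proof -
    obtain u where "f = ell2_fun u" "restrict_ell2 S u = u" using f by (auto simp: l2_iff)
    then show ?thesis by (auto simp: T l2_iff inv)
  qed
  moreover have "T (\<lambda>x. f x + h x) = (\<lambda>x. T f x + T h x)" if f: "f \<in> l2 S" and h: "h \<in> l2 S" for f h
  proof -
    obtain u v where u: "f = ell2_fun u" "restrict_ell2 S u = u" and v: "h = ell2_fun v" "restrict_ell2 S v = v"
      using f h by (auto simp: l2_iff)
    have "(\<lambda>x. f x + h x) = ell2_fun (u + v)" by (simp add: u v fun_eq_iff)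
    then have eq: "T (\<lambda>x. f x + h x) = ell2_fun (Q (u + v))" using u v by (simp add: T P.add)
    show ?thesis unfolding eq by (simp add: u v T Q.add fun_eq_iff)
  qed
  moreover have "T (\<lambda>x. c *s f x) = (\<lambda>x. c *s T f x)" if f: "f \<in> l2 S" for f c
  proof -
    obtain u where u: "f = ell2_fun u" "restrict_ell2 S u = u" using f by (auto simp: l2_iff)
    have "T (\<lambda>x. c *s f x) = ell2_fun (Q (Re c *\<^sub>R u + Im c *\<^sub>R mult_i u))"
      unfolding u(1) scalar_mult_ell2 using u(2) by (intro T) (simp add: P.add P.scaleR flip: mult_i_restrict)
    also have "\<dots> = (\<lambda>x. c *s ell2_fun (Q u) x)"
      by (simp add: scalar_mult_ell2 Q.add Q.scaleR comm)
    finally show ?thesis using u by (simp add: T)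
  qed
  moreover have "l2_norm (T f) \<le> K * l2_norm f" if f: "f \<in> l2 S" for f
  proof -
    obtain u where u: "f = ell2_fun u" "restrict_ell2 S u = u" using f by (auto simp: l2_iff)
    then show ?thesis using K[of u] by (simp add: T l2_norm_ell2 mult.commute)
  qed
  moreover have "l2_inner (T f) h = l2_inner f (T h)" if f: "f \<in> l2 S" and h: "h \<in> l2 S" for f h
  proof -
    obtain u v where u: "f = ell2_fun u" "restrict_ell2 S u = u" and v: "h = ell2_fun v" "restrict_ell2 S v = v"
      using f h by (auto simp: l2_iff)
    then show ?thesis by (simp add: T l2_inner_ell2 sym comm)
  qed
  ultimately show ?thesis
    unfolding self_adjoint_on_def bounded_operator_on_def by blast
qed

section \<open>The Borel functional calculus of operators on the concrete spaces\<close>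

text \<open>The projection onto the part of the union that is still missing after $n$ steps has spectral
  measure tending to $0$, by continuity of a finite measure.\<close>

lemma (in symmetric_operator) spectral_projection_UN:
  assumes B: "\<And>i :: nat. B i \<in> sets borel" and disj: "disjoint_family B"
  shows "(\<lambda>n. norm (spectral_projection (\<Union>i. B i) x - (\<Sum>i<n. spectral_projection (B i) x))) \<longlonglongrightarrow> 0"
proof -
  let ?U = "\<Union>i. B i"
  interpret finite_measure "spectral_measure x" by (rule finite_spectral_measure)
  have U: "?U \<in> sets borel" using B by auto
  have Un: "(\<Union>i<n. B i) \<in> sets borel" for n using B by auto
  have add: "spectral_projection (C \<union> D) x = spectral_projection C x + spectral_projection D x"
    if "C \<in> sets borel" "D \<in> sets borel" "C \<inter> D = {}" for C D
  proof (rule inner_eqI)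
    fix y
    have "measure (spectral_measure z) (C \<union> D) = measure (spectral_measure z) C + measure (spectral_measure z) D" for z
      using that by (intro finite_measure.finite_measure_Union[OF finite_spectral_measure]) auto
    then show "spectral_projection (C \<union> D) x \<bullet> y = (spectral_projection C x + spectral_projection D x) \<bullet> y"
      using that by (simp add: spectral_projection_inner inner_add spectral_form_indicator field_simps)
  qed
  have empty: "spectral_projection {} x = 0"
    using add[of "{}" "{}"] by simp
  have fin: "(\<Sum>i<n. spectral_projection (B i) x) = spectral_projection (\<Union>i<n. B i) x" for n
  proof (induction n)
    case (Suc n)
    have "(\<Union>i<n. B i) \<inter> B n = {}"
      using disj by (auto simp: disjoint_family_on_def) (metis IntI emptyE less_irrefl)
    then show ?case
      using Suc add[OF Un B, of n n] by (simp add: lessThan_Suc Un_commute)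
  qed (simp add: empty)
  have eq: "(norm (spectral_projection ?U x - (\<Sum>i<n. spectral_projection (B i) x)))\<^sup>2
      = measure (spectral_measure x) ?U - measure (spectral_measure x) (\<Union>i<n. B i)" for n
  proof -
    have "spectral_projection ?U x = spectral_projection (\<Union>i<n. B i) x + spectral_projection (?U - (\<Union>i<n. B i)) x"
    proof -
      have eqU: "(\<Union>i<n. B i) \<union> (?U - (\<Union>i<n. B i)) = ?U" by auto
      have "?U - (\<Union>i<n. B i) \<in> sets borel" using U Un[of n] by (rule sets.Diff)
      from add[OF Un[of n] this] show ?thesis unfolding eqU by blast
    qed
    then have "(norm (spectral_projection ?U x - (\<Sum>i<n. spectral_projection (B i) x)))\<^sup>2
        = measure (spectral_measure x) (?U - (\<Union>i<n. B i))"
      using U Un[of n] by (simp add: fin measure_spectral_measure(2))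
    also have "\<dots> = measure (spectral_measure x) ?U - measure (spectral_measure x) (\<Union>i<n. B i)"
      using U Un[of n] by (intro finite_measure_Diff) auto
    finally show ?thesis .
  qed
  have "(\<lambda>n. measure (spectral_measure x) (\<Union>i<n. B i)) \<longlonglongrightarrow> measure (spectral_measure x) (\<Union>n. \<Union>i<n. B i)"
  proof (rule finite_Lim_measure_incseq)
    show "incseq (\<lambda>n. \<Union>i<n. B i)" unfolding incseq_def by (intro allI impI UN_mono) auto
  qed (use Un in auto)
  moreover have "(\<Union>n. \<Union>i<n. B i) = ?U" by auto
  ultimately have "(\<lambda>n. measure (spectral_measure x) ?U - measure (spectral_measure x) (\<Union>i<n. B i))
      \<longlonglongrightarrow> measure (spectral_measure x) ?U - measure (spectral_measure x) ?U"
    by (intro tendsto_intros) simp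
  then have "(\<lambda>n. (norm (spectral_projection ?U x - (\<Sum>i<n. spectral_projection (B i) x)))\<^sup>2) \<longlonglongrightarrow> 0"
    by (simp add: eq)
  then have "(\<lambda>n. sqrt ((norm (spectral_projection ?U x - (\<Sum>i<n. spectral_projection (B i) x)))\<^sup>2)) \<longlonglongrightarrow> sqrt 0"
    by (rule tendsto_real_sqrt)
  then show ?thesis by simp
qed

lemma symmetric_inner_mult_i:
  assumes sym: "\<And>x y. Q x \<bullet> y = x \<bullet> Q y" and comm: "\<And>x. mult_i (Q x) = Q (mult_i x)"
  shows "Q v \<bullet> mult_i v = 0"
proof -
  have "- (Q v \<bullet> mult_i v) = Q (mult_i v) \<bullet> v"
    using mult_i_skew[of "Q v" v] comm[of v] by simp
  also have "\<dots> = mult_i v \<bullet> Q v" by (rule sym)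
  also have "\<dots> = Q v \<bullet> mult_i v" by (rule inner_commute)
  finally show ?thesis by simp
qed

lemma measure_of_eq_measure:
  assumes "sets M = sets borel" "\<And>B. B \<in> sets borel \<Longrightarrow> emeasure M B = f B"
  shows "measure_of UNIV (sets (borel :: real measure)) f = M"
proof -
  have space: "space M = UNIV" using sets_eq_imp_space_eq[OF assms(1)] by simp
  have "measure_of UNIV (sets borel) f = measure_of UNIV (sets (borel :: real measure)) (emeasure M)"
    using assms(2) sets.sigma_sets_eq[of "borel :: real measure"] by (intro measure_of_eq) auto
  also have "\<dots> = measure_of (space M) (sets M) (emeasure M)"
    using assms space by simp
  finally show ?thesis by (simp add: measure_of_of_measure)
qed

context
  fixes S :: "'g set" and T :: "('g, 'd::finite) oper" and R :: real
  assumes sa: "self_adjoint_on S T" and bound: "\<And>u. norm (ell2_op S T u) \<le> R * norm u" and R_pos: "R > 0"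
begin

interpretation symmetric_operator "ell2_op S T" R
  by (rule symmetric_operator_ell2_op[OF sa bound R_pos])

lemma ex_spectral_resolution: "\<exists>E. spectral_resolution S T E"
proof -
  note bo = self_adjoint_on_bounded[OF sa]
  define E :: "real set \<Rightarrow> ('g, 'd) oper" where "E B f = ell2_fun (spectral_projection B (Abs_ell2 f))" for B f
  have E: "E B (ell2_fun u) = ell2_fun (spectral_projection B u)" for B u
    by (simp add: E_def ell2_fun_inverse)
  have comm_i: "mult_i (spectral_projection B u) = spectral_projection B (mult_i u)" if "B \<in> sets borel" for B u
    using that by (intro spectral_projection_commute[OF mult_i_linear mult_i_adjoint]) (simp_all add: ell2_op_mult_i[OF bo])
  have comm_S: "restrict_ell2 S (spectral_projection B u) = spectral_projection B (restrict_ell2 S u)"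
    if "B \<in> sets borel" for B u
    using that by (intro spectral_projection_commute[OF restrict_ell2_linear restrict_ell2_sym])
      (simp_all add: restrict_ell2_op[OF bo] ell2_op_restrict[OF bo])
  have scalar: "scalar_measure E (ell2_fun u) = spectral_measure u" for u
    unfolding scalar_measure_def
  proof (rule measure_of_eq_measure)
    fix B :: "real set" assume B: "B \<in> sets borel"
    interpret finite_measure "spectral_measure u" by (rule finite_spectral_measure)
    show "emeasure (spectral_measure u) B = ennreal (Re (l2_inner (E B (ell2_fun u)) (ell2_fun u)))"
      using B by (simp add: emeasure_eq_measure measure_spectral_measure(1) E l2_inner_ell2)
  qed simp
  have "projection_valued_measure S E"
    unfolding projection_valued_measure_def
  proof (intro conjI ballI allI impI)
    fix B :: "real set" assume B: "B \<in> sets borel"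
    show "self_adjoint_on S (E B)"
      by (rule self_adjoint_onI[OF spectral_projection_linear[OF B] comm_i[OF B] comm_S[OF B]
            spectral_projection_sym[OF B] E])
  next
    fix B C :: "real set" and f :: "('g, 'd) vfun" assume "B \<in> sets borel" "C \<in> sets borel" and f: "f \<in> l2 S"
    then show "E (B \<inter> C) f = E B (E C f)"
      by (auto simp: l2_iff E spectral_projection_Int)
  next
    fix f :: "('g, 'd) vfun" assume "f \<in> l2 S" then show "E UNIV f = f" by (auto simp: l2_iff E)
  next
    fix B :: "nat \<Rightarrow> real set" and f :: "('g, 'd) vfun"
    assume B: "range B \<subseteq> sets borel" "disjoint_family B" and "f \<in> l2 S"
    then obtain u where u: "f = ell2_fun u" by (auto simp: l2_iff)
    have "(\<lambda>x. E (\<Union>i. B i) f x - (\<Sum>i<n. E (B i) f x))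
        = ell2_fun (spectral_projection (\<Union>i. B i) u - (\<Sum>i<n. spectral_projection (B i) u))" for n
      by (simp add: fun_eq_iff u E ell2_fun_sum)
    then show "(\<lambda>n. l2_norm (\<lambda>x. E (\<Union>i. B i) f x - (\<Sum>i<n. E (B i) f x))) \<longlonglongrightarrow> 0"
      using spectral_projection_UN[of B u] B by (simp add: l2_norm_ell2 image_subset_iff)
  qed
  moreover have "E {-R..R} f = f" if f: "f \<in> l2 S" for f
  proof -
    obtain u where u: "f = ell2_fun u" using f by (auto simp: l2_iff)
    have "AE t in spectral_measure u. \<bar>t\<bar> \<le> R"
      using spectral_measure[of u] by (simp add: moment_measure_def)
    then have "AE t in spectral_measure u. t \<notin> UNIV - {-R..R}"
      by eventually_elim auto
    then have "UNIV - {-R..R} \<in> null_sets (spectral_measure u)"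
      by (subst AE_iff_null_sets) auto
    then have "measure (spectral_measure u) (UNIV - {-R..R}) = 0"
      by (rule measure_eq_0_null_sets)
    then have "spectral_projection {-R..R} u = u"
      by (subst spectral_projection_eq_self_iff) auto
    then show ?thesis by (simp add: u E)
  qed
  moreover have "l2_inner (T f) f = (LINT t|scalar_measure E f. complex_of_real t)" if f: "f \<in> l2 S" for f
  proof -
    obtain u where u: "f = ell2_fun u" "restrict_ell2 S u = u" using f by (auto simp: l2_iff)
    have "T f = ell2_fun (ell2_op S T u)" using u by (simp add: ell2_fun_ell2_op[OF bo])
    moreover have "ell2_op S T u \<bullet> mult_i u = 0"
      by (rule symmetric_inner_mult_i[OF symm ell2_op_mult_i[OF bo]])
    ultimately show ?thesis
      using spectral_measure_moment[of u 1] by (simp add: u(1) scalar l2_inner_ell2 complex_eq_iff)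
  qed
  ultimately show ?thesis unfolding spectral_resolution_def by blast
qed

text \<open>The functional calculus is defined from an arbitrarily chosen resolution; by uniqueness of
  spectral measures the choice does not matter.\<close>

lemma scalar_measure_unique:
  assumes E: "spectral_resolution S T E" and u: "restrict_ell2 S u = u" and B: "B \<in> sets borel"
  shows "measure (scalar_measure E (ell2_fun u)) B = measure (spectral_measure u) B"
    and "sets (scalar_measure E (ell2_fun u)) = sets borel"
    and "measure (scalar_measure E (ell2_fun u)) B = ell2_op S (E B) u \<bullet> u"
proof -
  note bo = self_adjoint_on_bounded[OF sa]
  have saE: "self_adjoint_on S (E B)" if "B \<in> sets borel" for B
    using E that by (simp add: spectral_resolution_def projection_valued_measure_def)
  note boE = self_adjoint_on_bounded[OF saE]
  define F where "F B = ell2_op S (E B)" for B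
  define M where "M v = scalar_measure E (ell2_fun (restrict_ell2 S v))" for v
  have F_eq: "E B (ell2_fun v) = ell2_fun (F B v)" if "B \<in> sets borel" "restrict_ell2 S v = v" for B v
    using that by (simp add: F_def ell2_fun_ell2_op[OF boE])
  have F_lin: "bounded_linear (F B)" if "B \<in> sets borel" for B
    unfolding F_def by (rule ell2_op_linear[OF boE[OF that]])
  have F_sym: "F B x \<bullet> y = x \<bullet> F B y" if "B \<in> sets borel" for B x y
    unfolding F_def by (rule ell2_op_sym[OF saE[OF that]])
  have F_res: "F B (restrict_ell2 S x) = F B x" "restrict_ell2 S (F B x) = F B x" if "B \<in> sets borel" for B x
    unfolding F_def using ell2_op_restrict[OF boE[OF that]] restrict_ell2_op[OF boE[OF that]] by auto
  have F_Int: "F (B \<inter> C) x = F B (F C x)" if B: "B \<in> sets borel" and C: "C \<in> sets borel" for B C x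
  proof (rule ell2_eqI)
    fix z
    have "E (B \<inter> C) (ell2_fun (restrict_ell2 S x)) = E B (E C (ell2_fun (restrict_ell2 S x)))"
      using E B C restrict_in_l2[OF bo, of x]
      by (simp add: spectral_resolution_def projection_valued_measure_def)
    then show "ell2_fun (F (B \<inter> C) x) z = ell2_fun (F B (F C x)) z"
      using B C by (simp add: F_eq F_res restrict_ell2_restrict)
  qed
  have F_UNIV: "F UNIV x = restrict_ell2 S x" for x
  proof (rule ell2_eqI)
    fix z
    have "E UNIV (ell2_fun (restrict_ell2 S x)) = ell2_fun (restrict_ell2 S x)"
      using E restrict_in_l2[OF bo, of x]
      by (simp add: spectral_resolution_def projection_valued_measure_def)
    then show "ell2_fun (F UNIV x) z = ell2_fun (restrict_ell2 S x) z"
      by (simp add: F_eq F_res restrict_ell2_restrict)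
  qed
  have F_pos: "F B x \<bullet> x = (norm (F B x))\<^sup>2" if "B \<in> sets borel" for B x
    using F_Int[OF that that, of x] by (simp add: power2_norm_eq_inner F_sym[OF that, of x])
  have F_sums: "(\<lambda>i. F (C i) x \<bullet> x) sums (F (\<Union>i. C i) x \<bullet> x)"
    if C: "range C \<subseteq> sets borel" and disj: "disjoint_family C" for C :: "nat \<Rightarrow> real set" and x
  proof -
    have Ci: "C i \<in> sets borel" for i using C by auto
    have CU: "(\<Union>i. C i) \<in> sets borel" using C by auto
    let ?v = "restrict_ell2 S x"
    have "(\<lambda>n. l2_norm (\<lambda>z. E (\<Union>i. C i) (ell2_fun ?v) z - (\<Sum>i<n. E (C i) (ell2_fun ?v) z))) \<longlonglongrightarrow> 0"
      using E restrict_in_l2[OF bo, of x] C disj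
      by (simp add: spectral_resolution_def projection_valued_measure_def)
    moreover have "(\<lambda>z. E (\<Union>i. C i) (ell2_fun ?v) z - (\<Sum>i<n. E (C i) (ell2_fun ?v) z))
        = ell2_fun (F (\<Union>i. C i) x - (\<Sum>i<n. F (C i) x))" for n
      using Ci CU by (simp add: fun_eq_iff F_eq F_res restrict_ell2_restrict ell2_fun_sum)
    ultimately have "(\<lambda>n. norm (F (\<Union>i. C i) x - (\<Sum>i<n. F (C i) x))) \<longlonglongrightarrow> 0"
      by (simp add: l2_norm_ell2)
    then have "(\<lambda>n. F (\<Union>i. C i) x - (\<Sum>i<n. F (C i) x)) \<longlonglongrightarrow> 0"
      by (rule tendsto_norm_zero_cancel)
    then have "(\<lambda>n. F (\<Union>i. C i) x - (F (\<Union>i. C i) x - (\<Sum>i<n. F (C i) x))) \<longlonglongrightarrow> F (\<Union>i. C i) x - 0"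
      by (intro tendsto_intros)
    then have "(\<lambda>n. (\<Sum>i<n. F (C i) x) \<bullet> x) \<longlonglongrightarrow> F (\<Union>i. C i) x \<bullet> x"
      by (intro tendsto_intros) simp
    then show ?thesis by (simp add: sums_def inner_sum_left)
  qed
  have Fe: "F {} x \<bullet> x = 0" for x
  proof -
    have "(\<lambda>i :: nat. F {} x \<bullet> x) sums (F {} x \<bullet> x)"
      using F_sums[of "\<lambda>_. {}" x] by (simp add: disjoint_family_on_def)
    then have "summable (\<lambda>i :: nat. F {} x \<bullet> x)" by (rule sums_summable)
    then show ?thesis by (simp add: summable_const_iff)
  qed
  have M_sets: "sets (M x) = sets borel" for x
    using sets.sigma_sets_eq[of "borel :: real measure"] by (simp add: M_def scalar_measure_def)
  have M_space: "space (M x) = UNIV" for x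
    using sets_eq_imp_space_eq[OF M_sets] by simp
  have M_emeasure: "emeasure (M x) C = ennreal (F C x \<bullet> x)" if C: "C \<in> sets borel" for C x
  proof -
    let ?f = "\<lambda>B. ennreal (Re (l2_inner (E B (ell2_fun (restrict_ell2 S x))) (ell2_fun (restrict_ell2 S x))))"
    have f: "?f B = ennreal (F B x \<bullet> x)" if "B \<in> sets borel" for B
    proof -
      have "F B x \<bullet> restrict_ell2 S x = F B x \<bullet> x"
        by (simp only: F_res[OF that] flip: restrict_ell2_sym)
      then show ?thesis
        using that by (simp add: F_eq restrict_ell2_restrict l2_inner_ell2 F_res)
    qed
    have "measure_space UNIV (sets borel) ?f"
      unfolding measure_space_def
    proof (intro conjI)
      show "sigma_algebra UNIV (sets (borel :: real measure))"
        using sets.sigma_algebra_axioms[of "borel :: real measure"] by simp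
      show "positive (sets borel) ?f" by (simp add: positive_def f Fe)
      show "countably_additive (sets borel) ?f"
      proof (rule countably_additiveI)
        fix C :: "nat \<Rightarrow> real set"
        assume C: "range C \<subseteq> sets borel" "disjoint_family C" "(\<Union>i. C i) \<in> sets borel"
        have "suminf (\<lambda>i. ennreal (F (C i) x \<bullet> x)) = ennreal (F (\<Union>i. C i) x \<bullet> x)"
          using F_sums[OF C(1,2), of x] C(1) by (intro suminf_ennreal_eq) (auto simp: F_pos image_subset_iff)
        moreover have "C i \<in> sets borel" for i using C by auto
        ultimately show "suminf (\<lambda>i. ?f (C i)) = ?f (\<Union>i. C i)"
          using C(3) by (simp add: f)
      qed
    qed
    then have "emeasure (M x) C = ?f C"
      unfolding M_def scalar_measure_def using C
      by (intro emeasure_measure_of_sigma) (auto simp: measure_space_def)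
    then show ?thesis using f[OF C] by simp
  qed
  have M_measure: "measure (M x) C = F C x \<bullet> x" if "C \<in> sets borel" for C x
    using M_emeasure[OF that, of x] F_pos[OF that, of x] by (simp add: measure_def)
  have M_fin: "finite_measure (M x)" for x
    by (rule finite_measureI) (simp add: M_space M_emeasure)
  obtain R0 where R0: "\<And>f. f \<in> l2 S \<Longrightarrow> E {-R0..R0} f = f"
    using E unfolding spectral_resolution_def by blast
  have M_mm: "moment_measure R0 (M x)" for x
    unfolding moment_measure_def
  proof (intro conjI M_fin M_sets)
    have "ell2_fun (F {-R0..R0} x) = ell2_fun (restrict_ell2 S x)"
      using R0[OF restrict_in_l2[OF bo, of x]] by (simp add: F_eq restrict_ell2_restrict F_res)
    then have "F {-R0..R0} x = restrict_ell2 S x" by (simp add: ell2_fun_inject)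
    then have "F (UNIV - {-R0..R0}) x = F {} x"
      using F_Int[of "UNIV - {-R0..R0}" "{-R0..R0}" x] F_res(1)[of "UNIV - {-R0..R0}" x]
      by (simp add: Diff_Int_distrib2 Int_commute)
    then have "emeasure (M x) (UNIV - {-R0..R0}) = 0"
      by (simp add: M_emeasure Fe)
    then have "AE t in M x. t \<notin> UNIV - {-R0..R0}"
      by (subst AE_iff_null_sets[symmetric]) (auto simp: null_sets_def M_sets)
    then show "AE t in M x. \<bar>t\<bar> \<le> R0" by eventually_elim auto
  qed
  have M_int: "(\<integral>t. t \<partial>M x) = ell2_op S T x \<bullet> x" for x
  proof -
    have "l2_inner (T (ell2_fun (restrict_ell2 S x))) (ell2_fun (restrict_ell2 S x)) = (LINT t|M x. complex_of_real t)"
      using E restrict_in_l2[OF bo, of x] unfolding M_def spectral_resolution_def by blast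
    then have "ell2_op S T x \<bullet> restrict_ell2 S x = (\<integral>t. t \<partial>M x)"
      by (simp add: complex_eq_iff l2_inner_ell2 flip: ell2_fun_ell2_op[OF bo])
    then show ?thesis
      by (simp add: restrict_ell2_op[OF bo] flip: restrict_ell2_sym)
  qed
  have "measure (M u) B = measure (spectral_measure u) B"
    using resolution_unique[of F R0 M u B] bounded_linear.linear[OF F_lin] F_sym F_Int M_mm M_measure M_int F_UNIV u B
    by auto
  then show "measure (scalar_measure E (ell2_fun u)) B = measure (spectral_measure u) B"
    by (simp add: M_def u)
  show "sets (scalar_measure E (ell2_fun u)) = sets borel"
    using M_sets[of u] by (simp add: M_def u)
  show "measure (scalar_measure E (ell2_fun u)) B = ell2_op S (E B) u \<bullet> u"
    using M_measure[OF B, of u] by (simp add: M_def u F_def)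
qed

text \<open>Diagonal entries of spectral projections are values of spectral measures; in this form the
  functional calculus enters the traces.\<close>

theorem borel_calculus_indicator:
  assumes u: "restrict_ell2 S u = u"
  shows "l2_inner (borel_calculus S T (indicator {..l}) (ell2_fun u)) (ell2_fun u)
           = complex_of_real (measure (spectral_measure u) {..l})"
proof -
  define E where "E = (SOME E. spectral_resolution S T E)"
  have E: "spectral_resolution S T E"
    unfolding E_def by (rule someI_ex[OF ex_spectral_resolution])
  let ?P = "\<lambda>Q. bounded_operator_on S Q \<and>
      (\<forall>f\<in>l2 S. l2_inner (Q f) f = (LINT t|scalar_measure E f. indicator {..l} t))"
  have integral: "(LINT t|scalar_measure E (ell2_fun v). indicator {..l} t :: complex)
      = complex_of_real (measure (spectral_measure v) {..l})" if v: "restrict_ell2 S v = v" for v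
  proof -
    have [measurable_cong]: "sets (scalar_measure E (ell2_fun v)) = sets borel"
      by (rule scalar_measure_unique(2)[OF E v]) auto
    have "space (scalar_measure E (ell2_fun v)) = UNIV"
      using sets_eq_imp_space_eq[OF scalar_measure_unique(2)[OF E v, of "{}"]] by simp
    moreover have "(indicator {..l} :: real \<Rightarrow> complex) = (\<lambda>t. complex_of_real (indicator {..l} t))"
      by (auto simp: indicator_def)
    ultimately show ?thesis
      using scalar_measure_unique(1)[OF E v, of "{..l}"] by simp
  qed
  have saE: "self_adjoint_on S (E {..l})"
    using E by (simp add: spectral_resolution_def projection_valued_measure_def)
  note boE = self_adjoint_on_bounded[OF saE]
  have "?P (E {..l})"
  proof (intro conjI boE ballI)
    fix f :: "('g, 'd) vfun" assume "f \<in> l2 S"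
    then obtain v where v: "f = ell2_fun v" "restrict_ell2 S v = v" by (auto simp: l2_iff)
    let ?F = "ell2_op S (E {..l})"
    have Ef: "E {..l} (ell2_fun v) = ell2_fun (?F v)" using v by (simp add: ell2_fun_ell2_op[OF boE])
    have "?F v \<bullet> mult_i v = 0"
      by (rule symmetric_inner_mult_i[OF ell2_op_sym[OF saE] ell2_op_mult_i[OF boE]])
    moreover have "?F v \<bullet> v = measure (scalar_measure E f) {..l}"
      using scalar_measure_unique(3)[OF E v(2), of "{..l}"] v(1) by simp
    ultimately show "l2_inner (E {..l} f) f = (LINT t|scalar_measure E f. indicator {..l} t)"
      using v scalar_measure_unique(1)[OF E v(2), of "{..l}"] by (simp add: Ef integral l2_inner_ell2 complex_eq_iff)
  qed
  then have P: "?P (SOME Q. ?P Q)" by (rule someI[where P = ?P])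
  have calc: "borel_calculus S T (indicator {..l}) = (SOME Q. ?P Q)"
    by (simp add: borel_calculus_def Let_def flip: E_def)
  have "ell2_fun u \<in> l2 S" using u by (simp add: ell2_fun_in_l2_iff)
  from bspec[OF conjunct2[OF P] this] show ?thesis
    unfolding calc integral[OF u] .
qed

end

section \<open>Convergence of distribution functions from convergence of moments\<close>

text \<open>The averaged spectral measures are treated as functionals $f \mapsto \int f\,d\mu$ on the functions
  that are bounded on $[-R,R]$.\<close>

definition positive_functional :: "real \<Rightarrow> ((real \<Rightarrow> real) \<Rightarrow> real) \<Rightarrow> bool" where
  "positive_functional R \<Lambda> \<longleftrightarrow>
     (\<forall>f g. bounded_on_interval R f \<longrightarrow> bounded_on_interval R g \<longrightarrow>
        \<Lambda> (\<lambda>t. f t + g t) = \<Lambda> f + \<Lambda> g) \<and>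
     (\<forall>c f. \<Lambda> (\<lambda>t. c * f t) = c * \<Lambda> f) \<and>
     (\<forall>f g. bounded_on_interval R f \<longrightarrow> bounded_on_interval R g \<longrightarrow>
        (\<forall>t. \<bar>t\<bar> \<le> R \<longrightarrow> f t \<le> g t) \<longrightarrow> \<Lambda> f \<le> \<Lambda> g)"

lemma positive_functional_add:
  "positive_functional R \<Lambda> \<Longrightarrow> bounded_on_interval R f \<Longrightarrow> bounded_on_interval R g \<Longrightarrow>
     \<Lambda> (\<lambda>t. f t + g t) = \<Lambda> f + \<Lambda> g"
  unfolding positive_functional_def by blast

lemma positive_functional_cmult: "positive_functional R \<Lambda> \<Longrightarrow> \<Lambda> (\<lambda>t. c * f t) = c * \<Lambda> f"
  unfolding positive_functional_def by blast

lemma positive_functional_mono: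
  "positive_functional R \<Lambda> \<Longrightarrow> bounded_on_interval R f \<Longrightarrow> bounded_on_interval R g \<Longrightarrow>
     (\<And>t. \<bar>t\<bar> \<le> R \<Longrightarrow> f t \<le> g t) \<Longrightarrow> \<Lambda> f \<le> \<Lambda> g"
  unfolding positive_functional_def by blast

lemma positive_functional_integrals:
  assumes "\<And>i. i \<in> I \<Longrightarrow> moment_measure R (M i)" and c: "c \<ge> 0"
  shows "positive_functional R (\<lambda>f. c * (\<Sum>i\<in>I. \<integral>t. f t \<partial>M i))"
  unfolding positive_functional_def
proof (intro conjI allI impI)
  fix f g assume fg: "bounded_on_interval R f" "bounded_on_interval R g"
  have "(\<Sum>i\<in>I. \<integral>t. f t + g t \<partial>M i) = (\<Sum>i\<in>I. (\<integral>t. f t \<partial>M i) + (\<integral>t. g t \<partial>M i))"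
    using fg assms(1) by (intro sum.cong refl Bochner_Integration.integral_add moment_measure_integrable) auto
  then show "c * (\<Sum>i\<in>I. \<integral>t. f t + g t \<partial>M i) = c * (\<Sum>i\<in>I. \<integral>t. f t \<partial>M i) + c * (\<Sum>i\<in>I. \<integral>t. g t \<partial>M i)"
    by (simp add: sum.distrib distrib_left)
  assume le: "\<forall>t. \<bar>t\<bar> \<le> R \<longrightarrow> f t \<le> g t"
  show "c * (\<Sum>i\<in>I. \<integral>t. f t \<partial>M i) \<le> c * (\<Sum>i\<in>I. \<integral>t. g t \<partial>M i)"
  proof (intro mult_left_mono sum_mono integral_mono_AE c)
    fix i assume "i \<in> I"
    then have "AE t in M i. \<bar>t\<bar> \<le> R" using assms(1) by (auto simp: moment_measure_def)
    then show "AE t in M i. f t \<le> g t" by eventually_elim (use le in auto)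
  qed (use fg assms(1) in \<open>auto intro: moment_measure_integrable\<close>)
next
  fix a :: real and f :: "real \<Rightarrow> real"
  show "c * (\<Sum>i\<in>I. \<integral>t. a * f t \<partial>M i) = a * (c * (\<Sum>i\<in>I. \<integral>t. f t \<partial>M i))"
    by (simp add: sum_distrib_left mult.left_commute)
qed

lemma positive_functional_continuous_tendsto:
  assumes \<Lambda>: "\<And>m. positive_functional R (\<Lambda> m)" and \<Lambda>': "positive_functional R \<Lambda>'"
    and mom: "\<And>n. (\<lambda>m. \<Lambda> m (\<lambda>t. t ^ n)) \<longlonglongrightarrow> \<Lambda>' (\<lambda>t. t ^ n)"
    and f: "continuous_on UNIV f"
  shows "(\<lambda>m. \<Lambda> m f) \<longlonglongrightarrow> \<Lambda>' f"
proof (rule LIMSEQ_I)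
  fix e :: real assume e: "e > 0"
  have fR: "bounded_on_interval R f" by (rule bounded_on_interval_continuous[OF f])
  define C where "C = \<bar>\<Lambda>' (\<lambda>t. 1)\<bar> + 1"
  have C: "C > 0" by (simp add: C_def add_nonneg_pos)
  obtain a n where an: "\<And>t. \<bar>t\<bar> \<le> R \<Longrightarrow> \<bar>f t - (\<Sum>i\<le>n. a i * t ^ i)\<bar> < e / (4 * C)"
    using polynomial_uniform_approx[of R f "e / (4 * C)"] continuous_on_subset[OF f] e C by auto
  define p where "p t = (\<Sum>i\<le>n. a i * t ^ i)" for t
  have pR: "bounded_on_interval R p"
    unfolding p_def by (intro bounded_on_interval_sum bounded_on_interval_mult) auto
  have poly: "\<Phi> (\<lambda>t. \<Sum>i\<le>n. a i * t ^ i) = (\<Sum>i\<le>n. a i * \<Phi> (\<lambda>t. t ^ i))"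
    if "positive_functional R \<Phi>" for \<Phi> n
    using that
  proof (induction n)
    case 0
    show ?case using positive_functional_cmult[OF 0, of "a 0" "\<lambda>_. 1"] by simp
  next
    case (Suc n)
    have "\<Phi> (\<lambda>t. (\<Sum>i\<le>n. a i * t ^ i) + a (Suc n) * t ^ Suc n)
        = \<Phi> (\<lambda>t. \<Sum>i\<le>n. a i * t ^ i) + \<Phi> (\<lambda>t. a (Suc n) * t ^ Suc n)"
      by (intro positive_functional_add[OF Suc.prems] bounded_on_interval_sum bounded_on_interval_mult
          bounded_on_interval_const bounded_on_interval_power)
    also have "\<Phi> (\<lambda>t. a (Suc n) * t ^ Suc n) = a (Suc n) * \<Phi> (\<lambda>t. t ^ Suc n)"
      by (rule positive_functional_cmult[OF Suc.prems])
    finally show ?case using Suc by simp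
  qed
  have close: "\<bar>\<Phi> f - \<Phi> p\<bar> \<le> e / (4 * C) * \<Phi> (\<lambda>t. 1)" if \<Phi>: "positive_functional R \<Phi>" for \<Phi>
  proof -
    have ad: "\<Phi> (\<lambda>t. h t + c * 1) = \<Phi> h + c * \<Phi> (\<lambda>t. 1)" if "bounded_on_interval R h" for c h
      using positive_functional_add[OF \<Phi> that bounded_on_interval_const[of R c]]
        positive_functional_cmult[OF \<Phi>, of c "\<lambda>_. 1"] by simp
    note mono = positive_functional_mono[OF \<Phi>]
    have "\<Phi> f \<le> \<Phi> (\<lambda>t. p t + e / (4 * C) * 1)"
    proof (rule mono[OF fR])
      show "f t \<le> p t + e / (4 * C) * 1" if "\<bar>t\<bar> \<le> R" for t
        using an[OF that] by (simp add: p_def)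
    qed (intro bounded_on_interval_add pR bounded_on_interval_const)
    moreover have "\<Phi> p \<le> \<Phi> (\<lambda>t. f t + e / (4 * C) * 1)"
    proof (rule mono[OF pR])
      show "p t \<le> f t + e / (4 * C) * 1" if "\<bar>t\<bar> \<le> R" for t
        using an[OF that] by (simp add: p_def)
    qed (intro bounded_on_interval_add fR bounded_on_interval_const)
    ultimately show ?thesis unfolding ad[OF pR] ad[OF fR] by linarith
  qed
  have "(\<lambda>m. \<Lambda> m p) \<longlonglongrightarrow> \<Lambda>' p"
    unfolding p_def poly[OF \<Lambda>] poly[OF \<Lambda>'] by (intro tendsto_intros mom)
  from tendstoD[OF this, of "e / 4"]
  have "\<forall>\<^sub>F m in sequentially. \<bar>\<Lambda> m p - \<Lambda>' p\<bar> < e / 4"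
    using e by (simp add: dist_real_def)
  moreover have "\<forall>\<^sub>F m in sequentially. \<Lambda> m (\<lambda>t. 1) < C"
    using mom[of 0] by (intro order_tendstoD) (auto simp: C_def)
  ultimately have "\<forall>\<^sub>F m in sequentially. norm (\<Lambda> m f - \<Lambda>' f) < e"
  proof eventually_elim
    case (elim m)
    have "e / (4 * C) * \<Lambda> m (\<lambda>t. 1) \<le> e / (4 * C) * C"
      using elim e C by (intro mult_left_mono) auto
    moreover have "e / (4 * C) * \<Lambda>' (\<lambda>t. 1) \<le> e / (4 * C) * C"
      using e C by (intro mult_left_mono) (auto simp: C_def)
    moreover have "e / (4 * C) * C = e / 4" using C by simp
    moreover note close[OF \<Lambda>, of m] close[OF \<Lambda>']
    ultimately show ?case using elim e unfolding real_norm_def by linarith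
  qed
  then show "\<exists>no. \<forall>m\<ge>no. norm (\<Lambda> m f - \<Lambda>' f) < e"
    by (simp add: eventually_sequentially)
qed

lemma lower_ramp_bounds: "ramp (Suc k) (a - 1 / real (Suc k)) t \<le> indicator {..<a} t"
proof (cases "t < a")
  case False
  have "real (Suc k) * (t - (a - 1 / real (Suc k))) = real (Suc k) * (t - a) + 1"
    by (simp add: algebra_simps del: of_nat_Suc)
  moreover have "real (Suc k) * (t - a) \<ge> 0" using False by (intro mult_nonneg_nonneg) auto
  ultimately have "ramp (Suc k) (a - 1 / real (Suc k)) t = 0"
    unfolding ramp_def by linarith
  with False show ?thesis by simp
qed (simp add: ramp_def)

lemma lower_ramp_tendsto: "(\<lambda>k. ramp (Suc k) (a - 1 / real (Suc k)) t) \<longlonglongrightarrow> indicator {..<a} t"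
proof (cases "t < a")
  case True
  obtain N where N: "1 / real (Suc N) < a - t"
    using reals_Archimedean[of "a - t"] True by (auto simp: inverse_eq_divide)
  have "ramp (Suc k) (a - 1 / real (Suc k)) t = 1" if "k \<ge> N" for k
  proof -
    have "1 / real (Suc k) \<le> 1 / real (Suc N)" using that by (simp add: frac_le)
    then have "t - (a - 1 / real (Suc k)) \<le> 0" using N by linarith
    then have "real (Suc k) * (t - (a - 1 / real (Suc k))) \<le> 0"
      by (intro mult_nonneg_nonpos) auto
    then show ?thesis by (simp add: ramp_def del: of_nat_Suc)
  qed
  then have "\<forall>\<^sub>F k in sequentially. ramp (Suc k) (a - 1 / real (Suc k)) t = indicator {..<a} t"
    using True by (auto simp: eventually_sequentially)
  then show ?thesis by (rule tendsto_eventually)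
next
  case False
  have "ramp (Suc k) (a - 1 / real (Suc k)) t = indicator {..<a} t" for k
    using lower_ramp_bounds[of k a t] ramp_bounds(1)[of "Suc k" "a - 1 / real (Suc k)" t] False
    by (simp del: of_nat_Suc)
  then show ?thesis by simp
qed

text \<open>Convergence of moments bounds $\limsup \mu_m(-\infty,a]$ from above and
  $\liminf \mu_m(-\infty,a)$ from below, by ramps approaching the half-lines from outside and from
  inside. A lower bound for the mass at $a$ closes the gap.\<close>

theorem distribution_function_tendsto:
  assumes \<Lambda>: "\<And>m. positive_functional R (\<Lambda> m)"
    and M: "finite J" "\<And>j. j \<in> J \<Longrightarrow> moment_measure R (M j)"
    and \<Lambda>': "\<And>f. \<Lambda>' f = (\<Sum>j\<in>J. \<integral>t. f t \<partial>M j)"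
    and mom: "\<And>n. (\<lambda>m. \<Lambda> m (\<lambda>t. t ^ n)) \<longlonglongrightarrow> \<Lambda>' (\<lambda>t. t ^ n)"
    and atom: "\<And>e. e > 0 \<Longrightarrow> \<forall>\<^sub>F m in sequentially. \<Lambda> m (indicator {a}) \<ge> \<Lambda>' (indicator {a}) - e"
  shows "(\<lambda>m. \<Lambda> m (indicator {..a})) \<longlonglongrightarrow> \<Lambda>' (indicator {..a})"
proof -
  have pos': "positive_functional R \<Lambda>'"
    using positive_functional_integrals[OF M(2), where c = 1 and I = J] by (simp add: \<Lambda>'[abs_def])
  have mono: "\<Lambda> m f \<le> \<Lambda> m g"
    if "bounded_on_interval R f" "bounded_on_interval R g" "\<And>t. f t \<le> g t" for m f g
    using that by (intro positive_functional_mono[OF \<Lambda>]) auto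
  have ramp_R: "bounded_on_interval R (ramp k c)" for k c
    by (rule bounded_on_interval_continuous[OF continuous_on_ramp])
  have split: "\<Phi> (indicator {..a}) = \<Phi> (indicator {..<a}) + \<Phi> (indicator {a})"
    if "positive_functional R \<Phi>" for \<Phi>
  proof -
    have "\<Phi> (\<lambda>t. indicator {..<a} t + indicator {a} t) = \<Phi> (indicator {..<a}) + \<Phi> (indicator {a})"
      by (rule positive_functional_add[OF that]) auto
    moreover have "(\<lambda>t. indicator {..<a} t + indicator {a} t) = (indicator {..a} :: real \<Rightarrow> real)"
      by (auto simp: indicator_def)
    ultimately show ?thesis by simp
  qed
  have conv: "(\<lambda>k. \<Lambda>' (h k)) \<longlonglongrightarrow> \<Lambda>' g"
    if "\<And>k. h k \<in> borel_measurable borel" "g \<in> borel_measurable borel"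
      "\<And>t. (\<lambda>k. h k t) \<longlonglongrightarrow> g t" "\<And>k t. \<bar>h k t\<bar> \<le> 1" for h g
    unfolding \<Lambda>' by (intro tendsto_sum moment_measure_tendsto[OF M(2), where K = 1]) (use that in auto)
  have "(\<lambda>k. \<Lambda>' (ramp k a)) \<longlonglongrightarrow> \<Lambda>' (indicator {..a})"
    by (rule conv) (use ramp_bounds ramp_tendsto in \<open>auto simp: abs_of_nonneg\<close>)
  note upper = this
  have "(\<lambda>k. \<Lambda>' (ramp (Suc k) (a - 1 / real (Suc k)))) \<longlonglongrightarrow> \<Lambda>' (indicator {..<a})"
    by (rule conv) (use ramp_bounds lower_ramp_tendsto in \<open>auto simp: abs_of_nonneg\<close>)
  note lower = this
  show ?thesis
  proof (rule LIMSEQ_I)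
    fix e :: real assume e: "e > 0"
    have "\<forall>\<^sub>F k in sequentially. \<Lambda>' (ramp k a) < \<Lambda>' (indicator {..a}) + e / 4"
      using upper e by (intro order_tendstoD) auto
    then obtain k where k: "\<Lambda>' (ramp k a) < \<Lambda>' (indicator {..a}) + e / 4"
      by (auto simp: eventually_sequentially)
    have "\<forall>\<^sub>F k in sequentially. \<Lambda>' (ramp (Suc k) (a - 1 / real (Suc k))) > \<Lambda>' (indicator {..<a}) - e / 4"
      using lower e by (intro order_tendstoD) auto
    then obtain l where l: "\<Lambda>' (ramp (Suc l) (a - 1 / real (Suc l))) > \<Lambda>' (indicator {..<a}) - e / 4"
      by (auto simp: eventually_sequentially)
    have cont: "(\<lambda>m. \<Lambda> m (ramp k c)) \<longlonglongrightarrow> \<Lambda>' (ramp k c)" for k c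
      by (rule positive_functional_continuous_tendsto[OF \<Lambda> pos' mom continuous_on_ramp])
    have "\<forall>\<^sub>F m in sequentially. \<Lambda> m (ramp k a) < \<Lambda>' (ramp k a) + e / 4"
      using cont e by (intro order_tendstoD) auto
    moreover have "\<forall>\<^sub>F m in sequentially. \<Lambda> m (ramp (Suc l) (a - 1 / real (Suc l)))
        > \<Lambda>' (ramp (Suc l) (a - 1 / real (Suc l))) - e / 4"
      using cont e by (intro order_tendstoD) auto
    moreover have "\<forall>\<^sub>F m in sequentially. \<Lambda> m (indicator {a}) \<ge> \<Lambda>' (indicator {a}) - e / 4"
      using atom[of "e / 4"] e by simp
    ultimately have "\<forall>\<^sub>F m in sequentially. norm (\<Lambda> m (indicator {..a}) - \<Lambda>' (indicator {..a})) < e"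
    proof eventually_elim
      case (elim m)
      have "\<Lambda> m (indicator {..a}) \<le> \<Lambda> m (ramp k a)"
        by (rule mono) (auto intro: ramp_R ramp_bounds)
      moreover have "\<Lambda> m (ramp (Suc l) (a - 1 / real (Suc l))) \<le> \<Lambda> m (indicator {..<a})"
        by (rule mono) (auto intro: ramp_R lower_ramp_bounds simp del: of_nat_Suc)
      moreover note split[OF \<Lambda>, of m] split[OF pos']
      ultimately show ?case using elim k l e unfolding real_norm_def by linarith
    qed
    then show "\<exists>no. \<forall>m\<ge>no. norm (\<Lambda> m (indicator {..a}) - \<Lambda>' (indicator {..a})) < e"
      by (simp add: eventually_sequentially)
  qed
qed

section \<open>Kernel dimensions under a finite trace\<close>


definition commutant :: "('a::real_normed_vector \<Rightarrow> 'a) set \<Rightarrow> ('a \<Rightarrow> 'a) set" where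
  "commutant \<W> = {U. bounded_linear U \<and> (\<forall>W\<in>\<W>. \<forall>x. W (U x) = U (W x))}"

lemma commutantI:
  "bounded_linear U \<Longrightarrow> (\<And>W x. W \<in> \<W> \<Longrightarrow> W (U x) = U (W x)) \<Longrightarrow> U \<in> commutant \<W>"
  by (simp add: commutant_def)

lemma commutant_bounded_linear: "U \<in> commutant \<W> \<Longrightarrow> bounded_linear U"
  by (simp add: commutant_def)

lemma commutantD: "U \<in> commutant \<W> \<Longrightarrow> W \<in> \<W> \<Longrightarrow> W (U x) = U (W x)"
  by (simp add: commutant_def)

lemma commutant_compose:
  assumes U: "U \<in> commutant \<W>" and V: "V \<in> commutant \<W>"
  shows "(\<lambda>x. U (V x)) \<in> commutant \<W>"
proof (rule commutantI)
  show "bounded_linear (\<lambda>x. U (V x))"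
    by (rule bounded_linear_compose[OF commutant_bounded_linear[OF U] commutant_bounded_linear[OF V]])
qed (simp add: commutantD[OF U] commutantD[OF V])

lemma commutant_id: "(\<lambda>x. x) \<in> commutant \<W>"
  by (simp add: commutant_def bounded_linear_ident)

lemma commutant_add:
  assumes U: "U \<in> commutant \<W>" and V: "V \<in> commutant \<W>" and W: "\<And>W. W \<in> \<W> \<Longrightarrow> bounded_linear W"
  shows "(\<lambda>x. U x + V x) \<in> commutant \<W>" and "(\<lambda>x. U x - V x) \<in> commutant \<W>"
proof -
  note lin = linear_add[OF bounded_linear.linear[OF W]] linear_diff[OF bounded_linear.linear[OF W]]
  show "(\<lambda>x. U x + V x) \<in> commutant \<W>"
    by (rule commutantI) (simp_all add: lin commutantD[OF U] commutantD[OF V] bounded_linear_add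
        commutant_bounded_linear[OF U] commutant_bounded_linear[OF V])
  show "(\<lambda>x. U x - V x) \<in> commutant \<W>"
    by (rule commutantI) (simp_all add: lin commutantD[OF U] commutantD[OF V] bounded_linear_sub
        commutant_bounded_linear[OF U] commutant_bounded_linear[OF V])
qed

lemma orthogonal_projection_norm_le:
  fixes Q :: "'a::real_inner \<Rightarrow> 'a"
  assumes "\<And>x y. Q x \<bullet> y = x \<bullet> Q y" "\<And>x. Q (Q x) = Q x"
  shows "norm (Q x) \<le> norm x" and "Q x \<bullet> x = (norm (Q x))\<^sup>2"
proof -
  show eq: "Q x \<bullet> x = (norm (Q x))\<^sup>2"
    using assms(1)[of "Q x" x] assms(2)[of x] by (simp add: power2_norm_eq_inner)
  have "Q x \<bullet> x \<le> norm (Q x) * norm x" by (rule norm_cauchy_schwarz)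
  then show "norm (Q x) \<le> norm x"
    unfolding eq power2_eq_square by (cases "norm (Q x) = 0") auto
qed

text \<open>Think of $\mathrm{tr}(U) = \sum_{i\in I}\langle Ue_i,e_i\rangle$ as a trace on the commutant of
  \<open>\<W>\<close>, and of \<open>Q\<close>, \<open>N\<close>, \<open>D\<close> as projections onto an eigenspace, onto the kernel of the compressed
  operator \<open>B\<close>, and onto the functions over the boundary. The hypothesis on \<open>B P Q\<close> says that \<open>B\<close>
  maps the restrictions $PQx$ into the range of \<open>D\<close>. Let $\Pi$ be the projection onto
  $\ker\,(1-D)B$. It fixes all $PQx$, so that $\mathrm{tr}(Q) \le \mathrm{tr}(\Pi)$, and $C = B\Pi$ has
  range in that of \<open>D\<close>. The nullity of \<open>C\<close> is at most $\mathrm{tr}(1-\Pi) + \mathrm{tr}(N)$, that of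
  $C^*$ at least $\mathrm{tr}(1-D) \ge \#(I \setminus J)$. The two are equal: $\mathrm{tr}((C^*C)^k) = \mathrm{tr}((CC^*)^k)$
  for all $k$, so the spectral distributions of $C^*C$ and $CC^*$ agree, in particular at $0$.\<close>

theorem kernel_trace_estimate:
  fixes B D P Q N :: "'a::{real_inner,complete_space} \<Rightarrow> 'a" and e :: "'i \<Rightarrow> 'a"
  assumes W_lin: "\<And>W. W \<in> \<W> \<Longrightarrow> bounded_linear W"
    and W_adj: "\<And>W. W \<in> \<W> \<Longrightarrow> \<exists>W'. \<forall>x y. W x \<bullet> y = x \<bullet> W' y"
    and I: "finite I" "J \<subseteq> I" and e_norm: "\<And>i. i \<in> I \<Longrightarrow> norm (e i) = 1"
    and tracial: "\<And>U V. U \<in> commutant \<W> \<Longrightarrow> V \<in> commutant \<W> \<Longrightarrow> (\<And>x y. U x \<bullet> y = x \<bullet> V y) \<Longrightarrow>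
       (\<Sum>i\<in>I. (norm (U (e i)))\<^sup>2) = (\<Sum>i\<in>I. (norm (V (e i)))\<^sup>2)"
    and B: "B \<in> commutant \<W>" "\<And>x y. B x \<bullet> y = x \<bullet> B y"
    and D: "D \<in> commutant \<W>" "\<And>x y. D x \<bullet> y = x \<bullet> D y" "\<And>x. D (D x) = D x"
    and D_e: "\<And>i. i \<in> I - J \<Longrightarrow> D (e i) = 0"
    and P: "P \<in> \<W>" and P_sym: "\<And>x y. P x \<bullet> y = x \<bullet> P y" and P_e: "\<And>x. P (P x) = P x" "\<And>i. i \<in> I \<Longrightarrow> P (e i) = e i"
    and Q: "\<And>x y. Q x \<bullet> y = x \<bullet> Q y" "\<And>x. Q (Q x) = Q x"
    and BPQ: "\<And>x. D (B (P (Q x))) = B (P (Q x))"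
    and N: "\<And>x y. N x \<bullet> y = x \<bullet> N y" "\<And>x. N (N x) = N x"
    and ker: "\<And>x. P x = x \<Longrightarrow> B x = 0 \<Longrightarrow> N x = x"
  shows "(\<Sum>i\<in>I. (norm (Q (e i)))\<^sup>2) \<le> (\<Sum>i\<in>I. (norm (N (e i)))\<^sup>2) + real (card J)"
proof -
  interpret B: bounded_linear B using B(1) by (rule commutant_bounded_linear)
  interpret D: bounded_linear D using D(1) by (rule commutant_bounded_linear)
  interpret P: bounded_linear P using P by (rule W_lin)
  have sym_op: "\<exists>R. symmetric_operator U R"
    if U: "bounded_linear U" "\<And>x y. U x \<bullet> y = x \<bullet> U y" for U :: "'a \<Rightarrow> 'a"
  proof -
    obtain K where "K > 0" "\<And>x. norm (U x) \<le> norm x * K"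
      using bounded_linear.pos_bounded[OF U(1)] by blast
    then have "symmetric_operator U K"
      using U by (intro symmetric_operator.intro) (auto simp: mult.commute)
    then show ?thesis by blast
  qed
  have spec_comm: "symmetric_operator.spectral_projection U R C \<in> commutant \<W>"
    if U: "symmetric_operator U R" "U \<in> commutant \<W>" and C: "C \<in> sets borel" for U R C
  proof -
    interpret symmetric_operator U R by (rule U(1))
    have "W (spectral_projection C x) = spectral_projection C (W x)" if W: "W \<in> \<W>" for W x
    proof -
      obtain W' where "\<And>x y. W x \<bullet> y = x \<bullet> W' y" using W_adj[OF W] by blast
      then show ?thesis
        by (rule spectral_projection_commute[OF W_lin[OF W] _ commutantD[OF U(2) W] C])
    qed
    then show ?thesis
      by (rule commutantI[OF spectral_projection_linear[OF C]])
  qed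
  \<comment> \<open>The projection onto the kernel of $(1-D)B$.\<close>
  define Q1 where "Q1 x = B (B x - D (B x))" for x
  have Q1_comm: "Q1 \<in> commutant \<W>"
    unfolding Q1_def[abs_def]
    by (rule commutant_compose[OF B(1) commutant_add(2)[OF B(1) commutant_compose[OF D(1) B(1)] W_lin]])
  have Q1_sym: "Q1 x \<bullet> y = x \<bullet> Q1 y" for x y
    by (simp add: Q1_def B D B.diff inner_diff)
  obtain R1 where R1: "symmetric_operator Q1 R1"
    using sym_op[OF commutant_bounded_linear[OF Q1_comm] Q1_sym] by blast
  define Pi where "Pi = symmetric_operator.spectral_projection Q1 R1 {0}"
  have Pi_comm: "Pi \<in> commutant \<W>"
    unfolding Pi_def by (rule spec_comm[OF R1 Q1_comm]) auto
  interpret Pi: bounded_linear Pi using Pi_comm by (rule commutant_bounded_linear)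
  have Pi_sym: "Pi x \<bullet> y = x \<bullet> Pi y" for x y
    unfolding Pi_def using symmetric_operator.spectral_projection_sym[OF R1] by simp
  have Pi_idem: "Pi (Pi x) = Pi x" for x
    unfolding Pi_def using symmetric_operator.spectral_projection_Int[OF R1, of "{0}" "{0}"] by simp
  have Pi_ker: "D (B (Pi x)) = B (Pi x)" for x
  proof -
    have "Q1 (Pi x) = 0"
      using symmetric_operator.spectral_projection_eigen[OF R1, of 0 x] by (simp add: Pi_def)
    then have "0 = Q1 (Pi x) \<bullet> Pi x" by simp
    also have "\<dots> = (B (Pi x) - D (B (Pi x))) \<bullet> B (Pi x)" by (simp add: Q1_def B)
    also have "\<dots> = (norm (B (Pi x) - D (B (Pi x))))\<^sup>2"
      using D(2)[of "D (B (Pi x))" "B (Pi x)"] D(2)[of "B (Pi x)" "D (B (Pi x))"]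
      by (simp add: power2_norm_eq_inner inner_diff D(3))
    finally show ?thesis by simp
  qed
  have Pi_of_ker: "Pi x = x" if "D (B x) = B x" for x
    unfolding Pi_def by (rule symmetric_operator.spectral_projection_of_eigen[OF R1])
      (simp add: Q1_def that B.zero)
  note Pi_le = orthogonal_projection_norm_le[OF Pi_sym Pi_idem]
  note Q_le = orthogonal_projection_norm_le[OF Q]
  note N_le = orthogonal_projection_norm_le[OF N]
  note P_le = orthogonal_projection_norm_le[OF P_sym P_e(1)]
  \<comment> \<open>As \<open>P\<close> fixes $e_i$, the operator $PQP$ has the same diagonal entries as \<open>Q\<close>. It is symmetric,
    has norm at most $1$ and range in that of $\Pi$, hence is dominated by $\Pi$.\<close>
  have step1: "(norm (Q (e i)))\<^sup>2 \<le> (norm (Pi (e i)))\<^sup>2" if i: "i \<in> I" for i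
  proof -
    define z where "z = Pi (e i)"
    define K where "K x = P (Q (P x))" for x
    have K_sym: "K x \<bullet> y = x \<bullet> K y" for x y by (simp add: K_def P_sym Q)
    have PiK: "Pi (K x) = K x" for x unfolding K_def by (rule Pi_of_ker[OF BPQ])
    have "(norm (Q (e i)))\<^sup>2 = Q (e i) \<bullet> e i" by (simp add: Q_le(2))
    also have "\<dots> = Q (P (e i)) \<bullet> P (e i)" by (simp add: P_e(2)[OF i])
    also have "\<dots> = K (e i) \<bullet> e i" by (simp only: K_def P_sym)
    also have "\<dots> = Pi (K (e i)) \<bullet> e i" by (simp only: PiK)
    also have "\<dots> = e i \<bullet> K z" by (simp only: Pi_sym z_def K_sym)
    also have "\<dots> = e i \<bullet> Pi (K z)" by (simp only: PiK)
    also have "\<dots> = z \<bullet> K z" by (simp only: z_def Pi_sym)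
    also have "\<dots> = Q (P z) \<bullet> P z" by (simp only: K_def P_sym[symmetric] inner_commute)
    also have "\<dots> = (norm (Q (P z)))\<^sup>2" by (rule Q_le(2))
    also have "\<dots> \<le> (norm z)\<^sup>2"
      using Q_le(1)[of "P z"] P_le(1)[of z] by (intro power_mono) auto
    finally show ?thesis by (simp add: z_def)
  qed
  define C where "C x = B (Pi x)" for x
  define C' where "C' x = Pi (B x)" for x
  have CC': "C x \<bullet> y = x \<bullet> C' y" for x y by (simp add: C_def C'_def B Pi_sym)
  have C'C: "C' x \<bullet> y = x \<bullet> C y" for x y by (simp add: C_def C'_def B Pi_sym)
  have C_comm: "C \<in> commutant \<W>" and C'_comm: "C' \<in> commutant \<W>"
    unfolding C_def[abs_def] C'_def[abs_def]
    by (rule commutant_compose[OF B(1) Pi_comm], rule commutant_compose[OF Pi_comm B(1)])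
  define T1 where "T1 x = C' (C x)" for x
  define T2 where "T2 x = C (C' x)" for x
  have T1_comm: "T1 \<in> commutant \<W>" and T2_comm: "T2 \<in> commutant \<W>"
    unfolding T1_def[abs_def] T2_def[abs_def]
    by (rule commutant_compose[OF C'_comm C_comm], rule commutant_compose[OF C_comm C'_comm])
  have T1_sym: "T1 x \<bullet> y = x \<bullet> T1 y" and T2_sym: "T2 x \<bullet> y = x \<bullet> T2 y" for x y
    by (simp_all only: T1_def T2_def CC' C'C)
  obtain r1 where r1: "symmetric_operator T1 r1"
    using sym_op[OF commutant_bounded_linear[OF T1_comm] T1_sym] by blast
  obtain r2 where r2: "symmetric_operator T2 r2"
    using sym_op[OF commutant_bounded_linear[OF T2_comm] T2_sym] by blast
  interpret T1: symmetric_operator T1 r1 by (rule r1)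
  interpret T2: symmetric_operator T2 r2 by (rule r2)
  \<comment> \<open>The polarised trace property $\mathrm{tr}(V^*U) = \mathrm{tr}(UV^*)$.\<close>
  have polar: "(\<Sum>i\<in>I. U (e i) \<bullet> V (e i)) = (\<Sum>i\<in>I. V' (e i) \<bullet> U' (e i))"
    if U: "U \<in> commutant \<W>" "U' \<in> commutant \<W>" "\<And>x y. U x \<bullet> y = x \<bullet> U' y"
      and V: "V \<in> commutant \<W>" "V' \<in> commutant \<W>" "\<And>x y. V x \<bullet> y = x \<bullet> V' y" for U U' V V'
  proof -
    have "(\<Sum>i\<in>I. (norm (U (e i) + V (e i)))\<^sup>2) = (\<Sum>i\<in>I. (norm (U' (e i) + V' (e i)))\<^sup>2)"
      by (rule tracial[OF commutant_add(1)[OF U(1) V(1) W_lin] commutant_add(1)[OF U(2) V(2) W_lin]])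
        (simp_all add: inner_add U(3) V(3))
    moreover have "(\<Sum>i\<in>I. (norm (U (e i) - V (e i)))\<^sup>2) = (\<Sum>i\<in>I. (norm (U' (e i) - V' (e i)))\<^sup>2)"
      by (rule tracial[OF commutant_add(2)[OF U(1) V(1) W_lin] commutant_add(2)[OF U(2) V(2) W_lin]])
        (simp_all add: inner_diff U(3) V(3))
    moreover have "(norm (x + y))\<^sup>2 - (norm (x - y))\<^sup>2 = 4 * (x \<bullet> y)" for x y :: 'a
      by (simp add: power2_norm_eq_inner inner_add inner_diff inner_commute)
    then have "(\<Sum>i\<in>I. (norm (F (e i) + G (e i)))\<^sup>2) - (\<Sum>i\<in>I. (norm (F (e i) - G (e i)))\<^sup>2)
        = 4 * (\<Sum>i\<in>I. F (e i) \<bullet> G (e i))" for F G :: "'a \<Rightarrow> 'a"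
      by (simp add: sum_distrib_left flip: sum_subtractf)
    note this[of U V] this[of U' V']
    ultimately show ?thesis by (simp add: inner_commute)
  qed
  have pow_comm: "(T1 ^^ k) \<in> commutant \<W>" for k
  proof (induction k)
    case (Suc k)
    then show ?case using commutant_compose[OF T1_comm Suc] by (simp add: comp_def)
  qed (simp add: commutant_id id_def)
  have shift: "C ((T1 ^^ k) (C' x)) = (T2 ^^ Suc k) x" for k x
  proof (induction k)
    case (Suc k)
    have "C ((T1 ^^ Suc k) (C' x)) = T2 (C ((T1 ^^ k) (C' x)))" by (simp add: T1_def T2_def)
    then show ?case using Suc by simp
  qed (simp add: T2_def)
  have moments: "(\<Sum>i\<in>I. (T1 ^^ k) (e i) \<bullet> e i) = (\<Sum>i\<in>I. (T2 ^^ k) (e i) \<bullet> e i)" for k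
  proof (cases k)
    case (Suc n)
    have "(\<Sum>i\<in>I. (T1 ^^ k) (e i) \<bullet> e i) = (\<Sum>i\<in>I. C ((T1 ^^ n) (e i)) \<bullet> C (e i))"
      by (simp add: Suc T1_def C'C)
    also have "\<dots> = (\<Sum>i\<in>I. C' (e i) \<bullet> (T1 ^^ n) (C' (e i)))"
      by (rule polar[OF commutant_compose[OF C_comm pow_comm] commutant_compose[OF pow_comm C'_comm] _
            C_comm C'_comm CC']) (simp add: CC' T1.pow_sym)
    also have "\<dots> = (\<Sum>i\<in>I. (T2 ^^ k) (e i) \<bullet> e i)"
    proof (rule sum.cong[OF refl])
      fix i
      have "(T1 ^^ n) (C' (e i)) \<bullet> C' (e i) = (T2 ^^ Suc n) (e i) \<bullet> e i"
        by (simp only: CC'[symmetric] shift)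
      then show "C' (e i) \<bullet> (T1 ^^ n) (C' (e i)) = (T2 ^^ k) (e i) \<bullet> e i"
        by (simp only: Suc inner_commute[of "C' (e i)"])
    qed
    finally show ?thesis .
  qed simp
  have atoms: "(\<Sum>i\<in>I. measure (T1.spectral_measure (e i)) {0}) = (\<Sum>i\<in>I. measure (T2.spectral_measure (e i)) {0})"
  proof -
    obtain l where l: "set l = I" "distinct l" using finite_distinct_list[OF I(1)] by blast
    define L where "L = map (\<lambda>i. (\<lambda>_ :: real. 1 :: real, T1.spectral_measure (e i))) l @
        map (\<lambda>i. (\<lambda>_. - 1, T2.spectral_measure (e i))) l"
    have L: "weighted_integral L f = (\<Sum>i\<in>I. \<integral>t. f t \<partial>T1.spectral_measure (e i))
        - (\<Sum>i\<in>I. \<integral>t. f t \<partial>T2.spectral_measure (e i))" for f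
      by (simp add: weighted_integral_def L_def o_def sum_list_distinct_conv_sum_set l sum_negf)
    have "weighted_integral L (indicator {0}) = 0"
    proof (rule weighted_integral_eq_0[where R = "max r1 r2"])
      show "admissible (max r1 r2) L"
        by (auto simp: admissible_def L_def moment_measure_mono[OF T1.spectral_measure]
            moment_measure_mono[OF T2.spectral_measure])
      show "weighted_integral L (\<lambda>t. t ^ n) = 0" for n
        by (simp add: L T1.spectral_measure_moment T2.spectral_measure_moment moments)
    qed simp
    then show ?thesis by (simp add: L)
  qed
  \<comment> \<open>For $w$ in the kernel of $C$, the vector $\Pi w$ lies in the kernel of \<open>B\<close>. So the projection
    of $e_i$ onto $\ker C$ is controlled by $Ne_i$ and $(1-\Pi)e_i$.\<close>
  have step2: "measure (T1.spectral_measure (e i)) {0} \<le> (norm (N (e i)))\<^sup>2 + 1 - (norm (Pi (e i)))\<^sup>2"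
    if i: "i \<in> I" for i
  proof -
    define Z where "Z = T1.spectral_projection {0}"
    define w where "w = Z (e i)"
    have Z_comm: "Z \<in> commutant \<W>" unfolding Z_def by (rule spec_comm[OF r1 T1_comm]) auto
    have "P w = w"
      using commutantD[OF Z_comm P, of "e i"] P_e(2)[OF i] by (simp add: w_def)
    then have PPi: "P (Pi w) = Pi w"
      using commutantD[OF Pi_comm P, of w] by simp
    have "T1 w = 0"
      using T1.spectral_projection_eigen[of 0 "e i"] by (simp add: w_def Z_def)
    then have "(norm (C w))\<^sup>2 = 0"
      using C'C[of "C w" w] by (simp add: power2_norm_eq_inner T1_def)
    then have "N (Pi w) = Pi w" using ker[OF PPi] by (simp add: C_def)
    then have Pw: "Pi w \<bullet> e i = Pi w \<bullet> N (e i)" using N(1)[of "Pi w" "e i"] by simp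
    have w: "w \<bullet> e i = (norm w)\<^sup>2" "measure (T1.spectral_measure (e i)) {0} = (norm w)\<^sup>2"
      using T1.measure_spectral_measure[of "{0}" "e i"] by (simp_all add: w_def Z_def)
    have amgm: "x \<bullet> y \<le> ((norm x)\<^sup>2 + (norm y)\<^sup>2) / 2" for x y :: 'a
      using norm_cauchy_schwarz[of x y] sum_squares_bound[of "norm x" "norm y"] by simp
    have pyth: "(norm x)\<^sup>2 = (norm (Pi x))\<^sup>2 + (norm (x - Pi x))\<^sup>2" for x
      using Pi_le(2)[of x] by (simp add: power2_norm_eq_inner inner_diff inner_commute)
    have orth: "(w - Pi w) \<bullet> e i = (w - Pi w) \<bullet> (e i - Pi (e i))"
      by (simp add: inner_diff Pi_sym[symmetric] Pi_idem Pi.diff)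
    have "(norm w)\<^sup>2 = Pi w \<bullet> N (e i) + (w - Pi w) \<bullet> (e i - Pi (e i))"
      using w(1) Pw orth by (simp add: inner_diff)
    also have "\<dots> \<le> ((norm (Pi w))\<^sup>2 + (norm (N (e i)))\<^sup>2) / 2
        + ((norm (w - Pi w))\<^sup>2 + (norm (e i - Pi (e i)))\<^sup>2) / 2"
      by (intro add_mono amgm)
    finally have le: "(norm w)\<^sup>2 \<le> ((norm (Pi w))\<^sup>2 + (norm (N (e i)))\<^sup>2) / 2
        + ((norm (w - Pi w))\<^sup>2 + (norm (e i - Pi (e i)))\<^sup>2) / 2" .
    have "(norm (e i))\<^sup>2 = 1" using e_norm[OF i] by simp
    then have pyth_e: "(norm (e i - Pi (e i)))\<^sup>2 = 1 - (norm (Pi (e i)))\<^sup>2"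
      using pyth[of "e i"] by linarith
    have arith: "a \<le> b + 1 - c" if "a \<le> (u + b) / 2 + (v + d) / 2" "a = u + v" "d = 1 - c"
      for a b c d u v :: real
      using that by (simp add: field_simps)
    show ?thesis unfolding w(2) by (rule arith[OF le pyth pyth_e])
  qed
  \<comment> \<open>A vector killed by \<open>D\<close> is killed by $C^* = C^*D$.\<close>
  have step3: "measure (T2.spectral_measure (e i)) {0} \<ge> (if i \<in> J then 0 else 1)" if i: "i \<in> I" for i
  proof (cases "i \<in> J")
    case False
    have "C' (e i) \<bullet> x = 0" for x
    proof -
      have "C' (e i) \<bullet> x = e i \<bullet> D (C x)" by (simp add: C'C C_def Pi_ker)
      also have "\<dots> = 0" using D_e[of i] i False by (simp flip: D(2))
      finally show ?thesis .
    qed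
    then have "C' (e i) = 0" by (metis inner_eq_zero_iff)
    moreover have "C 0 = 0" by (simp add: C_def Pi.zero B.zero)
    ultimately have "T2 (e i) = 0 *\<^sub>R e i" by (simp add: T2_def)
    then have "T2.spectral_projection {0} (e i) = e i" by (rule T2.spectral_projection_of_eigen)
    then show ?thesis
      using T2.measure_spectral_measure(2)[of "{0}" "e i"] e_norm[OF i] False by simp
  qed simp
  have "(\<Sum>i\<in>I. (norm (Q (e i)))\<^sup>2) \<le> (\<Sum>i\<in>I. (norm (Pi (e i)))\<^sup>2)"
    by (intro sum_mono step1)
  also have "\<dots> \<le> (\<Sum>i\<in>I. (norm (N (e i)))\<^sup>2 + 1 - measure (T1.spectral_measure (e i)) {0})"
    using step2 by (intro sum_mono) (simp add: algebra_simps)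
  also have "\<dots> = (\<Sum>i\<in>I. (norm (N (e i)))\<^sup>2 + 1) - (\<Sum>i\<in>I. measure (T2.spectral_measure (e i)) {0})"
    by (simp add: sum_subtractf atoms)
  also have "\<dots> \<le> (\<Sum>i\<in>I. (norm (N (e i)))\<^sup>2 + 1) - (\<Sum>i\<in>I. if i \<in> J then 0 else 1)"
    using step3 by (intro diff_left_mono sum_mono)
  also have "\<dots> = (\<Sum>i\<in>I. (norm (N (e i)))\<^sup>2) + (\<Sum>i\<in>I. if i \<in> J then 1 else 0)"
    unfolding sum_subtractf[symmetric] sum.distrib[symmetric] by (intro sum.cong) auto
  also have "(\<Sum>i\<in>I. if i \<in> J then 1 else 0 :: real) = real (card J)"
    using I by (simp add: sum.If_cases Int_absorb1)
  finally show ?thesis .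
qed

section \<open>Twisted right translations\<close>

locale twisted_extension =
  fixes G :: "('g, 'm) monoid_scheme" (structure) and Z :: "('z, 'n) monoid_scheme"
    and p :: "'g \<Rightarrow> 'z" and s :: "'z \<Rightarrow> 'g" and \<sigma> :: "'g \<Rightarrow> 'g \<Rightarrow> complex"
  assumes G: "group G" and Z: "comm_group Z" and p_hom: "p \<in> hom G Z"
    and s: "\<And>z. z \<in> carrier Z \<Longrightarrow> s z \<in> carrier G" "\<And>z. z \<in> carrier Z \<Longrightarrow> p (s z) = z"
    and mult: "multiplier G \<sigma>"
begin

sublocale G: group G by (rule G)
sublocale Z: comm_group Z by (rule Z)

lemma p_mult: "x \<in> carrier G \<Longrightarrow> y \<in> carrier G \<Longrightarrow> p (x \<otimes> y) = p x \<otimes>\<^bsub>Z\<^esub> p y"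
  using p_hom by (simp add: hom_def)

lemma p_closed: "x \<in> carrier G \<Longrightarrow> p x \<in> carrier Z"
  using p_hom by (auto simp: hom_def)

lemma p_inv: "x \<in> carrier G \<Longrightarrow> p (inv x) = inv\<^bsub>Z\<^esub> (p x)"
  using p_hom G.is_group Z.is_group by (meson group_hom.hom_inv group_hom.intro group_hom_axioms.intro)

lemma sigma_norm: "a \<in> carrier G \<Longrightarrow> b \<in> carrier G \<Longrightarrow> cmod (\<sigma> a b) = 1"
  using mult by (simp add: multiplier_def)

lemma sigma_cocycle: "a \<in> carrier G \<Longrightarrow> b \<in> carrier G \<Longrightarrow> c \<in> carrier G \<Longrightarrow>
    \<sigma> b c * \<sigma> a (b \<otimes> c) = \<sigma> (a \<otimes> b) c * \<sigma> a b"
  using mult by (simp add: multiplier_def)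

lemma sigma_one: "a \<in> carrier G \<Longrightarrow> \<sigma> \<one> a = 1" "a \<in> carrier G \<Longrightarrow> \<sigma> a \<one> = 1"
  using mult by (simp_all add: multiplier_def)

lemma sigma_cnj: "a \<in> carrier G \<Longrightarrow> b \<in> carrier G \<Longrightarrow> cnj (\<sigma> a b) * \<sigma> a b = 1"
  using complex_norm_square[of "\<sigma> a b"] sigma_norm[of a b] by (simp add: mult.commute)

text \<open>The twisted right translation $(R_uv)(x) = \overline{\sigma(x,u)}\,v(xu)$. The cocycle identity
  makes it commute with the twisted left convolutions.\<close>

definition right_translation :: "'g \<Rightarrow> ('g, complex ^ 'd::finite) ell2 \<Rightarrow> ('g, complex ^ 'd) ell2" where
  "right_translation u = weighted_shift (carrier G) (\<lambda>x. x \<otimes> u) (\<lambda>x b. cnj (\<sigma> x u) *s b)"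

lemma right_translation_data:
  assumes u: "u \<in> carrier G"
  shows "shift_data (carrier G) (\<lambda>x. x \<otimes> u) (\<lambda>x b :: complex ^ 'd::finite. cnj (\<sigma> x u) *s b)"
  using u by (intro shift_data_scalar) (auto simp: inj_on_def sigma_norm)

lemma right_mult_image: "u \<in> carrier G \<Longrightarrow> (\<lambda>x. x \<otimes> u) ` carrier G = carrier G"
proof (intro equalityI subsetI)
  fix y assume "u \<in> carrier G" "y \<in> carrier G"
  then show "y \<in> (\<lambda>x. x \<otimes> u) ` carrier G"
    by (intro image_eqI[of _ _ "y \<otimes> inv u"]) (auto simp: G.m_assoc)
qed auto

lemma ell2_fun_right_translation:
  "u \<in> carrier G \<Longrightarrow> ell2_fun (right_translation u v) x
     = (if x \<in> carrier G then cnj (\<sigma> x u) *s ell2_fun v (x \<otimes> u) else 0)"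
  unfolding right_translation_def by (rule shift_data.ell2_fun_shift[OF right_translation_data])

lemma right_translation_linear: "u \<in> carrier G \<Longrightarrow> bounded_linear (right_translation u)"
  unfolding right_translation_def by (rule shift_data.shift_linear[OF right_translation_data])

lemma right_translation_norm:
  assumes "u \<in> carrier G" "restrict_ell2 (carrier G) v = v"
  shows "norm (right_translation u v) = norm v"
proof -
  have "(norm (right_translation u v))\<^sup>2 = (norm (restrict_ell2 (carrier G) v))\<^sup>2"
    unfolding right_translation_def shift_data.shift_norm[OF right_translation_data[OF assms(1)]]
    by (simp add: right_mult_image[OF assms(1)] restrict_ell2_norm)
  then show ?thesis by (simp add: assms)
qed

lemma right_translation_adjoint:
  assumes u: "u \<in> carrier G"
  shows "\<exists>W. \<forall>v (w :: ('g, complex ^ 'd::finite) ell2). right_translation u v \<bullet> w = v \<bullet> W w"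
proof -
  let ?V = "\<lambda>y b :: complex ^ 'd. \<sigma> (y \<otimes> inv u) u *s b"
  have V: "shift_data ((\<lambda>x. x \<otimes> u) ` carrier G) (\<lambda>y. y \<otimes> inv u) ?V"
    unfolding right_mult_image[OF u] using u by (intro shift_data_scalar) (auto simp: inj_on_def sigma_norm)
  have "right_translation u v \<bullet> w = v \<bullet> weighted_shift ((\<lambda>x. x \<otimes> u) ` carrier G) (\<lambda>y. y \<otimes> inv u) ?V w"
    for v w :: "('g, complex ^ 'd) ell2"
    unfolding right_translation_def
    by (rule shift_data.shift_adjoint[OF right_translation_data[OF u] V])
      (use u in \<open>simp_all add: G.m_assoc inner_vector_scalar_mult\<close>)
  then show ?thesis by blast
qed

lemma right_translation_restrict:
  assumes "u \<in> carrier G" "\<And>x. x \<in> carrier G \<Longrightarrow> x \<otimes> u \<in> S \<longleftrightarrow> x \<in> S"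
  shows "right_translation u (restrict_ell2 S v) = restrict_ell2 S (right_translation u v)"
  using assms by (intro ell2_eqI) (auto simp: ell2_fun_right_translation)

definition H :: "'g set" where "H = kernel G Z p"

lemma H_iff: "h \<in> H \<longleftrightarrow> h \<in> carrier G \<and> p h = \<one>\<^bsub>Z\<^esub>"
  by (auto simp: H_def kernel_def)

lemma H_inv: "h \<in> H \<Longrightarrow> inv h \<in> H"
  by (simp add: H_iff p_inv)

lemma preimage_right_invariant:
  assumes "u \<in> H" "x \<in> carrier G"
  shows "x \<otimes> u \<in> preimage G p X \<longleftrightarrow> x \<in> preimage G p X"
  using assms by (auto simp: preimage_def H_iff p_mult p_closed)

text \<open>The points $s(x)h$ with $x \in X$ and $h \in H$ enumerate the preimage of \<open>X\<close>.\<close>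

lemma infsum_preimage:
  fixes f :: "'g \<Rightarrow> real"
  assumes X: "finite X" "X \<subseteq> carrier Z" and f: "f summable_on preimage G p X"
  shows "infsum f (preimage G p X) = (\<Sum>x\<in>X. \<Sum>\<^sub>\<infinity>h\<in>H. f (s x \<otimes> h))"
proof -
  have fib: "(\<lambda>h. s x \<otimes> h) ` H = preimage G p {x}" if x: "x \<in> X" for x
  proof (intro equalityI subsetI)
    fix y assume "y \<in> preimage G p {x}"
    then have y: "y \<in> carrier G" "p y = x" by (auto simp: preimage_def)
    have "inv (s x) \<otimes> y \<in> H"
      using y x X s[of x] by (auto simp: H_iff p_mult p_inv)
    moreover have "s x \<otimes> (inv (s x) \<otimes> y) = y"
      using y x X s[of x] by (simp add: G.m_assoc[symmetric] subsetD)
    ultimately show "y \<in> (\<lambda>h. s x \<otimes> h) ` H" by (metis imageI)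
  next
    fix y assume "y \<in> (\<lambda>h. s x \<otimes> h) ` H"
    then show "y \<in> preimage G p {x}"
      using x X s[of x] by (auto simp: H_iff preimage_def p_mult subsetD)
  qed
  have U: "preimage G p X = (\<Union>x\<in>X. preimage G p {x})" by (auto simp: preimage_def)
  have "infsum f (preimage G p X) = (\<Sum>x\<in>X. infsum f (preimage G p {x}))"
    unfolding U
  proof (rule sum_infsum[symmetric])
    show "f summable_on preimage G p {x}" if "x \<in> X" for x
      using f by (rule summable_on_subset_banach) (use that in \<open>auto simp: preimage_def\<close>)
  qed (use X in \<open>auto simp: preimage_def\<close>)
  also have "\<dots> = (\<Sum>x\<in>X. \<Sum>\<^sub>\<infinity>h\<in>H. f (s x \<otimes> h))"
  proof (rule sum.cong[OF refl])
    fix x assume x: "x \<in> X"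
    have "inj_on (\<lambda>h. s x \<otimes> h) H"
      using x X s[of x] by (auto simp: inj_on_def H_iff subsetD)
    then show "infsum f (preimage G p {x}) = (\<Sum>\<^sub>\<infinity>h\<in>H. f (s x \<otimes> h))"
      by (simp add: fib[OF x, symmetric] infsum_reindex o_def)
  qed
  finally show ?thesis .
qed

definition basis_vec :: "'g \<Rightarrow> 'd \<Rightarrow> ('g, complex ^ 'd::finite) ell2" where
  "basis_vec g a = Abs_ell2 (unit_vec g a)"

lemma ell2_fun_basis_vec: "ell2_fun (basis_vec g a) = unit_vec g a"
  unfolding basis_vec_def
proof (rule ell2_fun_Abs)
  show "(\<lambda>x. (norm (unit_vec g a x))\<^sup>2) summable_on UNIV"
    by (subst summable_on_cong_neutral[where T = "{g}" and g = "\<lambda>x. (norm (unit_vec g a x))\<^sup>2"])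
      (auto simp: unit_vec_def)
qed

lemma restrict_basis_vec: "restrict_ell2 S (basis_vec g a) = (if g \<in> S then basis_vec g a else 0)"
  by (rule ell2_eqI) (simp add: ell2_fun_basis_vec unit_vec_def)

lemma inner_basis_vec: "v \<bullet> basis_vec g a = Re (ell2_fun v g $ a)"
proof -
  have "v \<bullet> basis_vec g a = (\<Sum>\<^sub>\<infinity>x\<in>{g}. ell2_fun v x \<bullet> axis a 1)"
    unfolding inner_ell2_def
    by (rule infsum_cong_neutral) (auto simp: ell2_fun_basis_vec unit_vec_def)
  then show ?thesis by (simp add: inner_axis inner_complex_def)
qed

lemma inner_mult_i_basis_vec: "v \<bullet> mult_i (basis_vec g a) = Im (ell2_fun v g $ a)"
proof -
  have "v \<bullet> mult_i (basis_vec g a) = - (mult_i v \<bullet> basis_vec g a)"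
    by (simp add: mult_i_skew)
  then show ?thesis by (simp add: inner_basis_vec)
qed

lemma norm_basis_vec: "norm (basis_vec g a) = 1"
  by (simp add: norm_eq_sqrt_inner inner_basis_vec ell2_fun_basis_vec unit_vec_def)

lemma right_translation_basis_vec:
  assumes "u \<in> carrier G" "y \<in> carrier G"
  shows "right_translation u (basis_vec (y \<otimes> u) a)
    = Re (cnj (\<sigma> y u)) *\<^sub>R basis_vec y a + Im (cnj (\<sigma> y u)) *\<^sub>R mult_i (basis_vec y a)"
proof (rule ell2_eqI)
  fix x
  have "ell2_fun (right_translation u (basis_vec (y \<otimes> u) a)) x = cnj (\<sigma> y u) *s ell2_fun (basis_vec y a) x"
    using assms by (auto simp: ell2_fun_right_translation ell2_fun_basis_vec unit_vec_def)
  then show "ell2_fun (right_translation u (basis_vec (y \<otimes> u) a)) x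
    = ell2_fun (Re (cnj (\<sigma> y u)) *\<^sub>R basis_vec y a + Im (cnj (\<sigma> y u)) *\<^sub>R mult_i (basis_vec y a)) x"
    using fun_cong[OF scalar_mult_ell2[of "cnj (\<sigma> y u)" "basis_vec y a"], of x] by simp
qed

section \<open>The trace property\<close>

text \<open>Operators that commute with these are complex linear, preserve $l^2(p^{-1}(X))^d$ and its
  orthogonal complement, and commute with the twisted right translations by \<open>H\<close>.\<close>

definition symmetries :: "'z set \<Rightarrow> (('g, complex ^ 'd::finite) ell2 \<Rightarrow> ('g, complex ^ 'd) ell2) set" where
  "symmetries X = {mult_i, restrict_ell2 (preimage G p X)} \<union> right_translation ` H"

lemma symmetries_linear: "W \<in> symmetries X \<Longrightarrow> bounded_linear W"
  by (auto simp: symmetries_def mult_i_linear restrict_ell2_linear H_iff right_translation_linear)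

lemma symmetries_adjoint: "W \<in> symmetries X \<Longrightarrow> \<exists>W'. \<forall>x y. W x \<bullet> y = x \<bullet> W' y"
proof -
  assume "W \<in> symmetries X"
  then consider "W = mult_i" | "W = restrict_ell2 (preimage G p X)"
    | u where "u \<in> carrier G" "W = right_translation u"
    by (auto simp: symmetries_def H_iff)
  then show ?thesis
  proof cases
    case 1
    show ?thesis unfolding 1 by (intro exI[of _ "\<lambda>y. - mult_i y"] allI mult_i_adjoint)
  next
    case 2
    show ?thesis unfolding 2
      by (intro exI[of _ "restrict_ell2 (preimage G p X)"] allI restrict_ell2_sym)
  next
    case 3
    show ?thesis unfolding 3(2) by (rule right_translation_adjoint[OF 3(1)])
  qed
qed

lemma norm_vec_sq: "(norm (b :: complex ^ 'd::finite))\<^sup>2 = (\<Sum>a\<in>UNIV. (cmod (b $ a))\<^sup>2)"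
  by (simp add: norm_vec_def L2_set_def sum_nonneg)

lemma adjoint_entry:
  assumes adj: "\<And>x y. U x \<bullet> y = x \<bullet> V y" and V: "V \<in> commutant (symmetries X)"
  shows "(cmod (ell2_fun (U (basis_vec y b)) z $ a))\<^sup>2 = (cmod (ell2_fun (V (basis_vec z a)) y $ b))\<^sup>2"
proof -
  have J: "V (mult_i x) = mult_i (V x)" for x
    using commutantD[OF V, of mult_i x] by (simp add: symmetries_def)
  have "Re (ell2_fun (U (basis_vec y b)) z $ a) = Re (ell2_fun (V (basis_vec z a)) y $ b)"
    using adj[of "basis_vec y b" "basis_vec z a"]
    unfolding inner_commute[of "basis_vec y b"] inner_basis_vec .
  moreover have "Im (ell2_fun (U (basis_vec y b)) z $ a) = - Im (ell2_fun (V (basis_vec z a)) y $ b)"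
  proof -
    have "U (basis_vec y b) \<bullet> mult_i (basis_vec z a) = mult_i (V (basis_vec z a)) \<bullet> basis_vec y b"
      by (simp only: adj J inner_commute[of "basis_vec y b"])
    also have "\<dots> = - (V (basis_vec z a) \<bullet> mult_i (basis_vec y b))" by (rule mult_i_skew)
    finally show ?thesis by (simp only: inner_mult_i_basis_vec)
  qed
  ultimately show ?thesis by (simp add: cmod_power2)
qed

text \<open>Up to a phase, $R_h$ maps $\delta_{yh,b}$ to $\delta_{y,b}$; the phases do not affect absolute
  values of matrix entries.\<close>

lemma translated_entry:
  assumes V: "V \<in> commutant (symmetries X)" and h: "h \<in> H" and yz: "y \<in> carrier G" "z \<in> carrier G"
  shows "norm (ell2_fun (V (basis_vec (y \<otimes> h) b)) (z \<otimes> h)) = norm (ell2_fun (V (basis_vec y b)) z)"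
proof -
  interpret V: bounded_linear V using V by (rule commutant_bounded_linear)
  have hG: "h \<in> carrier G" using h by (simp add: H_iff)
  have J: "V (mult_i x) = mult_i (V x)" for x
    using commutantD[OF V, of mult_i x] by (simp add: symmetries_def)
  let ?c = "cnj (\<sigma> y h)"
  have "right_translation h (V (basis_vec (y \<otimes> h) b)) = V (right_translation h (basis_vec (y \<otimes> h) b))"
    using h by (intro commutantD[OF V]) (auto simp: symmetries_def)
  also have "\<dots> = Re ?c *\<^sub>R V (basis_vec y b) + Im ?c *\<^sub>R mult_i (V (basis_vec y b))"
    by (simp only: right_translation_basis_vec[OF hG yz(1)] V.add V.scaleR J)
  finally have "ell2_fun (right_translation h (V (basis_vec (y \<otimes> h) b))) z = ?c *s ell2_fun (V (basis_vec y b)) z"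
    using fun_cong[OF scalar_mult_ell2[of ?c "V (basis_vec y b)"], of z] by simp
  then have "norm (cnj (\<sigma> z h) *s ell2_fun (V (basis_vec (y \<otimes> h) b)) (z \<otimes> h)) = norm (?c *s ell2_fun (V (basis_vec y b)) z)"
    using hG yz by (simp add: ell2_fun_right_translation)
  then show ?thesis
    using hG yz by (simp add: norm_vector_scalar_mult sigma_norm)
qed

text \<open>Both sides are sums of squared absolute values of matrix entries, over rows in one and over
  columns in the other case. Translating the entry at $(s(x), s(x')h)$ by $h^{-1}$ gives the one at
  $(s(x)h^{-1}, s(x'))$, which exchanges the summation over all rows and the representatives of
  the columns with that over all columns and the representatives of the rows.\<close>

lemma trace_symmetric:
  assumes X: "finite X" "X \<subseteq> carrier Z"
    and U: "U \<in> commutant (symmetries X)" and V: "V \<in> commutant (symmetries X)"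
    and adj: "\<And>x y. U x \<bullet> y = x \<bullet> V y"
  shows "(\<Sum>x\<in>X. \<Sum>a\<in>UNIV. (norm (U (basis_vec (s x) a)))\<^sup>2) = (\<Sum>x\<in>X. \<Sum>a\<in>UNIV. (norm (V (basis_vec (s x) a)))\<^sup>2)"
proof -
  let ?S = "preimage G p X"
  define kU where "kU x y = (\<Sum>a\<in>UNIV. (norm (ell2_fun (U (basis_vec x a)) y))\<^sup>2)" for x y
  define kV where "kV x y = (\<Sum>a\<in>UNIV. (norm (ell2_fun (V (basis_vec x a)) y))\<^sup>2)" for x y
  have sx: "s x \<in> carrier G" "s x \<in> ?S" if "x \<in> X" for x
    using that X s[of x] by (auto simp: preimage_def)
  have kUV: "kU x y = kV y x" for x y
    unfolding kU_def kV_def norm_vec_sq by (subst sum.swap) (simp add: adjoint_entry[OF adj V])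
  have kV_shift: "kV (y \<otimes> h) (z \<otimes> h) = kV y z" if "h \<in> H" "y \<in> carrier G" "z \<in> carrier G" for h y z
    unfolding kV_def using that by (simp add: translated_entry[OF V])
  have norm_sum: "(\<Sum>a\<in>UNIV. (norm (F (basis_vec (s x) a)))\<^sup>2)
      = (\<Sum>\<^sub>\<infinity>y\<in>?S. \<Sum>a\<in>UNIV. (norm (ell2_fun (F (basis_vec (s x) a)) y))\<^sup>2)"
    "(\<lambda>y. \<Sum>a\<in>UNIV. (norm (ell2_fun (F (basis_vec (s x) a)) y))\<^sup>2) summable_on ?S"
    if F: "F \<in> commutant (symmetries X)" and x: "x \<in> X" for F x
  proof -
    have "restrict_ell2 ?S (F (basis_vec (s x) a)) = F (basis_vec (s x) a)" for a
      using commutantD[OF F, of "restrict_ell2 ?S" "basis_vec (s x) a"] sx[OF x]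
      by (simp add: symmetries_def restrict_basis_vec)
    then have "((\<lambda>y. (norm (ell2_fun (F (basis_vec (s x) a)) y))\<^sup>2) has_sum (norm (F (basis_vec (s x) a)))\<^sup>2) ?S" for a
      using restrict_ell2_norm[of ?S "F (basis_vec (s x) a)"] has_sum_infsum[OF ell2_summable[of "F (basis_vec (s x) a)" ?S]]
      by simp
    then have *: "((\<lambda>y. \<Sum>a\<in>UNIV. (norm (ell2_fun (F (basis_vec (s x) a)) y))\<^sup>2) has_sum (\<Sum>a\<in>UNIV. (norm (F (basis_vec (s x) a)))\<^sup>2)) ?S"
      by (rule has_sum_finite_sum)
    show "(\<Sum>a\<in>UNIV. (norm (F (basis_vec (s x) a)))\<^sup>2)
      = (\<Sum>\<^sub>\<infinity>y\<in>?S. \<Sum>a\<in>UNIV. (norm (ell2_fun (F (basis_vec (s x) a)) y))\<^sup>2)"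
      using infsumI[OF *] by simp
    show "(\<lambda>y. \<Sum>a\<in>UNIV. (norm (ell2_fun (F (basis_vec (s x) a)) y))\<^sup>2) summable_on ?S"
      using * by (rule has_sum_imp_summable)
  qed
  have "(\<Sum>x\<in>X. \<Sum>a\<in>UNIV. (norm (U (basis_vec (s x) a)))\<^sup>2) = (\<Sum>x\<in>X. infsum (kU (s x)) ?S)"
    unfolding kU_def[abs_def] by (rule sum.cong[OF refl norm_sum(1)[OF U]])
  also have "\<dots> = (\<Sum>x\<in>X. \<Sum>x'\<in>X. \<Sum>\<^sub>\<infinity>h\<in>H. kU (s x) (s x' \<otimes> h))"
  proof (rule sum.cong[OF refl])
    fix x assume x: "x \<in> X"
    show "infsum (kU (s x)) ?S = (\<Sum>x'\<in>X. \<Sum>\<^sub>\<infinity>h\<in>H. kU (s x) (s x' \<otimes> h))"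
      by (rule infsum_preimage[OF X]) (unfold kU_def[abs_def], rule norm_sum(2)[OF U x])
  qed
  also have "\<dots> = (\<Sum>x\<in>X. \<Sum>x'\<in>X. \<Sum>\<^sub>\<infinity>h\<in>H. kV (s x') (s x \<otimes> h))"
  proof (intro sum.cong refl)
    fix x x' assume x: "x \<in> X" "x' \<in> X"
    have "(\<Sum>\<^sub>\<infinity>h\<in>H. kU (s x) (s x' \<otimes> h)) = (\<Sum>\<^sub>\<infinity>h\<in>H. kV (s x') (s x \<otimes> inv h))"
    proof (rule infsum_cong)
      fix h assume h: "h \<in> H"
      then have hG: "h \<in> carrier G" by (simp add: H_iff)
      have "kV (s x' \<otimes> h \<otimes> inv h) (s x \<otimes> inv h) = kV (s x' \<otimes> h) (s x)"
        using kV_shift[OF H_inv[OF h], of "s x' \<otimes> h" "s x"] hG sx x by simp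
      then show "kU (s x) (s x' \<otimes> h) = kV (s x') (s x \<otimes> inv h)"
        using hG sx x by (simp add: kUV G.m_assoc)
    qed
    also have "\<dots> = (\<Sum>\<^sub>\<infinity>h\<in>H. kV (s x') (s x \<otimes> h))"
      by (rule infsum_reindex_bij_witness[of _ "\<lambda>h. inv h" "\<lambda>h. inv h"]) (auto simp: H_iff p_inv)
    finally show "(\<Sum>\<^sub>\<infinity>h\<in>H. kU (s x) (s x' \<otimes> h)) = (\<Sum>\<^sub>\<infinity>h\<in>H. kV (s x') (s x \<otimes> h))" .
  qed
  also have "\<dots> = (\<Sum>x'\<in>X. \<Sum>x\<in>X. \<Sum>\<^sub>\<infinity>h\<in>H. kV (s x') (s x \<otimes> h))"
    by (rule sum.swap)
  also have "\<dots> = (\<Sum>x\<in>X. infsum (kV (s x)) ?S)"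
  proof (rule sum.cong[OF refl])
    fix x assume x: "x \<in> X"
    show "(\<Sum>x'\<in>X. \<Sum>\<^sub>\<infinity>h\<in>H. kV (s x) (s x' \<otimes> h)) = infsum (kV (s x)) ?S"
      by (rule infsum_preimage[OF X, symmetric]) (unfold kV_def[abs_def], rule norm_sum(2)[OF V x])
  qed
  also have "\<dots> = (\<Sum>x\<in>X. \<Sum>a\<in>UNIV. (norm (V (basis_vec (s x) a)))\<^sup>2)"
    unfolding kV_def[abs_def] by (rule sum.cong[OF refl norm_sum(1)[OF V, symmetric]])
  finally show ?thesis .
qed

end

section \<open>Boundaries of Foelner sets\<close>

text \<open>The inner boundary of \<open>X\<close> with respect to a set \<open>F\<close> of steps. Each step maps the
  points that it leads out of \<open>X\<close> injectively into an outer boundary, which is small for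
  F\o{}lner sets.\<close>

definition leaving :: "('z, 'n) monoid_scheme \<Rightarrow> 'z set \<Rightarrow> 'z set \<Rightarrow> 'z set" where
  "leaving Z F X = {x \<in> X. \<exists>f\<in>F. x \<otimes>\<^bsub>Z\<^esub> f \<notin> X}"

context comm_group
begin

lemma word_exists:
  assumes S: "finite_generating_set G S" and f: "f \<in> carrier G"
  shows "\<exists>ws. set ws \<subseteq> S \<union> m_inv G ` S \<and> f = foldr (\<otimes>) ws \<one>"
proof -
  have SG: "S \<subseteq> carrier G" and "f \<in> generate G S"
    using S f by (auto simp: finite_generating_set_def)
  from this(2) show ?thesis
  proof induction
    case one
    show ?case by (intro exI[of _ "[]"]) simp
  next
    case (incl h)
    then show ?case using SG by (intro exI[of _ "[h]"]) auto
  next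
    case (inv h)
    then show ?case using SG by (intro exI[of _ "[inv h]"]) auto
  next
    case (eng h1 h2)
    then obtain ws1 ws2 where ws: "set ws1 \<subseteq> S \<union> m_inv G ` S" "h1 = foldr (\<otimes>) ws1 \<one>"
      "set ws2 \<subseteq> S \<union> m_inv G ` S" "h2 = foldr (\<otimes>) ws2 \<one>" by blast
    have cl: "foldr (\<otimes>) ws \<one> \<in> carrier G" if "set ws \<subseteq> S \<union> m_inv G ` S" for ws
      using that SG by (induction ws) auto
    have "foldr (\<otimes>) (ws @ ws2) \<one> = foldr (\<otimes>) ws \<one> \<otimes> foldr (\<otimes>) ws2 \<one>"
      if "set ws \<subseteq> S \<union> m_inv G ` S" for ws
      using that
    proof (induction ws)
      case (Cons w ws)
      have "w \<in> carrier G" using Cons.prems SG by auto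
      then show ?case using Cons cl[of ws] cl[OF ws(3)] by (simp add: m_assoc)
    qed (use cl[OF ws(3)] in simp)
    then show ?case using ws by (intro exI[of _ "ws1 @ ws2"]) auto
  qed
qed

lemma word_dist_translate:
  assumes S: "finite_generating_set G S" and f: "f \<in> carrier G"
  shows "\<exists>n. \<forall>x\<in>carrier G. word_dist G S x (x \<otimes> f) \<le> n"
proof -
  obtain ws where "set ws \<subseteq> S \<union> m_inv G ` S" "f = foldr (\<otimes>) ws \<one>"
    using word_exists[OF S f] by blast
  then have "word_dist G S x (x \<otimes> f) \<le> length ws" for x
    unfolding word_dist_def by (intro Least_le) blast
  then show ?thesis by blast
qed

text \<open>Finiteness matters because the cardinality of an infinite set is $0$ by convention.\<close>

lemma finite_outer_boundary:
  assumes S: "finite_generating_set G S" and X: "finite X" "X \<subseteq> carrier G"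
  shows "finite (outer_boundary G S \<delta> X)"
proof -
  let ?T = "S \<union> m_inv G ` S"
  have "outer_boundary G S \<delta> X \<subseteq>
      (\<lambda>(x, ws). x \<otimes> foldr (\<otimes>) ws \<one>) ` (X \<times> {ws. set ws \<subseteq> ?T \<and> length ws \<le> nat \<lfloor>\<delta>\<rfloor>})"
  proof
    fix y assume "y \<in> outer_boundary G S \<delta> X"
    then obtain x where x: "x \<in> X" "real (word_dist G S x y) \<le> \<delta>" and y: "y \<in> carrier G"
      by (auto simp: outer_boundary_def)
    have xG: "x \<in> carrier G" using x X by auto
    let ?P = "\<lambda>n. \<exists>ws. length ws = n \<and> set ws \<subseteq> ?T \<and> y = x \<otimes> foldr (\<otimes>) ws \<one>"
    obtain ws where "set ws \<subseteq> ?T" "inv x \<otimes> y = foldr (\<otimes>) ws \<one>"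
      using word_exists[OF S, of "inv x \<otimes> y"] xG y by auto
    moreover have "x \<otimes> (inv x \<otimes> y) = y" using xG y by (simp add: m_assoc[symmetric])
    ultimately have "?P (length ws)" by metis
    then have "?P (word_dist G S x y)"
      unfolding word_dist_def by (rule LeastI)
    then obtain ws' where ws': "length ws' = word_dist G S x y" "set ws' \<subseteq> ?T" "y = x \<otimes> foldr (\<otimes>) ws' \<one>"
      by blast
    have "length ws' \<le> nat \<lfloor>\<delta>\<rfloor>" using x(2) ws'(1) by linarith
    with ws' x show "y \<in> (\<lambda>(x, ws). x \<otimes> foldr (\<otimes>) ws \<one>) ` (X \<times> {ws. set ws \<subseteq> ?T \<and> length ws \<le> nat \<lfloor>\<delta>\<rfloor>})"
      by (intro image_eqI[of _ _ "(x, ws')"]) auto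
  qed
  moreover have "finite ?T" using S by (auto simp: finite_generating_set_def)
  ultimately show ?thesis
    using X finite_lists_length_le[of ?T "nat \<lfloor>\<delta>\<rfloor>"] finite_subset by blast
qed

lemma card_leaving_le:
  assumes S: "finite_generating_set G S" and F: "finite F" "F \<subseteq> carrier G"
  shows "\<exists>\<delta>>0. \<forall>X. finite X \<longrightarrow> X \<subseteq> carrier G \<longrightarrow>
           card (leaving G F X) \<le> card F * card (outer_boundary G S \<delta> X)"
proof -
  have "\<forall>f\<in>F. \<exists>n. \<forall>x\<in>carrier G. word_dist G S x (x \<otimes> f) \<le> n"
    using word_dist_translate[OF S] F by auto
  then obtain n where n: "\<And>f x. f \<in> F \<Longrightarrow> x \<in> carrier G \<Longrightarrow> word_dist G S x (x \<otimes> f) \<le> n f"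
    by metis
  define \<delta> where "\<delta> = real (\<Sum>f\<in>F. n f) + 1"
  have "card (leaving G F X) \<le> card F * card (outer_boundary G S \<delta> X)"
    if X: "finite X" "X \<subseteq> carrier G" for X
  proof -
    let ?L = "\<lambda>f. {x \<in> X. x \<otimes> f \<notin> X}"
    have "card (?L f) \<le> card (outer_boundary G S \<delta> X)" if f: "f \<in> F" for f
    proof (rule card_inj_on_le)
      have fG: "f \<in> carrier G" using f F by auto
      show "inj_on (\<lambda>x. x \<otimes> f) (?L f)"
        using fG X by (auto simp: inj_on_def subsetD)
      have nf: "n f \<le> (\<Sum>f\<in>F. n f)" using f F by (intro member_le_sum) auto
      have "real (word_dist G S x (x \<otimes> f)) \<le> \<delta>" if "x \<in> X" for x
      proof -
        have "word_dist G S x (x \<otimes> f) \<le> (\<Sum>f\<in>F. n f)"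
          using n[OF f, of x] that X nf by (meson order_trans subsetD)
        then show ?thesis unfolding \<delta>_def by linarith
      qed
      then show "(\<lambda>x. x \<otimes> f) ` ?L f \<subseteq> outer_boundary G S \<delta> X"
        using fG X by (auto simp: outer_boundary_def subsetD intro!: bexI)
    qed (rule finite_outer_boundary[OF S X])
    moreover have "leaving G F X = (\<Union>f\<in>F. ?L f)" by (auto simp: leaving_def)
    then have "card (leaving G F X) \<le> (\<Sum>f\<in>F. card (?L f))"
      using card_UN_le[OF F(1)] by simp
    ultimately show ?thesis
      using sum_bounded_above[of F "\<lambda>f. card (?L f)" "card (outer_boundary G S \<delta> X)"] by force
  qed
  moreover have "\<delta> > 0" by (simp add: \<delta>_def add_nonneg_pos sum_nonneg)
  ultimately show ?thesis by blast
qed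

lemma leaving_ratio_tendsto:
  assumes S: "finite_generating_set G S" and X: "folner_exhaustion G S X"
    and F: "finite F" "F \<subseteq> carrier G"
  shows "(\<lambda>m. real (card (leaving G F (X m))) / real (card (X m))) \<longlonglongrightarrow> 0"
proof -
  obtain \<delta> where \<delta>: "\<delta> > 0" and le: "\<And>X. finite X \<Longrightarrow> X \<subseteq> carrier G \<Longrightarrow>
      card (leaving G F X) \<le> card F * card (outer_boundary G S \<delta> X)"
    using card_leaving_le[OF S F] by blast
  have fin: "finite (X m)" "X m \<subseteq> carrier G" for m
    using X by (auto simp: folner_exhaustion_def)
  have lim: "(\<lambda>m. real (card (outer_boundary G S \<delta> (X m))) / real (card (X m))) \<longlonglongrightarrow> 0"
    using X \<delta> by (simp add: folner_exhaustion_def)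
  show ?thesis
  proof (rule Lim_null_comparison)
    show "(\<lambda>m. real (card F) * (real (card (outer_boundary G S \<delta> (X m))) / real (card (X m)))) \<longlonglongrightarrow> 0"
      using tendsto_mult_right_zero[OF lim] by simp
    have "real (card (leaving G F (X m))) / real (card (X m))
        \<le> real (card F) * (real (card (outer_boundary G S \<delta> (X m))) / real (card (X m)))" for m
    proof -
      have "real (card (leaving G F (X m))) \<le> real (card F * card (outer_boundary G S \<delta> (X m)))"
        using le[OF fin] of_nat_le_iff by blast
      then show ?thesis by (simp add: divide_right_mono)
    qed
    then show "\<forall>\<^sub>F m in sequentially. norm (real (card (leaving G F (X m))) / real (card (X m)))
        \<le> real (card F) * (real (card (outer_boundary G S \<delta> (X m))) / real (card (X m)))"
      by (intro always_eventually) simp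
  qed
qed

end

section \<open>Twisted convolution operators and their compressions\<close>

lemma orthogonal_projection_onto_l2:
  fixes w :: "('g, complex ^ 'd::finite) ell2"
  shows "orthogonal_projection_onto (l2 S) (ell2_fun w) = ell2_fun (restrict_ell2 S w)"
proof -
  interpret P: bounded_linear "restrict_ell2 S" by (rule restrict_ell2_linear)
  have diff: "(\<lambda>x. ell2_fun w x - ell2_fun v x) = ell2_fun (w - v)" for v
    by (simp add: fun_eq_iff)
  have PP: "restrict_ell2 S (restrict_ell2 S v) = restrict_ell2 S v" for v
    by (simp add: restrict_ell2_restrict)
  show ?thesis
    unfolding orthogonal_projection_onto_def
  proof (rule the_equality)
    show "ell2_fun (restrict_ell2 S w) \<in> l2 S \<and>
        (\<forall>f\<in>l2 S. l2_inner (\<lambda>x. ell2_fun w x - ell2_fun (restrict_ell2 S w) x) f = 0)"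
    proof (intro conjI ballI)
      show "ell2_fun (restrict_ell2 S w) \<in> l2 S" by (simp add: ell2_fun_in_l2_iff PP)
      fix f :: "('g, 'd) vfun" assume "f \<in> l2 S"
      then obtain u where u: "f = ell2_fun u" "restrict_ell2 S u = u" by (auto simp: l2_iff)
      have orth: "(w - restrict_ell2 S w) \<bullet> v = 0" if "restrict_ell2 S v = v" for v
        using restrict_ell2_sym[of S "w - restrict_ell2 S w" v] that by (simp add: P.diff PP)
      show "l2_inner (\<lambda>x. ell2_fun w x - ell2_fun (restrict_ell2 S w) x) f = 0"
        unfolding diff u(1) l2_inner_ell2
        using orth[OF u(2)] orth[of "mult_i u"] u(2) by (simp add: complex_eq_iff flip: mult_i_restrict)
    qed
  next
    fix v :: "('g, 'd) vfun" assume v: "v \<in> l2 S \<and> (\<forall>f\<in>l2 S. l2_inner (\<lambda>x. ell2_fun w x - v x) f = 0)"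
    then obtain v' where v': "v = ell2_fun v'" "restrict_ell2 S v' = v'" by (auto simp: l2_iff)
    define z where "z = restrict_ell2 S w - v'"
    have z: "restrict_ell2 S z = z" by (simp add: z_def P.diff PP v')
    then have "l2_inner (ell2_fun (w - v')) (ell2_fun z) = 0"
      using v by (simp add: v'(1) diff ell2_fun_in_l2_iff)
    then have "(w - v') \<bullet> restrict_ell2 S z = 0" by (simp add: l2_inner_ell2 z complex_eq_iff)
    moreover have "z \<bullet> z = (w - v') \<bullet> restrict_ell2 S z"
      unfolding restrict_ell2_sym[symmetric] by (simp add: z_def P.diff v'(2))
    ultimately have "z \<bullet> z = 0" by simp
    then show "v = ell2_fun (restrict_ell2 S w)" by (simp add: z_def v')
  qed
qed

locale twisted_operator = twisted_extension G Z p s \<sigma>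
  for G :: "('g, 'm) monoid_scheme" (structure) and Z :: "('z, 'n) monoid_scheme"
    and p :: "'g \<Rightarrow> 'z" and s :: "'z \<Rightarrow> 'g" and \<sigma> :: "'g \<Rightarrow> 'g \<Rightarrow> complex" +
  fixes A :: "'g \<Rightarrow> complex ^ 'd ^ 'd::finite"
  assumes A: "A \<in> group_algebra_matrices G"
    and sa: "self_adjoint_on (carrier G) (twisted_action G \<sigma> A)"
begin

definition supp :: "'g set" where "supp = {g. A g \<noteq> 0}"

lemma finite_supp: "finite supp" and supp_carrier: "g \<in> supp \<Longrightarrow> g \<in> carrier G"
  using A by (auto simp: supp_def group_algebra_matrices_def)

text \<open>Substituting $h = g^{-1}x$ leaves a finite sum over the support of \<open>A\<close>.\<close>

lemma twisted_action_eq: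
  assumes x: "x \<in> carrier G"
  shows "twisted_action G \<sigma> A f x = (\<Sum>g\<in>supp. \<sigma> g (inv g \<otimes> x) *s (A g *v f (inv g \<otimes> x)))"
proof -
  let ?t = "\<lambda>h. \<sigma> (x \<otimes> inv h) h *s (A (x \<otimes> inv h) *v f h)"
  let ?K = "(\<lambda>g. inv g \<otimes> x) ` supp"
  have "twisted_action G \<sigma> A f x = infsum ?t (carrier G)"
    using x by (simp add: twisted_action_def)
  also have "\<dots> = infsum ?t ?K"
  proof (rule infsum_cong_neutral)
    fix h assume h: "h \<in> carrier G - ?K"
    have "A (x \<otimes> inv h) = 0"
    proof (rule ccontr)
      assume "A (x \<otimes> inv h) \<noteq> 0"
      then have "x \<otimes> inv h \<in> supp" by (simp add: supp_def)
      moreover have "h = inv (x \<otimes> inv h) \<otimes> x"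
        using x h by (simp add: G.inv_mult_group G.m_assoc)
      ultimately have "h \<in> ?K" by (rule rev_image_eqI)
      with h show False by simp
    qed
    then show "?t h = 0" by simp
  qed (use x supp_carrier in auto)
  also have "\<dots> = sum ?t ?K" using finite_supp by simp
  also have "\<dots> = (\<Sum>g\<in>supp. ?t (inv g \<otimes> x))"
  proof (rule sum.reindex[unfolded o_def])
    show "inj_on (\<lambda>g. inv g \<otimes> x) supp"
      using x supp_carrier by (auto simp: inj_on_def)
  qed
  also have "\<dots> = (\<Sum>g\<in>supp. \<sigma> g (inv g \<otimes> x) *s (A g *v f (inv g \<otimes> x)))"
  proof (rule sum.cong[OF refl])
    fix g assume "g \<in> supp"
    then have g: "g \<in> carrier G" by (rule supp_carrier)
    have "x \<otimes> inv (inv g \<otimes> x) = g" using g x by (simp add: G.inv_mult_group G.m_assoc[symmetric])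
    then show "?t (inv g \<otimes> x) = \<sigma> g (inv g \<otimes> x) *s (A g *v f (inv g \<otimes> x))" by simp
  qed
  finally show ?thesis .
qed

definition Aop :: "('g, complex ^ 'd) ell2 \<Rightarrow> ('g, complex ^ 'd) ell2" where
  "Aop = ell2_op (carrier G) (twisted_action G \<sigma> A)"

lemma twisted_action_bounded: "bounded_operator_on (carrier G) (twisted_action G \<sigma> A)"
  using sa by (rule self_adjoint_on_bounded)

lemma ell2_fun_Aop:
  "ell2_fun (Aop v) x = (if x \<in> carrier G
     then \<Sum>g\<in>supp. \<sigma> g (inv g \<otimes> x) *s (A g *v ell2_fun v (inv g \<otimes> x)) else 0)"
proof (cases "x \<in> carrier G")
  case True
  then show ?thesis
    unfolding Aop_def ell2_fun_ell2_op[OF twisted_action_bounded]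
    by (simp add: twisted_action_eq supp_carrier cong: sum.cong_simp)
next
  case False
  then show ?thesis by (simp add: Aop_def ell2_fun_ell2_op[OF twisted_action_bounded] twisted_action_def)
qed

lemma Aop_linear: "bounded_linear Aop"
  unfolding Aop_def by (rule ell2_op_linear[OF twisted_action_bounded])

lemma Aop_sym: "Aop v \<bullet> w = v \<bullet> Aop w"
  unfolding Aop_def by (rule ell2_op_sym[OF sa])

lemma Aop_mult_i: "mult_i (Aop v) = Aop (mult_i v)"
  unfolding Aop_def by (rule ell2_op_mult_i[OF twisted_action_bounded])

lemma Aop_carrier: "restrict_ell2 (carrier G) (Aop v) = Aop v" "Aop (restrict_ell2 (carrier G) v) = Aop v"
  unfolding Aop_def by (rule restrict_ell2_op[OF twisted_action_bounded], rule ell2_op_restrict[OF twisted_action_bounded])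

lemma Aop_bound: "\<exists>R>0. \<forall>v. norm (Aop v) \<le> R * norm v"
  unfolding Aop_def by (rule ell2_op_bound[OF twisted_action_bounded])

text \<open>With $b = g^{-1}x$, the cocycle identity for $(g,b,u)$ reads
  $\sigma(b,u)\sigma(g,bu) = \sigma(x,u)\sigma(g,b)$, and the factors with second argument $u$ can be
  moved to the other side by conjugation.\<close>

lemma Aop_right_translation:
  assumes u: "u \<in> carrier G"
  shows "right_translation u (Aop v) = Aop (right_translation u v)"
proof (rule ell2_eqI)
  fix x
  show "ell2_fun (right_translation u (Aop v)) x = ell2_fun (Aop (right_translation u v)) x"
  proof (cases "x \<in> carrier G")
    case True
    have "cnj (\<sigma> x u) *s (\<sigma> g (inv g \<otimes> (x \<otimes> u)) *s (A g *v ell2_fun v (inv g \<otimes> (x \<otimes> u))))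
        = \<sigma> g (inv g \<otimes> x) *s (A g *v (cnj (\<sigma> (inv g \<otimes> x) u) *s ell2_fun v (inv g \<otimes> x \<otimes> u)))"
      if "g \<in> supp" for g
    proof -
      have g: "g \<in> carrier G" using that by (rule supp_carrier)
      define b where "b = inv g \<otimes> x"
      have b: "b \<in> carrier G" "g \<otimes> b = x"
        using g True by (auto simp: b_def G.m_assoc[symmetric])
      have bu: "inv g \<otimes> (x \<otimes> u) = b \<otimes> u" using g True u by (simp add: b_def G.m_assoc)
      have "\<sigma> b u * \<sigma> g (b \<otimes> u) = \<sigma> x u * \<sigma> g b"
        using sigma_cocycle[OF g b(1) u] b(2) by simp
      note cocycle = this
      have "cnj (\<sigma> x u) * \<sigma> g (b \<otimes> u) = (cnj (\<sigma> b u) * \<sigma> b u) * (cnj (\<sigma> x u) * \<sigma> g (b \<otimes> u))"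
        by (simp only: sigma_cnj[OF b(1) u] mult_1)
      also have "\<dots> = cnj (\<sigma> b u) * cnj (\<sigma> x u) * (\<sigma> b u * \<sigma> g (b \<otimes> u))"
        by (simp only: ac_simps)
      also have "\<dots> = (cnj (\<sigma> x u) * \<sigma> x u) * (\<sigma> g b * cnj (\<sigma> b u))"
        by (simp only: cocycle ac_simps)
      also have "\<dots> = \<sigma> g b * cnj (\<sigma> b u)"
        by (simp only: sigma_cnj[OF True u] mult_1)
      finally have "cnj (\<sigma> x u) * \<sigma> g (b \<otimes> u) = \<sigma> g b * cnj (\<sigma> b u)" .
      then show ?thesis
        by (simp add: bu vector_scalar_commute vector_smult_assoc flip: b_def)
    qed
    then have "(\<Sum>g\<in>supp. cnj (\<sigma> x u) *s (\<sigma> g (inv g \<otimes> (x \<otimes> u)) *s (A g *v ell2_fun v (inv g \<otimes> (x \<otimes> u)))))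
        = (\<Sum>g\<in>supp. \<sigma> g (inv g \<otimes> x) *s (A g *v (cnj (\<sigma> (inv g \<otimes> x) u) *s ell2_fun v (inv g \<otimes> x \<otimes> u))))"
      by (rule sum.cong[OF refl])
    also have "\<dots> = ell2_fun (Aop (right_translation u v)) x"
      using True u supp_carrier by (simp add: ell2_fun_Aop ell2_fun_right_translation cong: sum.cong_simp)
    finally show ?thesis
      using True u by (simp add: ell2_fun_right_translation ell2_fun_Aop linear_sum[OF linear_vector_scalar_mult])
  qed (use u in \<open>simp add: ell2_fun_right_translation ell2_fun_Aop\<close>)
qed

lemma Aop_support:
  assumes "ell2_fun (Aop v) x \<noteq> 0"
  shows "x \<in> carrier G" and "\<exists>g\<in>supp. ell2_fun v (inv g \<otimes> x) \<noteq> 0"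
proof -
  show x: "x \<in> carrier G" using assms by (simp add: ell2_fun_Aop split: if_splits)
  show "\<exists>g\<in>supp. ell2_fun v (inv g \<otimes> x) \<noteq> 0"
  proof (rule ccontr)
    assume "\<not> ?thesis"
    then have "ell2_fun (Aop v) x = 0" by (simp add: ell2_fun_Aop)
    with assms show False by simp
  qed
qed

definition Acomp :: "'z set \<Rightarrow> ('g, complex ^ 'd) ell2 \<Rightarrow> ('g, complex ^ 'd) ell2" where
  "Acomp X v = restrict_ell2 (preimage G p X) (Aop (restrict_ell2 (preimage G p X) v))"

lemma Acomp_linear: "bounded_linear (Acomp X)"
  unfolding Acomp_def[abs_def]
  by (rule bounded_linear_compose[OF restrict_ell2_linear bounded_linear_compose[OF Aop_linear restrict_ell2_linear]])

lemma Acomp_sym: "Acomp X v \<bullet> w = v \<bullet> Acomp X w"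
  by (simp add: Acomp_def restrict_ell2_sym Aop_sym)

lemma Acomp_bound:
  assumes "\<And>v. norm (Aop v) \<le> R * norm v" "R > 0"
  shows "norm (Acomp X v) \<le> R * norm v"
proof -
  have "norm (Acomp X v) \<le> norm (Aop (restrict_ell2 (preimage G p X) v))"
    unfolding Acomp_def by (rule restrict_ell2_norm_le)
  also have "\<dots> \<le> R * norm (restrict_ell2 (preimage G p X) v)" by (rule assms)
  also have "\<dots> \<le> R * norm v" using assms by (intro mult_left_mono restrict_ell2_norm_le) auto
  finally show ?thesis .
qed

lemma Acomp_restrict:
  "restrict_ell2 (preimage G p X) (Acomp X v) = Acomp X v"
  "Acomp X (restrict_ell2 (preimage G p X) v) = Acomp X v"
  by (simp_all add: Acomp_def restrict_ell2_restrict)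

lemma Acomp_mult_i: "mult_i (Acomp X v) = Acomp X (mult_i v)"
  by (simp add: Acomp_def mult_i_restrict Aop_mult_i)

lemma compression_eq:
  assumes "restrict_ell2 (preimage G p X) v = v"
  shows "compression (preimage G p X) (twisted_action G \<sigma> A) (ell2_fun v) = ell2_fun (Acomp X v)"
proof -
  have "restrict_ell2 (carrier G) v = v"
    using assms by (auto simp: restrict_ell2_eq_self_iff preimage_def)
  then have "twisted_action G \<sigma> A (ell2_fun v) = ell2_fun (Aop v)"
    by (simp add: Aop_def ell2_fun_ell2_op[OF twisted_action_bounded])
  then show ?thesis
    by (simp add: compression_def orthogonal_projection_onto_l2 Acomp_def assms)
qed

lemma self_adjoint_compression:
  "self_adjoint_on (preimage G p X) (compression (preimage G p X) (twisted_action G \<sigma> A))"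
  by (rule self_adjoint_onI[OF Acomp_linear[of X] Acomp_mult_i _ Acomp_sym compression_eq])
    (simp add: Acomp_restrict)

lemma ell2_op_compression:
  "ell2_op (preimage G p X) (compression (preimage G p X) (twisted_action G \<sigma> A)) = Acomp X"
proof (rule ext, rule ell2_eqI)
  fix v x
  show "ell2_fun (ell2_op (preimage G p X) (compression (preimage G p X) (twisted_action G \<sigma> A)) v) x
      = ell2_fun (Acomp X v) x"
    unfolding ell2_fun_ell2_op[OF self_adjoint_on_bounded[OF self_adjoint_compression]]
    by (simp add: compression_eq restrict_ell2_restrict Acomp_restrict)
qed

end

section \<open>Convergence of the spectral distribution functions\<close>

lemma (in symmetric_operator) pow_norm_le: "norm ((T ^^ k) x) \<le> R ^ k * norm x"
proof (induction k)
  case (Suc k)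
  have "norm ((T ^^ Suc k) x) \<le> R * norm ((T ^^ k) x)" using bound by simp
  also have "\<dots> \<le> R * (R ^ k * norm x)" using Suc R_pos by (intro mult_left_mono) auto
  finally show ?case by simp
qed simp

context twisted_operator
begin

abbreviation trans_supp :: "'z set" where
  "trans_supp \<equiv> (\<lambda>g. inv\<^bsub>Z\<^esub> (p g)) ` supp"

lemma trans_supp: "finite trans_supp" "trans_supp \<subseteq> carrier Z"
  using finite_supp supp_carrier by (auto simp: p_closed)

text \<open>\<open>reach k\<close> collects the displacements that are possible in $k$ applications of the operator.\<close>

fun reach :: "nat \<Rightarrow> 'z set" where
  "reach 0 = {\<one>\<^bsub>Z\<^esub>}"
| "reach (Suc k) = (\<lambda>(g, w). p g \<otimes>\<^bsub>Z\<^esub> w) ` (supp \<times> reach k)"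

lemma reach: "finite (reach k)" "reach k \<subseteq> carrier Z"
proof -
  show "finite (reach k)" by (induction k) (auto simp: finite_supp)
  show "reach k \<subseteq> carrier Z" by (induction k) (auto simp: supp_carrier p_closed)
qed

lemma pow_support:
  assumes "x \<in> carrier G" "ell2_fun ((Aop ^^ k) (basis_vec x a)) y \<noteq> 0"
  shows "y \<in> carrier G \<and> (\<exists>w\<in>reach k. p y = p x \<otimes>\<^bsub>Z\<^esub> w)"
  using assms(2)
proof (induction k arbitrary: y)
  case 0
  then show ?case
    using assms(1) by (auto simp: ell2_fun_basis_vec unit_vec_def p_closed split: if_splits)
next
  case (Suc k)
  have y: "y \<in> carrier G" and "\<exists>g\<in>supp. ell2_fun ((Aop ^^ k) (basis_vec x a)) (inv g \<otimes> y) \<noteq> 0"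
    using Aop_support[of "(Aop ^^ k) (basis_vec x a)" y] Suc.prems by auto
  then obtain g where g: "g \<in> supp" "ell2_fun ((Aop ^^ k) (basis_vec x a)) (inv g \<otimes> y) \<noteq> 0" by blast
  obtain w where w: "w \<in> reach k" "p (inv g \<otimes> y) = p x \<otimes>\<^bsub>Z\<^esub> w"
    using Suc.IH[OF g(2)] by blast
  have gG: "g \<in> carrier G" using g(1) by (rule supp_carrier)
  have wZ: "w \<in> carrier Z" using w(1) reach(2) by auto
  have "y = g \<otimes> (inv g \<otimes> y)" using gG y by (simp add: G.m_assoc[symmetric])
  then have "p y = p g \<otimes>\<^bsub>Z\<^esub> (p x \<otimes>\<^bsub>Z\<^esub> w)"
    using gG y w(2) p_mult[of g "inv g \<otimes> y"] by simp
  also have "\<dots> = p x \<otimes>\<^bsub>Z\<^esub> (p g \<otimes>\<^bsub>Z\<^esub> w)"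
    using gG wZ assms(1) by (intro Z.m_lcomm) (auto simp: p_closed)
  finally show ?case using y g(1) w(1) by auto
qed

lemma pow_Acomp:
  assumes x: "x \<in> carrier G" "p x \<in> X" "p x \<notin> leaving Z (\<Union>j\<le>k. reach j) X" and "j \<le> k"
  shows "(Acomp X ^^ j) (basis_vec x a) = (Aop ^^ j) (basis_vec x a)"
proof -
  have inside: "restrict_ell2 (preimage G p X) ((Aop ^^ j) (basis_vec x a)) = (Aop ^^ j) (basis_vec x a)"
    if "j \<le> k" for j
    unfolding restrict_ell2_eq_self_iff
  proof (intro allI impI, rule ccontr)
    fix y assume y: "y \<notin> preimage G p X" "ell2_fun ((Aop ^^ j) (basis_vec x a)) y \<noteq> 0"
    then obtain w where "y \<in> carrier G" "w \<in> reach j" "p y = p x \<otimes>\<^bsub>Z\<^esub> w"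
      using pow_support[OF x(1)] by blast
    then have "p y \<in> X" using x that by (auto simp: leaving_def)
    with y(1) \<open>y \<in> carrier G\<close> show False by (simp add: preimage_def)
  qed
  show ?thesis using \<open>j \<le> k\<close>
  proof (induction j)
    case (Suc j)
    then show ?case using inside[of j] inside[of "Suc j"] by (simp add: Acomp_def)
  qed simp
qed

lemma restrict_in_commutant: 
  assumes "\<And>u x. u \<in> H \<Longrightarrow> x \<in> carrier G \<Longrightarrow> x \<otimes> u \<in> S \<longleftrightarrow> x \<in> S"
  shows "restrict_ell2 S \<in> commutant (symmetries X)"
proof (rule commutantI[OF restrict_ell2_linear])
  fix W :: "('g, complex ^ 'b) ell2 \<Rightarrow> ('g, complex ^ 'b) ell2" and v
  assume "W \<in> symmetries X"
  then show "W (restrict_ell2 S v) = restrict_ell2 S (W v)"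
    using assms by (auto simp: symmetries_def mult_i_restrict restrict_ell2_restrict Int_commute
        right_translation_restrict H_iff)
qed

lemma restrict_preimage_in_commutant: "restrict_ell2 (preimage G p Y) \<in> commutant (symmetries X)"
  by (rule restrict_in_commutant) (rule preimage_right_invariant)

lemma Acomp_in_commutant: "Acomp X \<in> commutant (symmetries X)"
proof (rule commutantI[OF Acomp_linear])
  fix W :: "('g, complex ^ 'd) ell2 \<Rightarrow> ('g, complex ^ 'd) ell2" and v assume W: "W \<in> symmetries X"
  note P = commutantD[OF restrict_preimage_in_commutant W]
  show "W (Acomp X v) = Acomp X (W v)"
  proof (cases "W \<in> right_translation ` H")
    case True
    then have "W (Aop v) = Aop (W v)" for v by (auto simp: Aop_right_translation H_iff)
    then show ?thesis by (simp add: Acomp_def P)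
  next
    case False
    with W have "W = mult_i \<or> W = restrict_ell2 (preimage G p X)" by (auto simp: symmetries_def)
    then show ?thesis by (auto simp: Acomp_mult_i Acomp_restrict)
  qed
qed

lemma scaleR_in_commutant:
  fixes U :: "('g, complex ^ 'b::finite) ell2 \<Rightarrow> ('g, complex ^ 'b) ell2"
  assumes U: "U \<in> commutant (symmetries X)"
  shows "(\<lambda>x. c *\<^sub>R U x) \<in> commutant (symmetries X)"
proof (rule commutantI)
  show "bounded_linear (\<lambda>x. c *\<^sub>R U x)"
    using commutant_bounded_linear[OF U] by (rule bounded_linear_const_scaleR)
  fix W :: "('g, complex ^ 'b) ell2 \<Rightarrow> ('g, complex ^ 'b) ell2" and x
  assume W: "W \<in> symmetries X"
  show "W (c *\<^sub>R U x) = c *\<^sub>R U (W x)"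
    using linear_scale[OF bounded_linear.linear[OF symmetries_linear[OF W]]] commutantD[OF U W] by simp
qed

context
  fixes R :: real
  assumes R: "\<And>v. norm (Aop v) \<le> R * norm v" "R > 0"
begin

interpretation Aop: symmetric_operator Aop R
  by (rule symmetric_operator.intro) (use Aop_linear Aop_sym R in auto)

interpretation Acomp: symmetric_operator "Acomp X" R for X
  by (rule symmetric_operator.intro) (use Acomp_linear Acomp_sym Acomp_bound[OF R] R in auto)

text \<open>The translation $R_g$ maps $\delta_{g,a}$ to $\delta_{1,a}$, is isometric on $l^2(G)^d$ and
  commutes with the spectral projections.\<close>

lemma spectral_measure_homogeneous:
  assumes g: "g \<in> carrier G"
  shows "Aop.spectral_measure (basis_vec g a) = Aop.spectral_measure (basis_vec \<one> a)"
proof (rule measure_eqI)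
  fix B assume "B \<in> sets (Aop.spectral_measure (basis_vec g a))"
  then have B: "B \<in> sets borel" by simp
  have E1: "right_translation g (basis_vec g a) = basis_vec \<one> a"
    using right_translation_basis_vec[OF g G.one_closed, of a] g by (simp add: sigma_one)
  obtain W where W: "\<And>v w :: ('g, complex ^ 'd) ell2. right_translation g v \<bullet> w = v \<bullet> W w"
    using right_translation_adjoint[OF g] by blast
  let ?E = "Aop.spectral_projection B"
  have "?E (basis_vec \<one> a) = right_translation g (?E (basis_vec g a))"
    unfolding E1[symmetric]
    by (rule Aop.spectral_projection_commute[OF right_translation_linear[OF g] W Aop_right_translation[OF g] B, symmetric])
  moreover have "restrict_ell2 (carrier G) (?E (basis_vec g a)) = ?E (basis_vec g a)"
    using Aop.spectral_projection_commute[OF restrict_ell2_linear restrict_ell2_sym _ B, of "carrier G" "basis_vec g a"] g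
    by (simp add: Aop_carrier restrict_basis_vec)
  ultimately have "norm (?E (basis_vec \<one> a)) = norm (?E (basis_vec g a))"
    by (simp add: right_translation_norm[OF g])
  then show "emeasure (Aop.spectral_measure (basis_vec g a)) B = emeasure (Aop.spectral_measure (basis_vec \<one> a)) B"
    using B by (simp add: finite_measure.emeasure_eq_measure[OF Aop.finite_spectral_measure]
        Aop.measure_spectral_measure(2))
qed simp

text \<open>Integration against the averaged spectral measures, $\mu_m$ for \<open>X = X m\<close> and $\mu$.\<close>

definition local_mean :: "'z set \<Rightarrow> (real \<Rightarrow> real) \<Rightarrow> real" where
  "local_mean X f = 1 / real (card X)
     * (\<Sum>(x, a)\<in>X \<times> UNIV. \<integral>t. f t \<partial>Acomp.spectral_measure X (basis_vec (s x) a))"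

definition global_mean :: "(real \<Rightarrow> real) \<Rightarrow> real" where
  "global_mean f = (\<Sum>a\<in>UNIV. \<integral>t. f t \<partial>Aop.spectral_measure (basis_vec \<one> a))"

lemma global_mean_eq:
  assumes X: "finite X" "X \<noteq> {}" "X \<subseteq> carrier Z"
  shows "global_mean f = 1 / real (card X)
     * (\<Sum>(x, a)\<in>X \<times> UNIV. \<integral>t. f t \<partial>Aop.spectral_measure (basis_vec (s x) a))"
proof -
  have "(\<Sum>(x, a)\<in>X \<times> UNIV. \<integral>t. f t \<partial>Aop.spectral_measure (basis_vec (s x) a))
      = (\<Sum>x\<in>X. \<Sum>a\<in>UNIV. \<integral>t. f t \<partial>Aop.spectral_measure (basis_vec (s x) a))"
    by (rule sum.cartesian_product[symmetric])
  also have "\<dots> = (\<Sum>x\<in>X. global_mean f)"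
    unfolding global_mean_def
  proof (intro sum.cong refl)
    fix x a assume "x \<in> X"
    then have "s x \<in> carrier G" using X s by auto
    then show "(\<integral>t. f t \<partial>Aop.spectral_measure (basis_vec (s x) a))
        = (\<integral>t. f t \<partial>Aop.spectral_measure (basis_vec \<one> a))"
      by (rule arg_cong[OF spectral_measure_homogeneous])
  qed
  finally show ?thesis using X by simp
qed

text \<open>Away from the boundary the diagonal entries of the two $k$-th powers agree; near it, each of
  them is at most $R^k$.\<close>

lemma moment_difference:
  assumes X: "finite X" "X \<noteq> {}" "X \<subseteq> carrier Z"
  shows "\<bar>local_mean X (\<lambda>t. t ^ k) - global_mean (\<lambda>t. t ^ k)\<bar>
    \<le> 2 * R ^ k * real CARD('d) * (real (card (leaving Z (\<Union>j\<le>k. reach j) X)) / real (card X))"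
proof -
  let ?L = "leaving Z (\<Union>j\<le>k. reach j) X"
  let ?e = "\<lambda>(x, a). basis_vec (s x) a"
  let ?I = "X \<times> (UNIV :: 'd set)"
  define dif where "dif i = (Acomp X ^^ k) (?e i) \<bullet> ?e i - (Aop ^^ k) (?e i) \<bullet> ?e i" for i
  have "local_mean X (\<lambda>t. t ^ k) - global_mean (\<lambda>t. t ^ k) = 1 / real (card X) * (\<Sum>i\<in>?I. dif i)"
    unfolding local_mean_def global_mean_eq[OF X]
    by (simp add: Acomp.spectral_measure_moment Aop.spectral_measure_moment dif_def sum_subtractf
        right_diff_distrib case_prod_beta)
  moreover have "\<bar>\<Sum>i\<in>?I. dif i\<bar> \<le> (\<Sum>i\<in>?I. if i \<in> ?L \<times> UNIV then 2 * R ^ k else 0)"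
  proof (rule order_trans[OF sum_abs], rule sum_mono)
    fix i assume i: "i \<in> ?I"
    then obtain x a where xa: "i = (x, a)" "x \<in> X" by auto
    have sx: "s x \<in> carrier G" "p (s x) = x" using xa X s[of x] by auto
    show "\<bar>dif i\<bar> \<le> (if i \<in> ?L \<times> UNIV then 2 * R ^ k else 0)"
    proof (cases "x \<in> ?L")
      case False
      then show ?thesis
        using pow_Acomp[of "s x" X k k a] sx xa by (simp add: dif_def)
    next
      case True
      have "\<bar>(Acomp X ^^ k) (?e i) \<bullet> ?e i\<bar> \<le> R ^ k"
        using Cauchy_Schwarz_ineq2[of "(Acomp X ^^ k) (?e i)" "?e i"] Acomp.pow_norm_le[where X = X and k = k and x = "?e i"]
        by (simp add: xa norm_basis_vec)
      moreover have "\<bar>(Aop ^^ k) (?e i) \<bullet> ?e i\<bar> \<le> R ^ k"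
        using Cauchy_Schwarz_ineq2[of "(Aop ^^ k) (?e i)" "?e i"] Aop.pow_norm_le[of k "?e i"]
        by (simp add: xa norm_basis_vec)
      ultimately show ?thesis using True xa unfolding dif_def by simp
    qed
  qed
  moreover have "(\<Sum>i\<in>?I. if i \<in> ?L \<times> UNIV then 2 * R ^ k else 0) = real (card ?L * CARD('d)) * (2 * R ^ k)"
  proof -
    have "?L \<subseteq> X" by (auto simp: leaving_def)
    then have "?I \<inter> ?L \<times> UNIV = ?L \<times> UNIV" by auto
    then show ?thesis using X by (simp add: sum.If_cases card_cartesian_product)
  qed
  ultimately have "\<bar>local_mean X (\<lambda>t. t ^ k) - global_mean (\<lambda>t. t ^ k)\<bar>
      \<le> 1 / real (card X) * (real (card ?L * CARD('d)) * (2 * R ^ k))"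
    by (simp add: abs_mult mult_left_mono divide_right_mono)
  then show ?thesis by (simp add: mult_ac)
qed

text \<open>The kernel estimate applies to the compression of $A-l$, with the projection onto the
  functions over the inner boundary in the role of \<open>D\<close>: for $Ay = ly$ one has
  $P(A-l)Py = -PA(1-P)y$, and a point of $p^{-1}(X)$ at which this is non-zero is joined by a step
  of \<open>A\<close> to a point outside.\<close>

lemma atom_lower_bound:
  assumes X: "finite X" "X \<noteq> {}" "X \<subseteq> carrier Z"
  shows "local_mean X (indicator {l}) \<ge> global_mean (indicator {l})
    - real CARD('d) * (real (card (leaving Z trans_supp X)) / real (card X))"
proof -
  let ?S = "preimage G p X"
  let ?L = "leaving Z trans_supp X"
  let ?I = "X \<times> (UNIV :: 'd set)"
  define e where "e = (\<lambda>(x, a :: 'd). basis_vec (s x) a)"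
  define P where "P = (restrict_ell2 ?S :: ('g, complex ^ 'd) ell2 \<Rightarrow> _)"
  define D where "D = (restrict_ell2 (preimage G p ?L) :: ('g, complex ^ 'd) ell2 \<Rightarrow> _)"
  define B where "B v = Acomp X v - l *\<^sub>R P v" for v
  define Q where "Q = Aop.spectral_projection {l}"
  define N where "N = Acomp.spectral_projection X {l}"
  have LX: "?L \<subseteq> X" by (auto simp: leaving_def)
  have sx: "s x \<in> carrier G" "p (s x) = x" "s x \<in> preimage G p Y \<longleftrightarrow> x \<in> Y" if "x \<in> X" for x Y
    using that X s[of x] by (auto simp: preimage_def)
  interpret P: bounded_linear P unfolding P_def by (rule restrict_ell2_linear)
  have "(\<Sum>i\<in>?I. (norm (Q (e i)))\<^sup>2) \<le> (\<Sum>i\<in>?I. (norm (N (e i)))\<^sup>2) + real (card (?L \<times> (UNIV :: 'd set)))"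
  proof (rule kernel_trace_estimate[where \<W> = "symmetries X" and B = B and D = D and P = P])
    show "finite ?I" using X by simp
    show "?L \<times> UNIV \<subseteq> ?I" using LX by auto
    show "norm (e i) = 1" if "i \<in> ?I" for i by (auto simp: e_def norm_basis_vec split: prod.splits)
    show "(\<Sum>i\<in>?I. (norm (U (e i)))\<^sup>2) = (\<Sum>i\<in>?I. (norm (V (e i)))\<^sup>2)"
      if "U \<in> commutant (symmetries X)" "V \<in> commutant (symmetries X)" "\<And>x y. U x \<bullet> y = x \<bullet> V y" for U V
      using trace_symmetric[OF X(1,3) that] by (simp add: e_def sum.cartesian_product case_prod_beta)
    show "B \<in> commutant (symmetries X)"
      unfolding B_def[abs_def] P_def
      by (rule commutant_add(2)[OF Acomp_in_commutant scaleR_in_commutant[OF restrict_preimage_in_commutant] symmetries_linear])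
    show "B x \<bullet> y = x \<bullet> B y" for x y
      by (simp add: B_def inner_diff Acomp_sym P_def restrict_ell2_sym)
    show "D \<in> commutant (symmetries X)" unfolding D_def by (rule restrict_preimage_in_commutant)
    show "D x \<bullet> y = x \<bullet> D y" for x y by (simp add: D_def restrict_ell2_sym)
    show "D (D x) = D x" for x by (simp add: D_def restrict_ell2_restrict)
    show "D (e i) = 0" if "i \<in> ?I - ?L \<times> UNIV" for i
    proof -
      obtain x a where "i = (x, a)" "x \<in> X" "x \<notin> ?L" using \<open>i \<in> ?I - ?L \<times> UNIV\<close> by auto
      then show ?thesis using sx(3)[of x ?L] by (simp add: e_def D_def restrict_basis_vec)
    qed
    show "P \<in> symmetries X" by (simp add: P_def symmetries_def)
    show "P x \<bullet> y = x \<bullet> P y" for x y by (simp add: P_def restrict_ell2_sym)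
    show "P (P x) = P x" for x by (simp add: P_def restrict_ell2_restrict)
    show "P (e i) = e i" if "i \<in> ?I" for i
      using that sx by (auto simp: e_def P_def restrict_basis_vec)
    show "Q x \<bullet> y = x \<bullet> Q y" for x y by (simp add: Q_def Aop.spectral_projection_sym)
    show "Q (Q x) = Q x" for x
      using Aop.spectral_projection_Int[of "{l}" "{l}" x] by (simp add: Q_def)
    show "N x \<bullet> y = x \<bullet> N y" for x y by (simp add: N_def Acomp.spectral_projection_sym)
    show "N (N x) = N x" for x
      using Acomp.spectral_projection_Int[where B = "{l}" and C = "{l}" and X = X and x = x] by (simp add: N_def)
    show "N x = x" if "P x = x" "B x = 0" for x
      unfolding N_def by (rule Acomp.spectral_projection_of_eigen) (use that in \<open>simp add: B_def\<close>)
    show "D (B (P (Q x))) = B (P (Q x))" for x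
    proof -
      define y where "y = Q x"
      have eig: "Aop y = l *\<^sub>R y" unfolding y_def Q_def by (rule Aop.spectral_projection_eigen)
      have PP: "P (P v) = P v" for v by (simp add: P_def restrict_ell2_restrict)
      have "B (P y) = P (Aop (P y)) - P (l *\<^sub>R y)"
        by (simp add: B_def Acomp_def PP P.scaleR flip: P_def)
      also have "\<dots> = - P (Aop (y - P y))"
        by (simp add: eig[symmetric] Aop.T.diff P.diff)
      finally have By: "B (P y) = - P (Aop (y - P y))" .
      have "ell2_fun (P (Aop (y - P y))) z = 0" if z: "z \<notin> preimage G p ?L" for z
      proof (rule ccontr)
        assume nz: "ell2_fun (P (Aop (y - P y))) z \<noteq> 0"
        then have zS: "z \<in> ?S" and "ell2_fun (Aop (y - P y)) z \<noteq> 0"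
          by (auto simp: P_def split: if_splits)
        then obtain g where zG: "z \<in> carrier G" and g: "g \<in> supp" "ell2_fun (y - P y) (inv g \<otimes> z) \<noteq> 0"
          using Aop_support by blast
        then have out: "inv g \<otimes> z \<notin> ?S" by (auto simp: P_def split: if_splits)
        have gG: "g \<in> carrier G" using g(1) by (rule supp_carrier)
        have "p (inv g \<otimes> z) = p z \<otimes>\<^bsub>Z\<^esub> inv\<^bsub>Z\<^esub> (p g)"
          using gG zG by (simp add: p_mult p_inv p_closed Z.m_comm)
        then have "p z \<otimes>\<^bsub>Z\<^esub> inv\<^bsub>Z\<^esub> (p g) \<notin> X"
          using out gG zG by (simp add: preimage_def)
        then have "p z \<in> ?L" using g(1) zS by (auto simp: leaving_def preimage_def)
        with z zG show False by (simp add: preimage_def)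
      qed
      then have "restrict_ell2 (preimage G p ?L) (B (P y)) = B (P y)"
        unfolding By restrict_ell2_eq_self_iff by simp
      then show ?thesis by (simp add: D_def y_def)
    qed
    show "bounded_linear W" if "W \<in> symmetries X" for W :: "('g, complex ^ 'd) ell2 \<Rightarrow> _"
      using that by (rule symmetries_linear)
    show "\<exists>W'. \<forall>x y. W x \<bullet> y = x \<bullet> W' y" if "W \<in> symmetries X"
      for W :: "('g, complex ^ 'd) ell2 \<Rightarrow> ('g, complex ^ 'd) ell2"
      using that by (rule symmetries_adjoint)
  qed
  then have "(\<Sum>i\<in>?I. measure (Aop.spectral_measure (e i)) {l})
      \<le> (\<Sum>i\<in>?I. measure (Acomp.spectral_measure X (e i)) {l}) + real CARD('d) * real (card ?L)"
    by (simp add: Q_def N_def Aop.measure_spectral_measure(2) Acomp.measure_spectral_measure(2)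
        card_cartesian_product mult.commute)
  from mult_left_mono[OF this, of "1 / real (card X)"]
  show ?thesis
    unfolding local_mean_def global_mean_eq[OF X]
    by (simp add: e_def case_prod_beta add_divide_distrib)
qed

theorem local_mean_tendsto:
  assumes S: "finite_generating_set Z S" and X: "folner_exhaustion Z S X"
  shows "(\<lambda>m. local_mean (X m) (indicator {..l})) \<longlonglongrightarrow> global_mean (indicator {..l})"
proof -
  have Xm: "finite (X m)" "X m \<noteq> {}" "X m \<subseteq> carrier Z" for m
    using X by (auto simp: folner_exhaustion_def)
  have vanish: "(\<lambda>m. c * (real (card (leaving Z F (X m))) / real (card (X m)))) \<longlonglongrightarrow> 0"
    if "finite F" "F \<subseteq> carrier Z" for c F
    using tendsto_mult_right_zero[OF Z.leaving_ratio_tendsto[OF S X that]] by simp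
  show ?thesis
  proof (rule distribution_function_tendsto[where R = R and J = UNIV
        and M = "\<lambda>a. Aop.spectral_measure (basis_vec \<one> a)"])
    have "positive_functional R (\<lambda>f. 1 / real (card (X m)) *
        (\<Sum>i\<in>X m \<times> UNIV. \<integral>t. f t \<partial>(case i of (x, a) \<Rightarrow> Acomp.spectral_measure (X m) (basis_vec (s x) a))))" for m
      by (rule positive_functional_integrals) (auto simp: Acomp.spectral_measure split: prod.splits)
    then show "positive_functional R (local_mean (X m))" for m
      unfolding local_mean_def[abs_def] by (simp add: case_prod_beta)
    show "(\<lambda>m. local_mean (X m) (\<lambda>t. t ^ k)) \<longlonglongrightarrow> global_mean (\<lambda>t. t ^ k)" for k
    proof -
      have "(\<lambda>m. local_mean (X m) (\<lambda>t. t ^ k) - global_mean (\<lambda>t. t ^ k)) \<longlonglongrightarrow> 0"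
      proof (rule Lim_null_comparison)
        show "\<forall>\<^sub>F m in sequentially. norm (local_mean (X m) (\<lambda>t. t ^ k) - global_mean (\<lambda>t. t ^ k))
            \<le> 2 * R ^ k * real CARD('d) * (real (card (leaving Z (\<Union>j\<le>k. reach j) (X m))) / real (card (X m)))"
          using moment_difference[OF Xm] by (intro always_eventually) simp
        show "(\<lambda>m. 2 * R ^ k * real CARD('d) * (real (card (leaving Z (\<Union>j\<le>k. reach j) (X m))) / real (card (X m)))) \<longlonglongrightarrow> 0"
          using reach by (intro vanish) auto
      qed
      then show ?thesis by (rule LIM_zero_cancel)
    qed
    fix \<epsilon> :: real assume "\<epsilon> > 0"
    have "(\<lambda>m. real CARD('d) * (real (card (leaving Z trans_supp (X m))) / real (card (X m)))) \<longlonglongrightarrow> 0"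
      by (rule vanish[OF trans_supp])
    then have "\<forall>\<^sub>F m in sequentially. real CARD('d) * (real (card (leaving Z trans_supp (X m))) / real (card (X m))) < \<epsilon>"
      using \<open>\<epsilon> > 0\<close> by (rule order_tendstoD)
    then show "\<forall>\<^sub>F m in sequentially. local_mean (X m) (indicator {l}) \<ge> global_mean (indicator {l}) - \<epsilon>"
    proof eventually_elim
      case (elim m)
      then show ?case using atom_lower_bound[OF Xm[of m], of l] by linarith
    qed
  qed (auto simp: Aop.spectral_measure global_mean_def)
qed

lemma local_trace_eq:
  assumes X: "finite X" "X \<subseteq> carrier Z"
  shows "local_trace s X (borel_calculus (preimage G p X)
      (compression (preimage G p X) (twisted_action G \<sigma> A)) (indicator {..l}))
    = complex_of_real (local_mean X (indicator {..l}))"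
proof -
  let ?S = "preimage G p X"
  let ?Q = "borel_calculus ?S (compression ?S (twisted_action G \<sigma> A)) (indicator {..l})"
  have "matrix_entry ?Q a a (s x) (s x)
      = complex_of_real (measure (Acomp.spectral_measure X (basis_vec (s x) a)) {..l})" if x: "x \<in> X" for x a
  proof -
    have "s x \<in> ?S" using x X s[of x] by (auto simp: preimage_def)
    then have "restrict_ell2 ?S (basis_vec (s x) a) = basis_vec (s x) a"
      by (simp add: restrict_basis_vec)
    from borel_calculus_indicator[OF self_adjoint_compression _ R(2) this, of l]
    show ?thesis
      unfolding ell2_op_compression by (simp add: matrix_entry_def ell2_fun_basis_vec Acomp_bound[OF R])
  qed
  then show ?thesis
    unfolding local_trace_def local_mean_def sum.swap[of _ X UNIV]
    by (simp add: sum.cartesian_product[symmetric])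
qed

lemma vn_trace_eq:
  "vn_trace G (borel_calculus (carrier G) (twisted_action G \<sigma> A) (indicator {..l}))
    = complex_of_real (global_mean (indicator {..l}))"
proof -
  let ?Q = "borel_calculus (carrier G) (twisted_action G \<sigma> A) (indicator {..l})"
  have "matrix_entry ?Q a a \<one> \<one> = complex_of_real (measure (Aop.spectral_measure (basis_vec \<one> a)) {..l})" for a
  proof -
    have "restrict_ell2 (carrier G) (basis_vec \<one> a) = basis_vec \<one> a"
      by (simp add: restrict_basis_vec)
    from borel_calculus_indicator[OF sa _ R(2) this, of l]
    show ?thesis
      using R(1) by (simp add: matrix_entry_def ell2_fun_basis_vec flip: Aop_def)
  qed
  then show ?thesis by (simp add: vn_trace_def global_mean_def)
qed

end

theorem spectral_distribution_tendsto:
  assumes S: "finite_generating_set Z S" and X: "folner_exhaustion Z S X"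
  shows "(\<lambda>m. local_trace s (X m) (borel_calculus (preimage G p (X m))
      (compression (preimage G p (X m)) (twisted_action G \<sigma> A)) (indicator {..l})))
    \<longlonglongrightarrow> vn_trace G (borel_calculus (carrier G) (twisted_action G \<sigma> A) (indicator {..l}))"
proof -
  obtain R where R: "\<And>v. norm (Aop v) \<le> R * norm v" "R > 0" using Aop_bound by blast
  have Xm: "finite (X m)" "X m \<subseteq> carrier Z" for m
    using X by (auto simp: folner_exhaustion_def)
  show ?thesis
    unfolding local_trace_eq[OF R Xm] vn_trace_eq[OF R]
    by (intro tendsto_of_real local_mean_tendsto[OF R S X])
qed

end

text \<open>The abelianisation $p$ exhibits the surface group as an extension of the abelian group
  $\mathbb Z^{2g}$; the commutator subgroup plays the role of \<open>H\<close>.\<close>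

theorem corollary7p8:
  fixes M :: "'x topology" and \<A> :: "('x set \<times> ('x \<Rightarrow> complex)) set" and x0 :: 'x
    and g :: nat
    and \<Gamma> :: "'g monoid"
    and p :: "'g \<Rightarrow> (nat \<Rightarrow>\<^sub>0 int)"
    and s :: "(nat \<Rightarrow>\<^sub>0 int) \<Rightarrow> 'g"
    and S :: "(nat \<Rightarrow>\<^sub>0 int) set"
    and X :: "nat \<Rightarrow> (nat \<Rightarrow>\<^sub>0 int) set"
    and \<sigma> :: "'g \<Rightarrow> 'g \<Rightarrow> complex"
    and A :: "'g \<Rightarrow> complex ^ 'd ^ 'd::finite"
  assumes "closed_riemann_surface M \<A>" and "has_genus M g" and "g > 1"
    and "x0 \<in> topspace M" and "group \<Gamma>" and "\<Gamma> \<cong> fundamental_group M x0"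
    and "p \<in> epi \<Gamma> (int_lattice (2 * g))"
    and "kernel \<Gamma> (int_lattice (2 * g)) p = derived \<Gamma> (carrier \<Gamma>)"
    and "\<forall>z\<in>carrier (int_lattice (2 * g)). s z \<in> carrier \<Gamma> \<and> p (s z) = z"
    and "multiplier \<Gamma> \<sigma>"
    and "A \<in> group_algebra_matrices \<Gamma>"
    and "self_adjoint_on (carrier \<Gamma>) (twisted_action \<Gamma> \<sigma> A)"
    and "finite_generating_set (int_lattice (2 * g)) S"
    and "folner_exhaustion (int_lattice (2 * g)) S X"
  shows "\<forall>lam::real.
    (\<lambda>m. local_trace s (X m)
           (borel_calculus (preimage \<Gamma> p (X m))
              (compression (preimage \<Gamma> p (X m)) (twisted_action \<Gamma> \<sigma> A))
              (indicator {..lam})))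
    \<longlonglongrightarrow> vn_trace \<Gamma> (borel_calculus (carrier \<Gamma>) (twisted_action \<Gamma> \<sigma> A) (indicator {..lam}))"
proof
  fix lam :: real
  have "p \<in> hom \<Gamma> (int_lattice (2 * g))" using assms(7) by (simp add: epi_def)
  then interpret twisted_operator \<Gamma> "int_lattice (2 * g)" p s \<sigma> A
    by (intro twisted_operator.intro twisted_extension.intro twisted_operator_axioms.intro
        abelian_free_Abelian_group) (use assms in auto)
  show "(\<lambda>m. local_trace s (X m)
           (borel_calculus (preimage \<Gamma> p (X m))
              (compression (preimage \<Gamma> p (X m)) (twisted_action \<Gamma> \<sigma> A))
              (indicator {..lam})))
    \<longlonglongrightarrow> vn_trace \<Gamma> (borel_calculus (carrier \<Gamma>) (twisted_action \<Gamma> \<sigma> A) (indicator {..lam}))"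
    by (rule spectral_distribution_tendsto[OF assms(13,14)])
qed

end
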